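(* The operad $\Lambda\mathsf{As}$ (with the canonical map $\Lambda\mathsf{Lie}_\infty\to\Lambda\mathsf{Lie}\to\Lambda\mathsf{As}$) is naturally a $\mathrm{Tw}$-coalgebra. Furthermore, $\Lambda\mathsf{As}$ is a homotopy fixed point for the functor $\mathrm{Tw}$.
   Context: **Conventions.** $\mathbb K$ is a field of characteristic zero. A dg operad is a unital symmetric operad in unbounded cochain complexes over $\mathbb K$ (differentials of degree $+1$), with elementary insertions $\circ_i$; quasi-isomorphisms are arity-wise. $\mathbf s$ raises degree by one. $\mathrm{Sh}_{p,q}\subset S_{p+q}$ is the set of $\sigma$ with $\sigma(1)<\dots<\sigma(p)$ and $\sigma(p+1)<\dots<\sigma(p+q)$. For $v\in\mathcal O(k)$, $w\in\mathcal O(m)$, an expression $v(i_1,\dots,w(j_1,\dots,j_m),\dots)$ in which each of $1,\dots,k+m-1$ occurs once denotes the operadic composite with inputs labelled as displayed. **Operads.** $\mathsf{As}$ governs associative algebras without unit; $\mathsf{Lie}$ governs Lie algebras; $\Lambda\mathcal P(n)=\mathbf s^{1-n}\mathcal P(n)\otimes\mathrm{sgn}_n$ for an operad $\mathcal P$. Thus a $\Lambda\mathsf{As}$-algebra has a degree $-1$ product with $(v_1\cdot v_2)\cdot v_3=-(-1)^{|v_1|}v_1\cdot(v_2\cdot v_3)$, and a $\Lambda\mathsf{Lie}$-algebra has a degree $-1$ graded symmetric bracket satisfying the Jacobi identity. The map $\Lambda\mathsf{Lie}\to\Lambda\mathsf{As}$ is $\Lambda$ applied to $\mathsf{Lie}\to\mathsf{As}$,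 $[x_1,x_2]\mapsto x_1x_2-x_2x_1$. $\Lambda\mathsf{Lie}_\infty$ is the dg operad free as a graded operad on $S_n$-invariant generators $\lambda_n$, arity $n\ge2$, degree $3-2n$, with $\partial\lambda_n=-\sum_{p=2}^{n-1}\sum_{\sigma\in\mathrm{Sh}_{p,n-p}}\sigma(\lambda_{n-p+1}\circ_1\lambda_p)$; the map $\Lambda\mathsf{Lie}_\infty\to\Lambda\mathsf{Lie}$ sends $\lambda_2$ to the bracket and $\lambda_n$ to $0$ for $n\ge3$. **$\mathrm{Tw}$.** Given $\hat\varphi:\Lambda\mathsf{Lie}_\infty\to\mathcal O$, put $\varphi_n=\hat\varphi(\lambda_n)$ for $n\ge2$, $\varphi_1=0$. $\mathrm{Tw}\,\mathcal O(n)=\prod_{r\ge0}\mathbf s^{2r}(\mathcal O(r+n))^{S_r}$, where $S_r\subset S_{r+n}$ permutes the first $r$ letters: a homogeneous $f$ is a sequence $(f_r)_{r\ge0}$ with $f_r\in\mathcal O(r+n)^{S_r}$ of degree $|f|-2r$. $S_n$ acts on the last $n$ inputs; the unit is $(u_{\mathcal O},0,0,\dots)$; for $f\in\mathrm{Tw}\,\mathcal O(n)$, $g\in\mathrm{Tw}\,\mathcal O(m)$, $$(f\circ_ig)_r=\sum_{p=0}^r\sum_{\sigma\in\mathrm{Sh}_{p,r-p}}f_p(\sigma(1),\dots,\sigma(p),r+1,\dots,r+i-1,g_{r-p}(\sigma(p+1),\dots,\sigma(r),r+i,\dots,r+i+m-1),r+i+m,\dots,r+n+m-1).$$ With $\kappa\in\mathrm{Tw}\,\mathcal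 O(1)$, $\kappa_r=\varphi_{r+1}$, $$(\partial^{\mathrm{Tw}}f)_r=\partial^{\mathcal O}f_r-(-1)^{|f|}\sum_{p=1}^r\sum_{\sigma\in\mathrm{Sh}_{p,r-p}}f_{r-p+1}(\varphi_p(\sigma(1),\dots,\sigma(p)),\sigma(p+1),\dots,\sigma(r),r+1,\dots,r+n)+(\kappa\circ_1f)_r-(-1)^{|f|}\sum_{i=1}^n(f\circ_i\kappa)_r.$$ $\beta_{\mathcal O}(\lambda_n)_r=\varphi_{r+n}$ defines $\beta_{\mathcal O}:\Lambda\mathsf{Lie}_\infty\to\mathrm{Tw}\,\mathcal O$; $(\mathrm{Tw}\,G)(f)_r=G(f_r)$; $\eta_{\mathcal O}(f)=f_0$; $((\mathfrak D_{\mathcal O}f)_r)_s=f_{s+r}$. A $\mathrm{Tw}$-coalgebra structure on $\hat\varphi$ is a dg operad map $c:\mathcal O\to\mathrm{Tw}\,\mathcal O$ with $c\hat\varphi=\beta_{\mathcal O}$, $\eta_{\mathcal O}c=\mathrm{id}$, $\mathrm{Tw}(c)\,c=\mathfrak D_{\mathcal O}\,c$. $\mathcal O$ is a homotopy fixed point for $\mathrm{Tw}$ if $\eta_{\mathcal O}:\mathrm{Tw}\,\mathcal O\to\mathcal O$ is a quasi-isomorphism. The natural coalgebra structure meant here is the embedding $v\mapsto(v,0,0,\dots)$. *)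

theory Defs
  imports
    Complex_Main
    "HOL-Combinatorics.Permutations"
    "HOL-Library.Function_Algebras"
    "HOL-Library.Poly_Mapping"
begin

definition sg :: "int \<Rightarrow> 'a::ab_group_add \<Rightarrow> 'a" where
  "sg e x = (if even e then x else - x)"

text \<open>The vector space with basis \<^typ>\<open>'b\<close> is the type of finitely supported functions; \<open>pscale\<close> is
  its scalar multiplication. \<open>lin s f\<close> extends \<open>f\<close> linearly to a space with scalar multiplication
  \<open>s\<close>.\<close>

definition pscale :: "'k::field \<Rightarrow> ('b \<Rightarrow>\<^sub>0 'k) \<Rightarrow> ('b \<Rightarrow>\<^sub>0 'k)" where
  "pscale c x = Poly_Mapping.map (\<lambda>a. c * a) x"

definition lin :: "('k::field \<Rightarrow> 'v \<Rightarrow> 'v) \<Rightarrow> ('b \<Rightarrow> 'v::ab_group_add) \<Rightarrow> ('b \<Rightarrow>\<^sub>0 'k) \<Rightarrow> 'v" where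
  "lin s f x = (\<Sum>b\<in>Poly_Mapping.keys x. s (Poly_Mapping.lookup x b) (f b))"

definition bilin :: "('b \<Rightarrow> 'c \<Rightarrow> ('d \<Rightarrow>\<^sub>0 'k::field)) \<Rightarrow> ('b \<Rightarrow>\<^sub>0 'k) \<Rightarrow> ('c \<Rightarrow>\<^sub>0 'k) \<Rightarrow> ('d \<Rightarrow>\<^sub>0 'k)" where
  "bilin f x y = lin pscale (\<lambda>b. lin pscale (f b) y) x"

lemma lookup_pscale: "Poly_Mapping.lookup (pscale c x) b = c * Poly_Mapping.lookup x b"
  by (simp add: pscale_def Poly_Mapping.map.rep_eq when_def)

global_interpretation free_vs: vector_space "pscale :: 'k::field \<Rightarrow> ('b \<Rightarrow>\<^sub>0 'k) \<Rightarrow> _"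
  by unfold_locales
    (auto intro!: poly_mapping_eqI simp: lookup_pscale lookup_add algebra_simps)

text \<open>A type of monomials with a set of linear relations (with integer coefficients) presents a
  vector space \<open>('b, 'k) pres\<close> over every field \<open>'k\<close>, with quotient map \<open>abs_pres\<close>.\<close>

class presented =
  fixes relators :: "('a \<Rightarrow>\<^sub>0 int) set"

definition rel_span :: "('b::presented \<Rightarrow>\<^sub>0 'k::field) set" where
  "rel_span = free_vs.span (Poly_Mapping.map of_int ` relators)"

quotient_type (overloaded) ('b, 'k) pres = "'b::presented \<Rightarrow>\<^sub>0 'k::field"
  / "\<lambda>x y. x - y \<in> rel_span"
proof (rule equivpI)
  show "reflp (\<lambda>x y. x - y \<in> (rel_span :: ('b \<Rightarrow>\<^sub>0 'k) set))"
    by (simp add: reflp_def rel_span_def free_vs.span_zero)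
  show "symp (\<lambda>x y. x - y \<in> (rel_span :: ('b \<Rightarrow>\<^sub>0 'k) set))"
    unfolding symp_def rel_span_def by (metis free_vs.span_neg minus_diff_eq)
  show "transp (\<lambda>x y. x - y \<in> (rel_span :: ('b \<Rightarrow>\<^sub>0 'k) set))"
    unfolding transp_def rel_span_def
  proof (intro allI impI)
    fix x y z :: "'b \<Rightarrow>\<^sub>0 'k" let ?S = "free_vs.span (Poly_Mapping.map of_int ` (relators :: ('b \<Rightarrow>\<^sub>0 int) set))"
    assume "x - y \<in> ?S" "y - z \<in> ?S"
    from free_vs.span_add[OF this] show "x - z \<in> ?S" by simp
  qed
qed

instantiation pres :: (presented, field) ab_group_add
begin

lift_definition zero_pres :: "('a, 'b) pres" is 0 .

lift_definition plus_pres :: "('a, 'b) pres \<Rightarrow> ('a, 'b) pres \<Rightarrow> ('a, 'b) pres" is "(+)"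
  unfolding rel_span_def by (drule (1) free_vs.span_add) (simp add: algebra_simps)

lift_definition uminus_pres :: "('a, 'b) pres \<Rightarrow> ('a, 'b) pres" is uminus
  unfolding rel_span_def by (drule free_vs.span_neg) (simp add: algebra_simps)

lift_definition minus_pres :: "('a, 'b) pres \<Rightarrow> ('a, 'b) pres \<Rightarrow> ('a, 'b) pres" is "(-)"
  unfolding rel_span_def by (drule (1) free_vs.span_diff) (simp add: algebra_simps)

instance
  by standard (transfer, simp add: rel_span_def free_vs.span_zero algebra_simps)+

end

lift_definition qscale :: "'k::field \<Rightarrow> ('b::presented, 'k) pres \<Rightarrow> ('b, 'k) pres" is pscale
  unfolding rel_span_def by (simp add: free_vs.span_scale flip: free_vs.scale_right_diff_distrib)

text \<open>In all uses below the relations are homogeneous, so that an element of a component of the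
  quotient has a representative supported on the monomials \<open>B\<close> of that component; the operations
  are defined on such representatives and do not depend on the one chosen.\<close>

definition hrep :: "'b set \<Rightarrow> ('b::presented, 'k::field) pres \<Rightarrow> ('b \<Rightarrow>\<^sub>0 'k)" where
  "hrep B x = (SOME y. Poly_Mapping.keys y \<subseteq> B \<and> abs_pres y = x)"

text \<open>Permutations act from the left by relabelling inputs: $\sigma v = v(\sigma(1),\dots,\sigma(n))$.
  So \<open>v(l\<^sub>1,\<dots>,l\<^sub>n)\<close> is the action of \<open>list_perm [l\<^sub>1,\<dots>,l\<^sub>n]\<close> on \<open>v\<close>.\<close>

definition list_perm :: "nat list \<Rightarrow> nat \<Rightarrow> nat" where
  "list_perm ls j = (if 1 \<le> j \<and> j \<le> length ls then ls ! (j - 1) else j)"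

definition Sh :: "nat \<Rightarrow> nat \<Rightarrow> (nat \<Rightarrow> nat) set" where
  "Sh p q = {\<sigma>. \<sigma> permutes {1..p + q} \<and> strict_mono_on {1..p} \<sigma> \<and> strict_mono_on {p + 1..p + q} \<sigma>}"

text \<open>\<open>carr P n d\<close> is the degree \<open>d\<close> component of $P(n)$, and the other operations are families
  indexed by arities and degrees: \<open>ins P n d m e i v w\<close> is $v\circ_i w$ for $v\in P(n)^d$,
  $w\in P(m)^e$; \<open>act P n d \<sigma>\<close> is the action of $\sigma\in S_n$ on $P(n)^d$; \<open>dif P n d\<close> is the differential
  $P(n)^d\to P(n)^{d+1}$. Addition is that of the ambient type.\<close>

record ('k, 'a) dgop =
  carr :: "nat \<Rightarrow> int \<Rightarrow> 'a set"
  scl :: "'k \<Rightarrow> 'a \<Rightarrow> 'a"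
  ins :: "nat \<Rightarrow> int \<Rightarrow> nat \<Rightarrow> int \<Rightarrow> nat \<Rightarrow> 'a \<Rightarrow> 'a \<Rightarrow> 'a"
  act :: "nat \<Rightarrow> int \<Rightarrow> (nat \<Rightarrow> nat) \<Rightarrow> 'a \<Rightarrow> 'a"
  dif :: "nat \<Rightarrow> int \<Rightarrow> 'a \<Rightarrow> 'a"
  unt :: 'a

definition linear_from ::
  "'a set \<Rightarrow> ('k \<Rightarrow> 'a \<Rightarrow> 'a) \<Rightarrow> ('k \<Rightarrow> 'b \<Rightarrow> 'b) \<Rightarrow> ('a::ab_group_add \<Rightarrow> 'b::ab_group_add) \<Rightarrow> bool" where
  "linear_from A s t F \<longleftrightarrow>
    (\<forall>x\<in>A. \<forall>y\<in>A. F (x + y) = F x + F y) \<and> (\<forall>c. \<forall>x\<in>A. F (s c x) = t c (F x))"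

text \<open>\<open>block_perm n m i \<sigma> \<tau>\<close> is the relabelling with
  $(\sigma v)\circ_{\sigma(i)}(\tau w)=\mathrm{block}(v\circ_i w)$.\<close>

definition block_perm :: "nat \<Rightarrow> nat \<Rightarrow> nat \<Rightarrow> (nat \<Rightarrow> nat) \<Rightarrow> (nat \<Rightarrow> nat) \<Rightarrow> nat \<Rightarrow> nat" where
  "block_perm n m i \<sigma> \<tau> = list_perm (concat (map
     (\<lambda>a. if a = i then map (\<lambda>b. \<sigma> i - 1 + \<tau> b) [1..<Suc m]
          else [if \<sigma> a < \<sigma> i then \<sigma> a else \<sigma> a + m - 1]) [1..<Suc n]))"

locale dg_operad = vector_space "scl P"
  for P :: "('k::field_char_0, 'a::ab_group_add) dgop" +
  assumes subspace_carr: "subspace (carr P n d)"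
    and unt_closed: "unt P \<in> carr P 1 0"
    and ins_closed: "\<lbrakk>v \<in> carr P n d; w \<in> carr P m e; i \<in> {1..n}\<rbrakk>
      \<Longrightarrow> ins P n d m e i v w \<in> carr P (n + m - 1) (d + e)"
    and act_closed: "\<lbrakk>v \<in> carr P n d; \<sigma> permutes {1..n}\<rbrakk> \<Longrightarrow> act P n d \<sigma> v \<in> carr P n d"
    and dif_closed: "v \<in> carr P n d \<Longrightarrow> dif P n d v \<in> carr P n (d + 1)"
    and ins_linear_left: "\<lbrakk>w \<in> carr P m e; i \<in> {1..n}\<rbrakk>
      \<Longrightarrow> linear_from (carr P n d) (scl P) (scl P) (\<lambda>v. ins P n d m e i v w)"
    and ins_linear_right: "\<lbrakk>v \<in> carr P n d; i \<in> {1..n}\<rbrakk>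
      \<Longrightarrow> linear_from (carr P m e) (scl P) (scl P) (\<lambda>w. ins P n d m e i v w)"
    and act_linear: "\<sigma> permutes {1..n} \<Longrightarrow> linear_from (carr P n d) (scl P) (scl P) (act P n d \<sigma>)"
    and dif_linear: "linear_from (carr P n d) (scl P) (scl P) (dif P n d)"
    and act_id: "v \<in> carr P n d \<Longrightarrow> act P n d id v = v"
    and act_comp: "\<lbrakk>v \<in> carr P n d; \<sigma> permutes {1..n}; \<tau> permutes {1..n}\<rbrakk>
      \<Longrightarrow> act P n d (\<sigma> \<circ> \<tau>) v = act P n d \<sigma> (act P n d \<tau> v)"
    and unit_left: "v \<in> carr P n d \<Longrightarrow> ins P 1 0 n d 1 (unt P) v = v"
    and unit_right: "\<lbrakk>v \<in> carr P n d; i \<in> {1..n}\<rbrakk> \<Longrightarrow> ins P n d 1 0 i v (unt P) = v"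
    and assoc_sequential:
      "\<lbrakk>u \<in> carr P n d; v \<in> carr P m e; w \<in> carr P q f; i \<in> {1..n}; j \<in> {1..m}\<rbrakk>
      \<Longrightarrow> ins P (n + m - 1) (d + e) q f (i + j - 1) (ins P n d m e i u v) w
        = ins P n d (m + q - 1) (e + f) i u (ins P m e q f j v w)"
    and assoc_parallel:
      "\<lbrakk>u \<in> carr P n d; v \<in> carr P m e; w \<in> carr P q f; 1 \<le> i; i < k; k \<le> n\<rbrakk>
      \<Longrightarrow> ins P (n + m - 1) (d + e) q f (k + m - 1) (ins P n d m e i u v) w
        = sg (e * f) (ins P (n + q - 1) (d + f) m e i (ins P n d q f k u w) v)"
    and equivariant:
      "\<lbrakk>v \<in> carr P n d; w \<in> carr P m e; i \<in> {1..n}; \<sigma> permutes {1..n}; \<tau> permutes {1..m}\<rbrakk>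
      \<Longrightarrow> ins P n d m e (\<sigma> i) (act P n d \<sigma> v) (act P m e \<tau> w)
        = act P (n + m - 1) (d + e) (block_perm n m i \<sigma> \<tau>) (ins P n d m e i v w)"
    and dif_dif: "v \<in> carr P n d \<Longrightarrow> dif P n (d + 1) (dif P n d v) = 0"
    and dif_unt: "dif P 1 0 (unt P) = 0"
    and dif_act: "\<lbrakk>v \<in> carr P n d; \<sigma> permutes {1..n}\<rbrakk>
      \<Longrightarrow> dif P n d (act P n d \<sigma> v) = act P n (d + 1) \<sigma> (dif P n d v)"
    and dif_ins: "\<lbrakk>v \<in> carr P n d; w \<in> carr P m e; i \<in> {1..n}\<rbrakk>
      \<Longrightarrow> dif P (n + m - 1) (d + e) (ins P n d m e i v w)
        = ins P n (d + 1) m e i (dif P n d v) w + sg d (ins P n d m (e + 1) i v (dif P m e w))"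

type_synonym ('a, 'b) gmap = "nat \<Rightarrow> int \<Rightarrow> 'a \<Rightarrow> 'b"

definition gcomp :: "('b, 'c) gmap \<Rightarrow> ('a, 'b) gmap \<Rightarrow> ('a, 'c) gmap" where
  "gcomp G F n d x = G n d (F n d x)"

definition dg_operad_map ::
  "('k, 'a::ab_group_add) dgop \<Rightarrow> ('k, 'b::ab_group_add) dgop \<Rightarrow> ('a, 'b) gmap \<Rightarrow> bool" where
  "dg_operad_map P Q F \<longleftrightarrow>
    (\<forall>n d. F n d ` carr P n d \<subseteq> carr Q n d) \<and>
    (\<forall>n d. linear_from (carr P n d) (scl P) (scl Q) (F n d)) \<and>
    F 1 0 (unt P) = unt Q \<and>
    (\<forall>n d m e i. \<forall>v\<in>carr P n d. \<forall>w\<in>carr P m e. i \<in> {1..n} \<longrightarrow>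
      F (n + m - 1) (d + e) (ins P n d m e i v w) = ins Q n d m e i (F n d v) (F m e w)) \<and>
    (\<forall>n d \<sigma>. \<forall>v\<in>carr P n d. \<sigma> permutes {1..n} \<longrightarrow>
      F n d (act P n d \<sigma> v) = act Q n d \<sigma> (F n d v)) \<and>
    (\<forall>n d. \<forall>v\<in>carr P n d. F n (d + 1) (dif P n d v) = dif Q n d (F n d v))"

definition cocycles :: "('k, 'a::ab_group_add) dgop \<Rightarrow> nat \<Rightarrow> int \<Rightarrow> 'a set" where
  "cocycles P n d = {x \<in> carr P n d. dif P n d x = 0}"

definition coboundaries :: "('k, 'a::ab_group_add) dgop \<Rightarrow> nat \<Rightarrow> int \<Rightarrow> 'a set" where
  "coboundaries P n d = dif P n (d - 1) ` carr P n (d - 1)"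

definition cohom_class :: "('k, 'a::ab_group_add) dgop \<Rightarrow> nat \<Rightarrow> int \<Rightarrow> 'a \<Rightarrow> 'a set" where
  "cohom_class P n d x = {y \<in> cocycles P n d. y - x \<in> coboundaries P n d}"

definition cohomology :: "('k, 'a::ab_group_add) dgop \<Rightarrow> nat \<Rightarrow> int \<Rightarrow> 'a set set" where
  "cohomology P n d = cohom_class P n d ` cocycles P n d"

definition cohom_map ::
  "('k, 'b::ab_group_add) dgop \<Rightarrow> ('a, 'b) gmap \<Rightarrow> nat \<Rightarrow> int \<Rightarrow> 'a set \<Rightarrow> 'b set" where
  "cohom_map Q F n d X = (\<Union>x\<in>X. cohom_class Q n d (F n d x))"

definition quasi_isomorphism ::
  "('k, 'a::ab_group_add) dgop \<Rightarrow> ('k, 'b::ab_group_add) dgop \<Rightarrow> ('a, 'b) gmap \<Rightarrow> bool" where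
  "quasi_isomorphism P Q F \<longleftrightarrow> dg_operad_map P Q F \<and>
    (\<forall>n d. bij_betw (cohom_map Q F n d) (cohomology P n d) (cohomology Q n d))"

text \<open>$\Lambda P(n)=\mathbf s^{1-n}P(n)\otimes\mathrm{sgn}_n$ is the arity-wise tensor product of $P$ with
  $n\mapsto\mathbb K e_n$, $|e_n|=1-n$, which is the endomorphism operad of a line in degree 1:
  $e_n\circ_i e_m=(-1)^{(i-1)(1-m)}e_{n+m-1}$, and $\sigma e_n=\mathrm{sgn}(\sigma)e_n$. An element \<open>v\<close> stands for
  $e_n\otimes v$, and $(e_n\otimes v)\circ_i(e_m\otimes w)=(-1)^{|v|(1-m)}(e_n\circ_i e_m)\otimes(v\circ_i w)$.
  Since $(e_2\circ_1 e_2)=-(e_2\circ_2 e_2)$, a $\Lambda\mathsf{As}$-algebra satisfies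
  $(v_1 v_2)v_3=-(-1)^{|v_1|}v_1(v_2v_3)$.\<close>

definition Lam :: "('k, 'a::ab_group_add) dgop \<Rightarrow> ('k, 'a) dgop" where
  "Lam P = (let s = (\<lambda>n::nat. 1 - int n) in \<lparr>
     carr = (\<lambda>n d. carr P n (d - s n)),
     scl = scl P,
     ins = (\<lambda>n d m e i v w. sg ((d - s n) * s m + (int i - 1) * s m)
              (ins P n (d - s n) m (e - s m) i v w)),
     act = (\<lambda>n d \<sigma> v. if evenperm \<sigma> then act P n (d - s n) \<sigma> v else - act P n (d - s n) \<sigma> v),
     dif = (\<lambda>n d v. sg (s n) (dif P n (d - s n) v)),
     unt = unt P \<rparr>)"

definition Lam_map :: "('a, 'b) gmap \<Rightarrow> ('a, 'b) gmap" where
  "Lam_map F n d = F n (d - (1 - int n))"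

text \<open>$\mathsf{As}(n)$, $n\ge1$, is the multilinear part of the free associative algebra on
  $x_1,\dots,x_n$; the word \<open>[l\<^sub>1,\<dots>,l\<^sub>n]\<close> is the monomial $x_{l_1}\cdots x_{l_n}$. There are
  no units, hence $\mathsf{As}(0)=0$.\<close>

definition as_words :: "nat \<Rightarrow> nat list set" where
  "as_words n = {w. w \<noteq> [] \<and> distinct w \<and> set w = {1..n}}"

definition word_subst :: "nat \<Rightarrow> nat \<Rightarrow> nat list \<Rightarrow> nat list \<Rightarrow> nat list" where
  "word_subst i m u w = concat (map (\<lambda>l. if l < i then [l]
     else if l = i then map (\<lambda>j. j + i - 1) u else [l + m - 1]) w)"

definition As :: "('k::field, nat list \<Rightarrow>\<^sub>0 'k) dgop" where
  "As = \<lparr>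
     carr = (\<lambda>n d. if d = 0 then {x. Poly_Mapping.keys x \<subseteq> as_words n} else {0}),
     scl = pscale,
     ins = (\<lambda>n d m e i. bilin (\<lambda>w u. Poly_Mapping.single (word_subst i m u w) 1)),
     act = (\<lambda>n d \<sigma>. lin pscale (\<lambda>w. Poly_Mapping.single (map \<sigma> w) 1)),
     dif = (\<lambda>n d x. 0),
     unt = Poly_Mapping.single [1] 1 \<rparr>"

text \<open>$\mathsf{Lie}(n)$ is the multilinear part of the free Lie algebra on $x_1,\dots,x_n$, which is
  the span of bracket monomials modulo the ideal generated by antisymmetry and the Jacobi identity.\<close>

datatype lie_mon = X nat | Br lie_mon lie_mon

primrec lie_leaves :: "lie_mon \<Rightarrow> nat list" where
  "lie_leaves (X j) = [j]"
| "lie_leaves (Br s t) = lie_leaves s @ lie_leaves t"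

primrec lie_bind :: "(nat \<Rightarrow> lie_mon) \<Rightarrow> lie_mon \<Rightarrow> lie_mon" where
  "lie_bind f (X j) = f j"
| "lie_bind f (Br s t) = Br (lie_bind f s) (lie_bind f t)"

inductive_set lie_relators :: "(lie_mon \<Rightarrow>\<^sub>0 int) set" where
  antisym: "Poly_Mapping.single (Br s t) 1 + Poly_Mapping.single (Br t s) 1 \<in> lie_relators"
| jacobi: "Poly_Mapping.single (Br r (Br s t)) 1 + Poly_Mapping.single (Br s (Br t r)) 1
    + Poly_Mapping.single (Br t (Br r s)) 1 \<in> lie_relators"
| left: "x \<in> lie_relators
    \<Longrightarrow> (\<Sum>s\<in>Poly_Mapping.keys x. Poly_Mapping.single (Br s t) (Poly_Mapping.lookup x s)) \<in> lie_relators"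
| right: "x \<in> lie_relators
    \<Longrightarrow> (\<Sum>s\<in>Poly_Mapping.keys x. Poly_Mapping.single (Br t s) (Poly_Mapping.lookup x s)) \<in> lie_relators"

instantiation lie_mon :: presented
begin
definition "relators_lie_mon = lie_relators"
instance ..
end

definition lie_mons :: "nat \<Rightarrow> lie_mon set" where
  "lie_mons n = {t. distinct (lie_leaves t) \<and> set (lie_leaves t) = {1..n}}"

definition lie_subst :: "nat \<Rightarrow> nat \<Rightarrow> lie_mon \<Rightarrow> lie_mon \<Rightarrow> lie_mon" where
  "lie_subst i m s = lie_bind (\<lambda>l. if l < i then X l
     else if l = i then lie_bind (\<lambda>j. X (j + i - 1)) s else X (l + m - 1))"

definition Lie :: "('k::field, (lie_mon, 'k) pres) dgop" where
  "Lie = \<lparr>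
     carr = (\<lambda>n d. if d = 0 then abs_pres ` {x. Poly_Mapping.keys x \<subseteq> lie_mons n} else {0}),
     scl = qscale,
     ins = (\<lambda>n d m e i x y. abs_pres (bilin (\<lambda>t s. Poly_Mapping.single (lie_subst i m s t) 1)
              (hrep (lie_mons n) x) (hrep (lie_mons m) y))),
     act = (\<lambda>n d \<sigma> x. abs_pres (lin pscale (\<lambda>t. Poly_Mapping.single (lie_bind (\<lambda>j. X (\<sigma> j)) t) 1)
              (hrep (lie_mons n) x))),
     dif = (\<lambda>n d x. 0),
     unt = abs_pres (Poly_Mapping.single (X 1) 1) \<rparr>"

definition lie_bracket :: "(lie_mon, 'k::field) pres" where
  "lie_bracket = abs_pres (Poly_Mapping.single (Br (X 1) (X 2)) 1)"

text \<open>The operad map with $[x_1,x_2]\mapsto x_1x_2-x_2x_1$ sends a bracket monomial to the iterated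
  commutator in the free associative algebra.\<close>

definition word_mult :: "(nat list \<Rightarrow>\<^sub>0 'k::field) \<Rightarrow> (nat list \<Rightarrow>\<^sub>0 'k) \<Rightarrow> (nat list \<Rightarrow>\<^sub>0 'k)" where
  "word_mult = bilin (\<lambda>u w. Poly_Mapping.single (u @ w) 1)"

primrec commutator :: "lie_mon \<Rightarrow> (nat list \<Rightarrow>\<^sub>0 'k::field)" where
  "commutator (X j) = Poly_Mapping.single [j] 1"
| "commutator (Br s t) =
     word_mult (commutator s) (commutator t) - word_mult (commutator t) (commutator s)"

definition Lie_to_As :: "((lie_mon, 'k::field) pres, nat list \<Rightarrow>\<^sub>0 'k) gmap" where
  "Lie_to_As n d x = lin pscale commutator (hrep (lie_mons n) x)"

text \<open>Monomials in the generators are planar rooted trees with labelled leaves; a vertex with \<open>k\<close>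
  children is $\lambda_k$, and \<open>Nd [t\<^sub>1,\<dots>,t\<^sub>k]\<close> is $\lambda_k(t_1,\dots,t_k)$. The vertices of a tree are
  multiplied in depth-first order, root first and children from left to right. The symmetry of the
  generators gives the relations that exchange neighbouring children \<open>s\<close>, \<open>t\<close> of a vertex with the
  Koszul sign $(-1)^{|s||t|}$.\<close>

datatype ltree = Lf nat | Nd "ltree list"

fun leaves :: "ltree \<Rightarrow> nat list" where
  "leaves (Lf j) = [j]"
| "leaves (Nd ts) = concat (map leaves ts)"

fun tdeg :: "ltree \<Rightarrow> int" where
  "tdeg (Lf j) = 0"
| "tdeg (Nd ts) = 3 - 2 * int (length ts) + sum_list (map tdeg ts)"

fun stable :: "ltree \<Rightarrow> bool" where
  "stable (Lf j) = True"
| "stable (Nd ts) = (2 \<le> length ts \<and> (\<forall>t\<in>set ts. stable t))"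

fun tbind :: "(nat \<Rightarrow> ltree) \<Rightarrow> ltree \<Rightarrow> ltree" where
  "tbind f (Lf j) = f j"
| "tbind f (Nd ts) = Nd (map (tbind f) ts)"

inductive exchange :: "ltree \<Rightarrow> ltree \<Rightarrow> int \<Rightarrow> bool" where
  here: "exchange (Nd (us @ s # t # vs)) (Nd (us @ t # s # vs)) (tdeg s * tdeg t)"
| inside: "exchange s t e \<Longrightarrow> exchange (Nd (us @ s # vs)) (Nd (us @ t # vs)) e"

instantiation ltree :: presented
begin
definition relators_ltree :: "(ltree \<Rightarrow>\<^sub>0 int) set" where "relators_ltree =
  {Poly_Mapping.single s 1 - sg e (Poly_Mapping.single t 1) | s t e. exchange s t e}"
instance ..
end

definition ltrees :: "nat \<Rightarrow> int \<Rightarrow> ltree set" where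
  "ltrees n d = {t. stable t \<and> distinct (leaves t) \<and> set (leaves t) = {1..n} \<and> tdeg t = d}"

definition tree_subst :: "nat \<Rightarrow> nat \<Rightarrow> ltree \<Rightarrow> ltree \<Rightarrow> ltree" where
  "tree_subst i m s = tbind (\<lambda>l. if l < i then Lf l
     else if l = i then tbind (\<lambda>j. Lf (j + i - 1)) s else Lf (l + m - 1))"

text \<open>The total degree of the vertices which come after leaf \<open>i\<close> in depth-first order; the vertices
  of \<open>s\<close> move past them when \<open>s\<close> is grafted onto the leaf \<open>i\<close>.\<close>

fun deg_after :: "nat \<Rightarrow> ltree \<Rightarrow> int" where
  "deg_after i (Lf j) = 0"
| "deg_after i (Nd []) = 0"
| "deg_after i (Nd (t # ts)) =
     (if i \<in> set (leaves t) then deg_after i t + sum_list (map tdeg ts) else deg_after i (Nd ts))"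

text \<open>The exponent of the Koszul sign of $t_1,\dots,t_k\mapsto t_{\sigma(1)},\dots,t_{\sigma(k)}$.\<close>

definition koszul :: "(nat \<Rightarrow> nat) \<Rightarrow> ltree list \<Rightarrow> int" where
  "koszul \<sigma> ts = (\<Sum>(a, b) \<in> {(a, b). 1 \<le> a \<and> a < b \<and> b \<le> length ts \<and> \<sigma> a > \<sigma> b}.
     tdeg (ts ! (\<sigma> a - 1)) * tdeg (ts ! (\<sigma> b - 1)))"

text \<open>The derivation with
  $\partial\lambda_k=-\sum_{p=2}^{k-1}\sum_{\sigma\in\mathrm{Sh}_{p,k-p}}\sigma(\lambda_{k-p+1}\circ_1\lambda_p)$.\<close>

primrec tree_dif :: "ltree \<Rightarrow> (ltree \<Rightarrow>\<^sub>0 'k::field)" where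
  "tree_dif (Lf j) = 0"
| "tree_dif (Nd ts) =
     - (\<Sum>p\<in>{2..<length ts}. \<Sum>\<sigma>\<in>Sh p (length ts - p). sg (koszul \<sigma> ts)
         (Poly_Mapping.single
           (Nd (Nd (map (\<lambda>j. ts ! (\<sigma> j - 1)) [1..<Suc p])
                # map (\<lambda>j. ts ! (\<sigma> j - 1)) [Suc p..<Suc (length ts)])) 1))
     + (\<Sum>j<length ts. sg (3 - 2 * int (length ts) + sum_list (map tdeg (take j ts)))
         (lin pscale (\<lambda>t. Poly_Mapping.single (Nd (ts[j := t])) 1) (map tree_dif ts ! j)))"

definition LLinf :: "('k::field, (ltree, 'k) pres) dgop" where
  "LLinf = \<lparr>
     carr = (\<lambda>n d. abs_pres ` {x. Poly_Mapping.keys x \<subseteq> ltrees n d}),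
     scl = qscale,
     ins = (\<lambda>n d m e i x y. abs_pres
              (bilin (\<lambda>t s. sg (e * deg_after i t) (Poly_Mapping.single (tree_subst i m s t) 1))
                (hrep (ltrees n d) x) (hrep (ltrees m e) y))),
     act = (\<lambda>n d \<sigma> x. abs_pres (lin pscale (\<lambda>t. Poly_Mapping.single (tbind (\<lambda>j. Lf (\<sigma> j)) t) 1)
              (hrep (ltrees n d) x))),
     dif = (\<lambda>n d x. abs_pres (lin pscale tree_dif (hrep (ltrees n d) x))),
     unt = abs_pres (Poly_Mapping.single (Lf 1) 1) \<rparr>"

definition lam :: "nat \<Rightarrow> (ltree, 'k::field) pres" where
  "lam n = abs_pres (Poly_Mapping.single (Nd (map Lf [1..<Suc n])) 1)"

text \<open>The map of graded operads $\Lambda\mathsf{Lie}_\infty\to P$ with $\lambda_n\mapsto g_n$.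
  \<open>graft P u n d i [(m\<^sub>1, e\<^sub>1, w\<^sub>1), \<dots>]\<close> plugs \<open>w\<^sub>1, w\<^sub>2, \<dots>\<close> into the inputs of \<open>u\<close> starting
  from input \<open>i\<close>; \<open>planar P g t\<close> is the value of a tree with leaves labelled from left to right.\<close>

fun graft :: "('k, 'a) dgop \<Rightarrow> 'a \<Rightarrow> nat \<Rightarrow> int \<Rightarrow> nat \<Rightarrow> (nat \<times> int \<times> 'a) list \<Rightarrow> 'a" where
  "graft P u n d i [] = u"
| "graft P u n d i ((m, e, w) # ws) = graft P (ins P n d m e i u w) (n + m - 1) (d + e) (i + m) ws"

fun planar :: "('k, 'a) dgop \<Rightarrow> (nat \<Rightarrow> 'a) \<Rightarrow> ltree \<Rightarrow> 'a" where
  "planar P g (Lf j) = unt P"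
| "planar P g (Nd ts) = graft P (g (length ts)) (length ts) (3 - 2 * int (length ts)) 1
     (map (\<lambda>t. (length (leaves t), tdeg t, planar P g t)) ts)"

definition free_map ::
  "('k::field, 'a::ab_group_add) dgop \<Rightarrow> (nat \<Rightarrow> 'a) \<Rightarrow> ((ltree, 'k) pres, 'a) gmap" where
  "free_map P g n d x =
     lin (scl P) (\<lambda>t. act P n d (list_perm (leaves t)) (planar P g t)) (hrep (ltrees n d) x)"

definition LLinf_to_LLie :: "((ltree, 'k::field) pres, (lie_mon, 'k) pres) gmap" where
  "LLinf_to_LLie = free_map (Lam Lie) (\<lambda>n. if n = 2 then lie_bracket else 0)"

definition LLinf_to_LAs :: "((ltree, 'k::field) pres, nat list \<Rightarrow>\<^sub>0 'k) gmap" where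
  "LLinf_to_LAs = gcomp (Lam_map Lie_to_As) LLinf_to_LLie"

text \<open>\<open>mc \<phi> n\<close> is $\varphi_n=\hat\varphi(\lambda_n)$ for $n\ge2$ and $\varphi_1=0$. A homogeneous element
  of $\mathrm{Tw}\,P(n)$ is the sequence of its components \<open>f r\<close> in $P(r+n)^{S_r}$, added pointwise; its
  first \<open>r\<close> inputs are those on which $S_r$ acts.\<close>

definition mc :: "((ltree, 'k::field) pres, 'a::ab_group_add) gmap \<Rightarrow> nat \<Rightarrow> 'a" where
  "mc \<phi> n = (if 2 \<le> n then \<phi> n (3 - 2 * int n) (lam n) else 0)"

definition Tw_ins :: "('k, 'a::ab_group_add) dgop \<Rightarrow> nat \<Rightarrow> int \<Rightarrow> nat \<Rightarrow> int \<Rightarrow> nat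
    \<Rightarrow> (nat \<Rightarrow> 'a) \<Rightarrow> (nat \<Rightarrow> 'a) \<Rightarrow> nat \<Rightarrow> 'a" where
  "Tw_ins P n d m e i f g = (\<lambda>r. \<Sum>p\<le>r. \<Sum>\<sigma>\<in>Sh p (r - p).
     act P (r + n + m - 1) (d + e - 2 * int r)
       (list_perm (map \<sigma> [1..<Suc p] @ [r + 1..<r + i] @ map \<sigma> [Suc p..<Suc r] @ [r + i..<r + n + m]))
       (ins P (p + n) (d - 2 * int p) (r - p + m) (e - 2 * int (r - p)) (p + i) (f p) (g (r - p))))"

definition Tw_dif :: "('k::field, 'a::ab_group_add) dgop \<Rightarrow> ((ltree, 'k) pres, 'a) gmap
    \<Rightarrow> nat \<Rightarrow> int \<Rightarrow> (nat \<Rightarrow> 'a) \<Rightarrow> nat \<Rightarrow> 'a" where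
  "Tw_dif P \<phi> n d f = (let \<kappa> = (\<lambda>r. mc \<phi> (r + 1)) in (\<lambda>r.
     dif P (r + n) (d - 2 * int r) (f r)
     - sg d (\<Sum>p=1..r. \<Sum>\<sigma>\<in>Sh p (r - p). act P (r + n) (d + 1 - 2 * int r) \<sigma>
         (ins P (r - p + 1 + n) (d - 2 * int (r - p + 1)) p (3 - 2 * int p) 1
           (f (r - p + 1)) (mc \<phi> p)))
     + Tw_ins P 1 1 n d 1 \<kappa> f r
     - sg d (\<Sum>i=1..n. Tw_ins P n d 1 1 i f \<kappa> r)))"

definition Tw :: "('k::field, 'a::ab_group_add) dgop \<Rightarrow> ((ltree, 'k) pres, 'a) gmap
    \<Rightarrow> ('k, nat \<Rightarrow> 'a) dgop" where
  "Tw P \<phi> = \<lparr>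
     carr = (\<lambda>n d. {f. \<forall>r. f r \<in> carr P (r + n) (d - 2 * int r) \<and>
              (\<forall>\<sigma>. \<sigma> permutes {1..r} \<longrightarrow> act P (r + n) (d - 2 * int r) \<sigma> (f r) = f r)}),
     scl = (\<lambda>c f r. scl P c (f r)),
     ins = Tw_ins P,
     act = (\<lambda>n d \<sigma> f r. act P (r + n) (d - 2 * int r)
              (\<lambda>j. if j \<le> r then j else r + \<sigma> (j - r)) (f r)),
     dif = Tw_dif P \<phi>,
     unt = (\<lambda>r. if r = 0 then unt P else 0) \<rparr>"

definition Tw_beta :: "('k::field, 'a::ab_group_add) dgop \<Rightarrow> ((ltree, 'k) pres, 'a) gmap
    \<Rightarrow> ((ltree, 'k) pres, nat \<Rightarrow> 'a) gmap" where
  "Tw_beta P \<phi> = free_map (Tw P \<phi>) (\<lambda>n r. mc \<phi> (r + n))"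

definition Tw_map :: "('a, 'b) gmap \<Rightarrow> (nat \<Rightarrow> 'a, nat \<Rightarrow> 'b) gmap" where
  "Tw_map G n d f = (\<lambda>r. G (r + n) (d - 2 * int r) (f r))"

definition Tw_eta :: "(nat \<Rightarrow> 'a, 'a) gmap" where
  "Tw_eta n d f = f 0"

definition Tw_D :: "(nat \<Rightarrow> 'a, nat \<Rightarrow> nat \<Rightarrow> 'a) gmap" where
  "Tw_D n d f = (\<lambda>r s. f (s + r))"

definition Tw_coalgebra :: "('k::field_char_0, 'a::ab_group_add) dgop
    \<Rightarrow> ((ltree, 'k) pres, 'a) gmap \<Rightarrow> ('a, nat \<Rightarrow> 'a) gmap \<Rightarrow> bool" where
  "Tw_coalgebra P \<phi> c \<longleftrightarrow>
     dg_operad P \<and> dg_operad_map LLinf P \<phi> \<and>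
     dg_operad_map P (Tw P \<phi>) c \<and>
     (\<forall>n d. \<forall>x\<in>carr LLinf n d. gcomp c \<phi> n d x = Tw_beta P \<phi> n d x) \<and>
     (\<forall>n d. \<forall>v\<in>carr P n d. gcomp Tw_eta c n d v = v) \<and>
     (\<forall>n d. \<forall>v\<in>carr P n d. gcomp (Tw_map c) c n d v = gcomp Tw_D c n d v)"

definition homotopy_fixed_point :: "('k::field_char_0, 'a::ab_group_add) dgop
    \<Rightarrow> ((ltree, 'k) pres, 'a) gmap \<Rightarrow> bool" where
  "homotopy_fixed_point P \<phi> \<longleftrightarrow> quasi_isomorphism (Tw P \<phi>) P Tw_eta"

definition Tw_embed :: "('a::zero, nat \<Rightarrow> 'a) gmap" where
  "Tw_embed n d v = (\<lambda>r. if r = 0 then v else 0)"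

end

theory Submission
  imports Defs
begin

text \<open>Write \<open>w\<close> for a word in the letters \<open>1,\<dots>,n\<close>, a basis element of $\Lambda\mathsf{As}(n)$. Most of the
  signs disappear in the basis of signed words $e_w=\mathrm{sgn}(w)\,w$: the symmetric group permutes this
  basis, and $e_w\circ_i e_u=\pm e_{w\circ_i u}$, where \<open>u\<close> of length \<open>m\<close> moves as an element of degree \<open>m - 1\<close>
  past the letters to the left of \<open>i\<close> in \<open>w\<close>. The function \<open>theta\<close> is the change of basis, and
  \<open>inversions_word_subst\<close> is the count of inversions that makes it work.

  The structure map $\Lambda\mathsf{Lie}_\infty\to\Lambda\mathsf{As}$ is zero on a tree unless all its vertices are
  binary, and then it is an iterated bracket (\<open>tree_val\<close>). It is a map of dg operads because the
  differential of a tree with one ternary vertex is the Jacobi identity (\<open>tree_val_tree_dif\<close>). Since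
  $\varphi_n=0$ for $n\ge3$, the sequences $\beta(\lambda_n)=(\varphi_{r+n})_r$ are concentrated in $r=0$, which gives
  $c\hat\varphi=\beta$ for the embedding \<open>c\<close> (\<open>Tw_beta_embed\<close>). The embedding is a chain map because the twisted
  differential of \<open>v\<close> is $[z,v]-\sum_i v(\dots,[z,x_i],\dots)$, and the commutator with \<open>z\<close> is a derivation.

  For the second claim, degrees force a homogeneous element of $\mathrm{Tw}\,\Lambda\mathsf{As}(n)$ to have a single nonzero
  component, an invariant $f_r$. Such an invariant is a noncommutative polynomial in which each of
  $x_1,\dots,x_n$ occurs once and a further letter \<open>z\<close> occurs \<open>r\<close> times. In these terms the twisted
  differential is, up to sign, the derivation with $x_i\mapsto0$ and $z\mapsto z^2$: the commutator with \<open>z\<close>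
  contributes $2z^2$, the bracket inserted into a symmetric input contributes $-z^2$, and the brackets
  inserted into the inputs $x_i$ cancel the commutators $[z,x_i]$ (\<open>twisted_sum\<close>). The complex is thus a sum of
  tensor products of \<open>n + 1\<close> copies of $\mathbb K[z]$ with $z^{2k-1}\mapsto z^{2k}$ and $z^{2k}\mapsto0$, one for each block
  of letters \<open>z\<close> between the $x_i$ (without the empty word if \<open>n = 0\<close>). It is acyclic apart from the words
  without \<open>z\<close>; the homotopy $z^{2k}\mapsto z^{2k-1}$ on the first nonempty block is explicit
  (\<open>insert_zero_homotopy\<close>, \<open>Tw_acyclic\<close>). Hence the projection to the component $r=0$ is a quasi-isomorphism with the embedding as a section.\<close>

section \<open>Signs and linear extension\<close>

abbreviation "supp \<equiv> Poly_Mapping.keys"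
abbreviation "coeff \<equiv> Poly_Mapping.lookup"
abbreviation "single \<equiv> Poly_Mapping.single"

type_synonym 'k ncpoly = "nat list \<Rightarrow>\<^sub>0 'k"

lemma sg_zero [simp]: "sg e 0 = 0"
  and sg_0 [simp]: "sg 0 x = x"
  and sg_add: "sg e (x + y) = sg e x + sg e y"
  and sg_minus: "sg e (- x) = - sg e x"
  and sg_diff: "sg e (x - y) = sg e x - sg e y"
  and sg_sg: "sg e (sg e' x) = sg (e + e') x"
  by (auto simp: sg_def)

lemma sg_cong: "even a = even b \<Longrightarrow> sg a x = sg b x"
  by (simp add: sg_def)

lemma sg_eq_0_iff [simp]: "sg e x = 0 \<longleftrightarrow> x = 0"
  by (simp add: sg_def)

lemma sg_mult: "sg e x * y = sg e (x * y)" "x * sg e y = sg e (x * y)"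
  for x y :: "'a::ring"
  by (simp_all add: sg_def)

lemma lookup_sg: "coeff (sg e x) b = sg e (coeff x b)"
  by (simp add: sg_def)

lemma keys_sg [simp]: "supp (sg e x) = supp x"
  by (auto simp: in_keys_iff lookup_sg)

lemma pscale_sg: "pscale c (sg e x) = sg e (pscale c x)"
  by (simp add: sg_def free_vs.scale_minus_right)

context vector_space
begin

lemma lin_superset:
  assumes "finite S" "supp x \<subseteq> S"
  shows "lin scale f x = (\<Sum>b\<in>S. scale (coeff x b) (f b))"
  unfolding lin_def by (rule sum.mono_neutral_left) (use assms in \<open>auto simp: in_keys_iff\<close>)

lemma lin_zero [simp]: "lin scale f 0 = 0"
  by (simp add: lin_def)

lemma lin_add: "lin scale f (x + y) = lin scale f x + lin scale f y"
proof -
  let ?S = "supp x \<union> supp y"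
  have "supp (x + y) \<subseteq> ?S" by (rule Poly_Mapping.keys_add)
  then show ?thesis
    by (simp add: lin_superset[of ?S] lookup_add scale_left_distrib sum.distrib)
qed

lemma keys_pscale_subset: "supp (pscale c x) \<subseteq> supp x"
  by (auto simp: in_keys_iff lookup_pscale)

lemma lin_pscale: "lin scale f (pscale c x) = scale c (lin scale f x)"
  unfolding lin_superset[OF finite_keys keys_pscale_subset]
  by (simp add: lookup_pscale lin_def scale_sum_right)

lemma lin_single [simp]: "lin scale f (single b c) = scale c (f b)"
  by (simp add: lin_superset[of "{b}"])

lemma lin_uminus: "lin scale f (- x) = - lin scale f x"
  using lin_add[of f x "- x"] by (simp add: eq_neg_iff_add_eq_0 add.commute)

lemma lin_diff: "lin scale f (x - y) = lin scale f x - lin scale f y"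
  using lin_add[of f "x - y" y] by simp

lemma lin_sum: "lin scale f (\<Sum>a\<in>A. g a) = (\<Sum>a\<in>A. lin scale f (g a))"
  by (induction A rule: infinite_finite_induct) (auto simp: lin_add)

lemma lin_sg: "lin scale f (sg e x) = sg e (lin scale f x)"
  by (simp add: sg_def lin_uminus)

lemma lin_cong:
  "(\<And>b. b \<in> supp x \<Longrightarrow> f b = g b) \<Longrightarrow> lin scale f x = lin scale g x"
  unfolding lin_def by (intro sum.cong) auto

lemma lin_lin: "lin scale f (lin pscale g x) = lin scale (\<lambda>b. lin scale f (g b)) x"
  unfolding lin_def[of pscale] by (simp add: lin_sum lin_pscale) (simp add: lin_def)

lemma lin_fun_zero [simp]: "lin scale (\<lambda>b. 0) x = 0"
  by (simp add: lin_def)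

lemma lin_fun_add: "lin scale (\<lambda>b. f b + g b) x = lin scale f x + lin scale g x"
  by (simp add: lin_def scale_right_distrib sum.distrib)

lemma lin_fun_uminus: "lin scale (\<lambda>b. - f b) x = - lin scale f x"
  by (simp add: lin_def scale_minus_right sum_negf)

lemma lin_fun_sg: "lin scale (\<lambda>b. sg e (f b)) x = sg e (lin scale f x)"
  by (simp add: sg_def lin_fun_uminus)

lemma lin_swap:
  "lin scale (\<lambda>a. lin scale (\<lambda>b. f a b) y) x = lin scale (\<lambda>b. lin scale (\<lambda>a. f a b) x) y"
  by (simp add: lin_def scale_sum_right mult.commute) (rule sum.swap)

end

lemma lin_id [simp]: "lin pscale (\<lambda>b. single b 1) x = x"
proof (rule poly_mapping_eqI)
  fix k
  have "coeff (lin pscale (\<lambda>b. single b 1) x) k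
      = (\<Sum>b\<in>supp x. if b = k then coeff x b else 0)"
    unfolding lin_def lookup_sum
    by (intro sum.cong) (auto simp: lookup_pscale lookup_single when_def)
  then show "coeff (lin pscale (\<lambda>b. single b 1) x) k
      = coeff x k"
    by (simp add: in_keys_iff)
qed

lemma lookup_lin:
  "coeff (lin pscale f x) w
    = (\<Sum>b\<in>supp x. coeff x b * coeff (f b) w)"
  by (simp add: lin_def lookup_sum lookup_pscale)

lemma keys_lin: "supp (lin pscale f x) \<subseteq> (\<Union>b\<in>supp x. supp (f b))"
proof
  fix w assume "w \<in> supp (lin pscale f x)"
  then have "(\<Sum>b\<in>supp x. coeff x b * coeff (f b) w) \<noteq> 0"
    by (simp add: in_keys_iff lookup_lin)
  then obtain b where "b \<in> supp x" "coeff (f b) w \<noteq> 0"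
    by (metis (no_types, lifting) mult_zero_right sum.neutral)
  then show "w \<in> (\<Union>b\<in>supp x. supp (f b))"
    by (auto simp: in_keys_iff)
qed

lemma keys_lin_subset:
  assumes "supp x \<subseteq> A" "\<And>b. b \<in> A \<Longrightarrow> supp (f b) \<subseteq> B"
  shows "supp (lin pscale f x) \<subseteq> B"
  using keys_lin[of f x] assms by blast

lemma keys_bilin_subset:
  assumes "supp x \<subseteq> A" "supp y \<subseteq> B"
    and "\<And>a b. a \<in> A \<Longrightarrow> b \<in> B \<Longrightarrow> supp (f a b) \<subseteq> D"
  shows "supp (bilin f x y) \<subseteq> D"
  unfolding bilin_def by (intro keys_lin_subset[OF assms(1)] keys_lin_subset[OF assms(2)] assms(3))

lemma bilin_cong:
  assumes "\<And>a b. a \<in> supp x \<Longrightarrow> b \<in> supp y \<Longrightarrow> f a b = g a b"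
  shows "bilin f x y = bilin g x y"
  unfolding bilin_def by (intro free_vs.lin_cong assms)

lemma bilin_swap: "bilin f x y = bilin (\<lambda>b a. f a b) y x"
  unfolding bilin_def by (rule free_vs.lin_swap)

lemma bilin_left:
  "bilin f 0 y = 0"
  "bilin f (x + x') y = bilin f x y + bilin f x' y"
  "bilin f (- x) y = - bilin f x y"
  "bilin f (x - x') y = bilin f x y - bilin f x' y"
  "bilin f (pscale c x) y = pscale c (bilin f x y)"
  "bilin f (sg e x) y = sg e (bilin f x y)"
  "bilin f (\<Sum>a\<in>A. h a) y = (\<Sum>a\<in>A. bilin f (h a) y)"
  "bilin f (lin pscale k z) y = lin pscale (\<lambda>b. bilin f (k b) y) z"
  by (simp_all add: bilin_def free_vs.lin_add free_vs.lin_uminus free_vs.lin_diff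
      free_vs.lin_pscale free_vs.lin_sg free_vs.lin_sum free_vs.lin_lin)

lemma bilin_right:
  "bilin f x 0 = 0"
  "bilin f x (y + y') = bilin f x y + bilin f x y'"
  "bilin f x (- y) = - bilin f x y"
  "bilin f x (y - y') = bilin f x y - bilin f x y'"
  "bilin f x (pscale c y) = pscale c (bilin f x y)"
  "bilin f x (sg e y) = sg e (bilin f x y)"
  "bilin f x (\<Sum>a\<in>A. h a) = (\<Sum>a\<in>A. bilin f x (h a))"
  "bilin f x (lin pscale k z) = lin pscale (\<lambda>b. bilin f x (k b)) z"
  unfolding bilin_swap[of f x] by (rule bilin_left)+

lemma bilin_single [simp]:
  "bilin f (single a 1) (single b 1) = f a b"
  by (simp add: bilin_def)

lemma bilin_fun_sg: "bilin (\<lambda>a b. sg e (f a b)) x y = sg e (bilin f x y)"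
  by (simp add: bilin_def free_vs.lin_fun_sg)

lemma lin_bilin: "lin pscale g (bilin f x y) = bilin (\<lambda>a b. lin pscale g (f a b)) x y"
  by (simp add: bilin_def free_vs.lin_lin)

section \<open>Maps out of presented vector spaces\<close>

lemma abs_pres_eq_iff: "abs_pres x = abs_pres y \<longleftrightarrow> x - y \<in> rel_span"
  by (rule pres.abs_eq_iff)

lemma abs_pres_add: "abs_pres (x + y) = abs_pres x + abs_pres y"
  and abs_pres_0: "abs_pres 0 = 0"
  and abs_pres_pscale: "abs_pres (pscale c x) = qscale c (abs_pres x)"
  by (simp_all add: plus_pres.abs_eq zero_pres_def qscale.abs_eq)

lemma hrep:
  assumes "x \<in> abs_pres ` {y. supp y \<subseteq> B}"
  shows "supp (hrep B x) \<subseteq> B" "abs_pres (hrep B x) = x"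
proof -
  have "\<exists>y. supp y \<subseteq> B \<and> abs_pres y = x" using assms by auto
  from someI_ex[OF this] show "supp (hrep B x) \<subseteq> B" "abs_pres (hrep B x) = x"
    by (auto simp: hrep_def)
qed

definition kills_relators :: "('b::presented \<Rightarrow> ('c \<Rightarrow>\<^sub>0 'k::field)) \<Rightarrow> bool" where
  "kills_relators f \<longleftrightarrow> (\<forall>r\<in>relators. lin pscale f (Poly_Mapping.map of_int r) = 0)"

lemma kills_rel_span:
  assumes "kills_relators f" "x \<in> rel_span" shows "lin pscale f x = 0"
  using assms(2) unfolding rel_span_def
proof (induction rule: free_vs.span_induct_alt)
  case (step c x y)
  then show ?case using assms(1) by (auto simp: kills_relators_def free_vs.lin_add free_vs.lin_pscale)
qed simp

lemma lin_eq_of_abs_pres_eq: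
  assumes "kills_relators f" "abs_pres x = abs_pres y" shows "lin pscale f x = lin pscale f y"
  using kills_rel_span[OF assms(1), of "x - y"] assms(2) by (simp add: abs_pres_eq_iff free_vs.lin_diff)

definition pres_lin :: "('b::presented \<Rightarrow> ('c \<Rightarrow>\<^sub>0 'k)) \<Rightarrow> ('b, 'k::field) pres \<Rightarrow> ('c \<Rightarrow>\<^sub>0 'k)" where
  "pres_lin f x = lin pscale f (hrep UNIV x)"

lemma pres_lin_abs: "kills_relators f \<Longrightarrow> pres_lin f (abs_pres x) = lin pscale f x"
  unfolding pres_lin_def by (rule lin_eq_of_abs_pres_eq) (auto intro: hrep)

text \<open>A linear function on monomials that vanishes on the relations is constant on the fibres of the
  quotient map, so that it does not matter which representative \<open>hrep\<close> has chosen.\<close>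

lemma lin_hrep:
  assumes "kills_relators f" "x \<in> abs_pres ` {y. supp y \<subseteq> B}"
  shows "lin pscale f (hrep B x) = pres_lin f x"
  by (metis assms hrep(2) pres_lin_abs)

lemma pres_cases: obtains x' where "x = abs_pres x'"
  by (metis Quotient3_abs_rep Quotient3_pres)

lemma pres_lin_linear:
  assumes "kills_relators f"
  shows "pres_lin f 0 = 0" "pres_lin f (x + y) = pres_lin f x + pres_lin f y"
    "pres_lin f (qscale c x) = pscale c (pres_lin f x)"
    "pres_lin f (- x) = - pres_lin f x"
    "pres_lin f (lin qscale k z) = lin pscale (\<lambda>b. pres_lin f (k b)) z"
proof -
  obtain x' y' where xy: "x = abs_pres x'" "y = abs_pres y'" by (metis pres_cases)
  show 0: "pres_lin f 0 = 0" using pres_lin_abs[OF assms, of 0] by (simp add: abs_pres_0)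
  have add: "pres_lin f (x + y) = pres_lin f x + pres_lin f y" for x y
    by (cases x rule: pres_cases, cases y rule: pres_cases)
      (simp add: pres_lin_abs[OF assms] free_vs.lin_add flip: abs_pres_add)
  have sc: "pres_lin f (qscale c x) = pscale c (pres_lin f x)" for c x
    by (cases x rule: pres_cases)
      (simp add: pres_lin_abs[OF assms] free_vs.lin_pscale flip: abs_pres_pscale)
  show "pres_lin f (x + y) = pres_lin f x + pres_lin f y" by (rule add)
  show "pres_lin f (qscale c x) = pscale c (pres_lin f x)" by (rule sc)
  show "pres_lin f (- x) = - pres_lin f x"
    using add[of x "- x"] 0 by (simp add: eq_neg_iff_add_eq_0 add.commute)
  have "pres_lin f (\<Sum>b\<in>A. qscale (c b) (k b)) = (\<Sum>b\<in>A. pscale (c b) (pres_lin f (k b)))" for A c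
    by (induction A rule: infinite_finite_induct) (auto simp: 0 add sc)
  then show "pres_lin f (lin qscale k z) = lin pscale (\<lambda>b. pres_lin f (k b)) z"
    by (simp add: lin_def)
qed

section \<open>Words and inversions\<close>

primrec inversions :: "nat list \<Rightarrow> nat" where
  "inversions [] = 0"
| "inversions (x # xs) = length (filter (\<lambda>y. y < x) xs) + inversions xs"

lemma inversions_append:
  "inversions (us @ vs) = inversions us + inversions vs + (\<Sum>x\<leftarrow>us. length (filter (\<lambda>y. y < x) vs))"
  by (induction us) auto

lemma inversions_map_mono:
  assumes "\<And>x y. x \<in> set w \<Longrightarrow> y \<in> set w \<Longrightarrow> f x < f y \<longleftrightarrow> x < y"
  shows "inversions (map f w) = inversions w"
  using assms
proof (induction w)
  case (Cons x w)
  have "filter (\<lambda>y. f y < f x) w = filter (\<lambda>y. y < x) w" using Cons.prems by (intro filter_cong) auto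
  then show ?case using Cons by (simp add: filter_map o_def)
qed simp

lemma inversions_swap_adjacent:
  "a \<noteq> b \<Longrightarrow> even (inversions (us @ a # b # ws)) \<longleftrightarrow> odd (inversions (us @ b # a # ws))"
  by (induction us) auto

lemma inversions_move:
  "a \<notin> set vs \<Longrightarrow> even (inversions (us @ a # vs @ ws)) \<longleftrightarrow> even (inversions (us @ vs @ a # ws) + length vs)"
proof (induction vs arbitrary: us)
  case (Cons v vs)
  then show ?case
    using inversions_swap_adjacent[of a v us "vs @ ws"] Cons.IH[of "us @ [v]"] by auto
qed simp

lemma inversions_swap:
  assumes "distinct (us @ a # vs @ b # ws)"
  shows "even (inversions (us @ a # vs @ b # ws)) \<longleftrightarrow> odd (inversions (us @ b # vs @ a # ws))"
  using assms inversions_move[of a vs us "b # ws"] inversions_move[of b vs us "a # ws"]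
    inversions_swap_adjacent[of a b "us @ vs" ws] by auto

lemma inversions_transpose:
  assumes "distinct w" "a \<in> set w" "b \<in> set w" "a \<noteq> b"
  shows "even (inversions (map (transpose a b) w)) \<longleftrightarrow> odd (inversions w)"
proof -
  have *: ?thesis if w: "w = us @ c # vs @ d # ws" and cd: "{c, d} = {a, b}" for us vs ws c d
  proof -
    have "map (transpose a b) us = us" "map (transpose a b) vs = vs" "map (transpose a b) ws = ws"
      using assms(1) w cd by (auto intro!: map_idI transpose_apply_other)
    moreover have "transpose a b c = d" "transpose a b d = c"
      using cd by (auto simp: doubleton_eq_iff)
    ultimately show ?thesis using inversions_swap[of us c vs d ws] assms(1) w by auto
  qed
  obtain us r where w: "w = us @ a # r" using assms(2) by (meson split_list)
  then consider "b \<in> set us" | "b \<in> set r" using assms by auto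
  then show ?thesis
  proof cases
    case 1
    then obtain p q where "us = p @ b # q" by (meson split_list)
    then show ?thesis using *[of p b q a r] w by auto
  next
    case 2
    then obtain p q where "r = p @ b # q" by (meson split_list)
    then show ?thesis using *[of us a p b q] w by auto
  qed
qed

text \<open>It is enough to treat transpositions: exchanging two letters of a word changes the parity of the
  number of its inversions.\<close>

lemma inversions_permutes:
  assumes "\<sigma> permutes S" "finite S" "distinct w" "set w = S"
  shows "even (inversions (map \<sigma> w)) \<longleftrightarrow> (evenperm \<sigma> \<longleftrightarrow> even (inversions w))"
  using assms
proof (induction \<sigma> rule: permutes_induct)
  case id
  then show ?case by (simp add: evenperm_id)
next
  case (swap a b p)
  then have *: "distinct (map p w)" "set (map p w) = S"
    by (auto simp: distinct_map permutes_inj_on permutes_image)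
  have ev: "evenperm (transpose a b \<circ> p) \<longleftrightarrow> (a = b \<longleftrightarrow> evenperm p)"
    using swap by (subst evenperm_comp)
      (auto simp: evenperm_swap permutation_swap_id intro: permutation_permutes[THEN iffD2])
  show ?case
  proof (cases "a = b")
    case True
    then show ?thesis using swap by (simp add: o_def)
  next
    case False
    show ?thesis
    proof -
      have "even (inversions (map (transpose a b) (map p w))) \<longleftrightarrow> odd (inversions (map p w))"
        using inversions_transpose[OF *(1), of a b] *(2) swap False by blast
      moreover have "even (inversions (map p w)) \<longleftrightarrow> (evenperm p \<longleftrightarrow> even (inversions w))"
        using swap by blast
      ultimately show ?thesis unfolding map_map[symmetric] ev using False by blast
    qed
  qed
qed

definition perm_parity :: "(nat \<Rightarrow> nat) \<Rightarrow> int" where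
  "perm_parity \<sigma> = (if evenperm \<sigma> then 0 else 1)"

lemma as_words_iff: "w \<in> as_words n \<longleftrightarrow> n \<noteq> 0 \<and> distinct w \<and> set w = {1..n}"
  by (cases "n = 0") (auto simp: as_words_def)

lemma length_as_words: "w \<in> as_words n \<Longrightarrow> length w = n"
  by (metis as_words_iff card_atLeastAtMost diff_Suc_1 distinct_card)

lemma finite_as_words: "finite (as_words n)"
  by (rule finite_subset[OF _ finite_lists_length_eq[of "{1..n}" n]])
    (auto simp: length_as_words as_words_iff)

lemma map_as_words: "w \<in> as_words n \<Longrightarrow> \<sigma> permutes {1..n} \<Longrightarrow> map \<sigma> w \<in> as_words n"
  by (auto simp: as_words_iff distinct_map permutes_inj_on permutes_image)

lemma inversions_as_words:
  "\<sigma> permutes {1..n} \<Longrightarrow> w \<in> as_words n \<Longrightarrow> even (int (inversions (map \<sigma> w))) = even (perm_parity \<sigma> + int (inversions w))"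
  using inversions_permutes[of \<sigma> "{1..n}" w] by (auto simp: as_words_iff perm_parity_def)

lemma list_perm_permutes:
  assumes "distinct ls" "set ls = {1..n}" shows "list_perm ls permutes {1..n}"
proof (rule bij_imp_permutes)
  have n: "length ls = n" using assms distinct_card[of ls] by simp
  have "bij_betw (\<lambda>j. ls ! (j - 1)) {1..n} (set ls)"
  proof (rule bij_betw_byWitness[where f' = "\<lambda>x. Suc (THE k. k < n \<and> ls ! k = x)"])
    have *: "(THE k. k < n \<and> ls ! k = ls ! j) = j" if "j < n" for j
      using that n assms(1) by (intro the_equality) (auto simp: nth_eq_iff_index_eq)
    show "\<forall>a\<in>{1..n}. Suc (THE k. k < n \<and> ls ! k = ls ! (a - 1)) = a" using * by auto
    show "\<forall>a'\<in>set ls. ls ! (Suc (THE k. k < n \<and> ls ! k = a') - 1) = a'"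
      using * n by (auto simp: in_set_conv_nth)
    show "(\<lambda>j. ls ! (j - 1)) ` {1..n} \<subseteq> set ls" using n by auto
    show "(\<lambda>x. Suc (THE k. k < n \<and> ls ! k = x)) ` set ls \<subseteq> {1..n}"
      using * n by (auto simp: in_set_conv_nth)
  qed
  then show "bij_betw (list_perm ls) {1..n} {1..n}"
    using n assms(2) by (subst bij_betw_cong[of _ _ "\<lambda>j. ls ! (j - 1)"]) (auto simp: list_perm_def)
  show "\<And>x. x \<notin> {1..n} \<Longrightarrow> list_perm ls x = x" using n by (auto simp: list_perm_def)
qed

lemma map_list_perm_upt: "length ls = n \<Longrightarrow> map (list_perm ls) [1..<Suc n] = ls"
  by (rule nth_equalityI) (auto simp: list_perm_def simp del: upt_Suc)

lemma upt_as_words: "n \<noteq> 0 \<Longrightarrow> [1..<Suc n] \<in> as_words n"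
  by (auto simp: as_words_iff simp del: upt_Suc)

definition shift_letter :: "nat \<Rightarrow> nat \<Rightarrow> nat \<Rightarrow> nat" where
  "shift_letter i m l = (if l < i then l else l + m - 1)"

lemma word_subst_append: "word_subst i m u (v @ w) = word_subst i m u v @ word_subst i m u w"
  by (simp add: word_subst_def)

lemma word_subst_notin: "i \<notin> set w \<Longrightarrow> word_subst i m u w = map (shift_letter i m) w"
  by (induction w) (auto simp: word_subst_def shift_letter_def)

lemma word_subst_single: "word_subst i m u [i] = map (\<lambda>j. j + i - 1) u"
  by (simp add: word_subst_def)

lemma word_subst_split:
  assumes "i \<notin> set us" "i \<notin> set vs"
  shows "word_subst i m u (us @ i # vs)
    = map (shift_letter i m) us @ map (\<lambda>j. j + i - 1) u @ map (shift_letter i m) vs"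
  using word_subst_append[of i m u us "[i] @ vs"] word_subst_append[of i m u "[i]" vs]
  by (simp add: word_subst_notin assms word_subst_single)

lemma as_words_split:
  assumes "w \<in> as_words n" "i \<in> {1..n}"
  obtains us vs where "w = us @ i # vs" "i \<notin> set us" "i \<notin> set vs" "set us \<union> set vs = {1..n} - {i}"
    "distinct us" "distinct vs" "set us \<inter> set vs = {}"
proof -
  obtain us vs where w: "w = us @ i # vs" using assms by (metis as_words_iff split_list)
  moreover have "set us \<union> set vs = {1..n} - {i}" using assms w unfolding as_words_iff by auto
  ultimately show thesis using that[of us vs] assms(1) by (auto simp: as_words_iff)
qed

lemma word_subst_as_words:
  assumes "w \<in> as_words n" "u \<in> as_words m" "i \<in> {1..n}"
  shows "word_subst i m u w \<in> as_words (n + m - 1)"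
proof -
  obtain us vs where w: "w = us @ i # vs" "i \<notin> set us" "i \<notin> set vs" "set us \<union> set vs = {1..n} - {i}"
    "distinct us" "distinct vs" "set us \<inter> set vs = {}"
    using as_words_split[OF assms(1,3)] .
  have m: "m \<noteq> 0" "distinct u" "set u = {1..m}" using assms(2) by (auto simp: as_words_iff)
  let ?f = "shift_letter i m"
  have inj: "inj_on ?f (set us \<union> set vs)"
    using m w(4) by (auto simp: inj_on_def shift_letter_def split: if_splits)
  have range: "?f l \<notin> {i..i + m - 1} \<and> ?f l \<in> {1..n + m - 1}" if "l \<in> set us \<union> set vs" for l
    using that m w(4) assms(3) by (auto simp: shift_letter_def)
  have block: "{i..i + m - 1} \<subseteq> {1..n + m - 1}" using assms(3) m by auto
  have u: "set (map (\<lambda>j. j + i - 1) u) = {i..i + m - 1}"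
  proof -
    have "x \<in> (\<lambda>j. j + i - 1) ` {1..m}" if "x \<in> {i..i + m - 1}" for x
      using that assms(3) by (intro image_eqI[of _ _ "x - i + 1"]) auto
    then show ?thesis using m assms(3) by auto
  qed
  have 1: "distinct (word_subst i m u w)"
    unfolding w(1) word_subst_split[OF w(2,3)] distinct_append set_append u
  proof (intro conjI)
    show "distinct (map ?f us)" "distinct (map ?f vs)"
      unfolding distinct_map using w(5,6) inj by (auto intro: inj_on_subset)
    show "distinct (map (\<lambda>j. j + i - 1) u)"
      using m assms(3) by (auto simp: distinct_map inj_on_def)
    have "?f ` set us \<inter> ?f ` set vs = ?f ` (set us \<inter> set vs)"
      using inj by (intro inj_on_image_Int[symmetric]) auto
    then have "?f ` set us \<inter> ?f ` set vs = {}" using w(7) by simp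
    then show "set (map ?f us) \<inter> ({i..i + m - 1} \<union> set (map ?f vs)) = {}"
      using range by (auto simp del: atLeastAtMost_iff)
    show "{i..i + m - 1} \<inter> set (map ?f vs) = {}"
      using range by (auto simp del: atLeastAtMost_iff)
  qed
  have 2: "set (word_subst i m u w) \<subseteq> {1..n + m - 1}"
    unfolding w(1) word_subst_split[OF w(2,3)] set_append u using range block by (auto simp del: atLeastAtMost_iff)
  have "length (word_subst i m u w) = n + m - 1"
    unfolding w(1) word_subst_split[OF w(2,3)]
    using length_as_words[OF assms(1)] length_as_words[OF assms(2)] w(1) by auto
  then have "set (word_subst i m u w) = {1..n + m - 1}"
    using 2 distinct_card[OF 1] by (intro card_subset_eq) auto
  then show ?thesis using 1 m assms by (auto simp: as_words_iff)
qed

definition position :: "nat \<Rightarrow> nat list \<Rightarrow> nat" where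
  "position i w = length (takeWhile (\<lambda>l. l \<noteq> i) w)"

lemma position_split [simp]: "i \<notin> set us \<Longrightarrow> position i (us @ i # vs) = length us"
  unfolding position_def by (subst takeWhile_append2) auto

lemma position_append: "position i (us @ vs) = (if i \<in> set us then position i us else length us + position i vs)"
  unfolding position_def by (auto simp: takeWhile_append)

lemma position_map: "inj_on \<sigma> (insert i (set w)) \<Longrightarrow> position (\<sigma> i) (map \<sigma> w) = position i w"
proof (induction w)
  case (Cons x w)
  then show ?case by (auto simp: position_def inj_on_def)
qed (simp add: position_def)

text \<open>A letter outside the block \<open>B\<close> compares in the same way with all letters of \<open>B\<close>, hence forms an
  inversion with each of them or with none.\<close>

lemma inversions_block:
  assumes "\<And>x b. x \<in> set us \<union> set vs \<Longrightarrow> b \<in> set B \<Longrightarrow> (b < x \<longleftrightarrow> g x) \<and> (x < b \<longleftrightarrow> \<not> g x)"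
  shows "inversions (us @ B @ vs) = inversions (us @ vs) + inversions B
    + length B * (length (filter g us) + length (filter (\<lambda>x. \<not> g x) vs))"
proof -
  have 1: "(\<Sum>x\<leftarrow>us. length (filter (\<lambda>y. y < x) B)) = length B * length (filter g us)"
    using assms
  proof (induction us)
    case (Cons x us)
    have "filter (\<lambda>y. y < x) B = (if g x then B else [])"
      using Cons.prems by (auto intro!: filter_True filter_False)
    with Cons show ?case by (auto simp: algebra_simps)
  qed simp
  have 2: "(\<Sum>x\<leftarrow>B. length (filter (\<lambda>y. y < x) vs)) = length B * length (filter (\<lambda>x. \<not> g x) vs)"
    using assms
  proof (induction B)
    case (Cons b B)
    have "filter (\<lambda>y. y < b) vs = filter (\<lambda>x. \<not> g x) vs"
      using Cons.prems by (intro filter_cong) auto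
    with Cons show ?case by (auto simp: algebra_simps)
  qed simp
  show ?thesis by (simp add: inversions_append[of us] inversions_append[of B] sum_list_addf 1 2 algebra_simps)
qed

text \<open>Substituting \<open>u\<close> for the letter \<open>i\<close> of \<open>w\<close> turns each inversion of \<open>w\<close> that involves \<open>i\<close> into \<open>m\<close>
  inversions. The parity of the number of those inversions is that of \<open>i - 1\<close> plus the position of
  \<open>i\<close> in \<open>w\<close>, since \<open>i - 1\<close> letters are smaller than \<open>i\<close>.\<close>

lemma inversions_word_subst:
  assumes "w \<in> as_words n" "u \<in> as_words m" "i \<in> {1..n}"
  shows "even (int (inversions (word_subst i m u w)))
    = even (int (inversions w) + int (inversions u) + (int m - 1) * (int i - 1 + int (position i w)))"
proof -
  obtain us vs where w: "w = us @ i # vs" "i \<notin> set us" "i \<notin> set vs" "set us \<union> set vs = {1..n} - {i}"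
    "distinct us" "distinct vs" "set us \<inter> set vs = {}"
    using as_words_split[OF assms(1,3)] .
  have m: "m \<noteq> 0" "distinct u" "set u = {1..m}" "length u = m"
    using assms(2) length_as_words[OF assms(2)] by (auto simp: as_words_iff)
  let ?f = "shift_letter i m"
  \<comment> \<open>The number of inversions of \<open>w\<close> that involve the letter \<open>i\<close>.\<close>
  define K where "K = length (filter (\<lambda>x. i < x) us) + length (filter (\<lambda>x. \<not> i < x) vs)"
  have 1: "inversions w = inversions (us @ vs) + K"
  proof -
    have "inversions (us @ [i] @ vs) = inversions (us @ vs) + inversions [i] + length [i] * K"
      unfolding K_def by (rule inversions_block) (use w(2,3) in \<open>auto simp: not_less le_less\<close>)
    then show ?thesis by (simp add: w(1))
  qed
  have f: "?f x < i \<or> i + m - 1 < ?f x" "(i + m - 1 < ?f x) = (i < x)" if "x \<in> set us \<union> set vs" for x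
  proof -
    have "x \<noteq> i" using that w(2,3) by auto
    then show "?f x < i \<or> i + m - 1 < ?f x" "(i + m - 1 < ?f x) = (i < x)"
      using m(1) unfolding shift_letter_def by (cases "x < i"; simp; linarith)+
  qed
  have B: "i \<le> b" "b \<le> i + m - 1" if "b \<in> set (map (\<lambda>j. j + i - 1) u)" for b
    using that m(3) by auto
  have "inversions (word_subst i m u w) = inversions (map ?f us @ map ?f vs) + inversions (map (\<lambda>j. j + i - 1) u)
     + length (map (\<lambda>j. j + i - 1) u) * (length (filter (\<lambda>x. i + m - 1 < x) (map ?f us))
       + length (filter (\<lambda>x. \<not> i + m - 1 < x) (map ?f vs)))"
    unfolding w(1) word_subst_split[OF w(2,3)]
  proof (rule inversions_block)
    fix x b assume "x \<in> set (map ?f us) \<union> set (map ?f vs)" and b: "b \<in> set (map (\<lambda>j. j + i - 1) u)"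
    then obtain y where "x = ?f y" "y \<in> set us \<union> set vs" by auto
    then show "(b < x \<longleftrightarrow> i + m - 1 < x) \<and> (x < b \<longleftrightarrow> \<not> i + m - 1 < x)"
      using f(1)[of y] B[OF b] by auto
  qed
  moreover have "inversions (map ?f us @ map ?f vs) = inversions (us @ vs)"
    unfolding map_append[symmetric] using m(1) by (intro inversions_map_mono) (auto simp: shift_letter_def)
  moreover have "inversions (map (\<lambda>j. j + i - 1) u) = inversions u"
    using m assms(3) by (intro inversions_map_mono) auto
  moreover have "filter ((\<lambda>x. i + m - 1 < x) \<circ> ?f) us = filter (\<lambda>x. i < x) us"
    "filter ((\<lambda>x. \<not> i + m - 1 < x) \<circ> ?f) vs = filter (\<lambda>x. \<not> i < x) vs"
    using f(2) by (auto intro!: filter_cong)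
  ultimately have 2: "inversions (word_subst i m u w) = inversions (us @ vs) + inversions u + m * K"
    using m by (simp add: filter_map K_def)
  have "length (filter (\<lambda>x. x < i) us) + length (filter (\<lambda>x. \<not> i < x) vs) = i - 1"
  proof -
    have "length (filter (\<lambda>x. x < i) us) + length (filter (\<lambda>x. \<not> i < x) vs)
        = card ({x \<in> set us. x < i} \<union> {x \<in> set vs. \<not> i < x})"
      using w by (subst card_Un_disjoint)
        (auto simp: distinct_card distinct_length_filter Int_commute Collect_conj_eq)
    also have "{x \<in> set us. x < i} \<union> {x \<in> set vs. \<not> i < x} = {1..<i}"
    proof -
      have "x \<in> set us \<union> set vs \<longleftrightarrow> x \<in> {1..n} - {i}" for x using w(4) by auto
      moreover have "x \<in> set us \<Longrightarrow> x \<noteq> i" "x \<in> set vs \<Longrightarrow> x \<noteq> i" for x using w by auto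
      ultimately show ?thesis using assms(3) by fastforce
    qed
    finally show ?thesis by simp
  qed
  moreover have "length (filter (\<lambda>x. i < x) us) + length (filter (\<lambda>x. x < i) us) = length us"
    using w(2) by (induction us) auto
  ultimately have "K + 2 * length (filter (\<lambda>x. x < i) us) = length us + (i - 1)"
    by (simp add: K_def)
  then have "even K \<longleftrightarrow> even (length us + (i - 1))" by presburger
  moreover have "position i w = length us" using w by simp
  ultimately show ?thesis using 1 2 assms(3) m(1)
    by (cases i) (auto simp: even_mult_iff)
qed

section \<open>The operad of shifted associative algebras\<close>

abbreviation relabel :: "(nat \<Rightarrow> nat) \<Rightarrow> 'k::field ncpoly \<Rightarrow> 'k ncpoly" where
  "relabel \<sigma> \<equiv> lin pscale (\<lambda>w. single (map \<sigma> w) 1)"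

abbreviation LAs :: "('k::field, 'k ncpoly) dgop" where "LAs \<equiv> Lam As"

lemma LAs_simps:
  "carr LAs n d = (if d = 1 - int n then {x. supp x \<subseteq> as_words n} else {0})"
  "scl LAs = pscale"
  "ins LAs n d m e i v w = sg ((d - (1 - int n)) * (1 - int m) + (int i - 1) * (1 - int m))
    (bilin (\<lambda>w u. single (word_subst i m u w) 1) v w)"
  "act LAs n d \<sigma> v = sg (perm_parity \<sigma>) (relabel \<sigma> v)"
  "dif LAs n d v = 0"
  "unt LAs = single [1] 1"
  by (auto simp: Lam_def As_def Let_def perm_parity_def sg_def)

lemma LAs_ins_zero [simp]: "ins LAs n d m e i 0 w = 0" "ins LAs n d m e i v 0 = 0"
  by (simp_all add: LAs_simps bilin_left bilin_right)

lemma LAs_ins_linear: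
  "ins LAs n d m e i (v + v') w = ins LAs n d m e i v w + ins LAs n d m e i v' w"
  "ins LAs n d m e i v (w + w') = ins LAs n d m e i v w + ins LAs n d m e i v w'"
  "ins LAs n d m e i (pscale c v) w = pscale c (ins LAs n d m e i v w)"
  "ins LAs n d m e i v (pscale c w) = pscale c (ins LAs n d m e i v w)"
  by (simp_all add: LAs_simps bilin_left bilin_right sg_add pscale_sg)

lemma LAs_carr_cases:
  assumes "x \<in> carr LAs n d"
  obtains "x = 0" | "d = 1 - int n" "supp x \<subseteq> as_words n"
  using assms by (auto simp: LAs_simps split: if_splits)

lemma zero_in_LAs [simp]: "0 \<in> carr LAs n d"
  by (auto simp: LAs_simps)

lemma keys_relabel: "supp x \<subseteq> A \<Longrightarrow> map \<sigma> ` A \<subseteq> B \<Longrightarrow> supp (relabel \<sigma> x) \<subseteq> B"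
  by (erule keys_lin_subset) auto

lemma relabel_relabel: "relabel \<sigma> (relabel \<tau> x) = relabel (\<sigma> \<circ> \<tau>) x"
  by (simp add: free_vs.lin_lin)

lemma word_subst_assoc_sequential:
  assumes "set u \<subseteq> {1..m}" "j \<in> {1..m}" "i \<ge> 1"
  shows "word_subst (i + j - 1) q x (word_subst i m u w) = word_subst i (m + q - 1) (word_subst j q x u) w"
proof (induction w)
  case (Cons l w)
  have "word_subst (i + j - 1) q x (map (\<lambda>k. k + i - 1) u) = map (\<lambda>k. k + i - 1) (word_subst j q x u)"
    using assms(1)
  proof (induction u)
    case (Cons k u)
    then have k: "k \<ge> 1" and IH: "word_subst (i + j - 1) q x (map (\<lambda>k. k + i - 1) u)
      = map (\<lambda>k. k + i - 1) (word_subst j q x u)" by auto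
    have "word_subst (i + j - 1) q x [k + i - 1] = map (\<lambda>k. k + i - 1) (word_subst j q x [k])"
      using k assms(2,3) by (auto simp: word_subst_def)
    then show ?case
      using IH word_subst_append[of _ _ _ "[_]"] by (simp flip: word_subst_append)
        (metis append_Cons append_Nil map_append word_subst_append)
  qed (simp add: word_subst_def)
  then have "word_subst (i + j - 1) q x (word_subst i m u [l]) = word_subst i (m + q - 1) (word_subst j q x u) [l]"
    using assms by (cases "l < i"; cases "l = i") (auto simp: word_subst_def)
  then show ?case
    using Cons by (metis append_Cons append_Nil word_subst_append)
qed (simp add: word_subst_def)

lemma word_subst_assoc_parallel:
  assumes "1 \<le> i" "i < k" "set u \<subseteq> {1..m}" "set x \<subseteq> {1..q}"
  shows "word_subst (k + m - 1) q x (word_subst i m u w) = word_subst i m u (word_subst k q x w)"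
proof (induction w)
  case (Cons l w)
  have u: "1 \<le> j \<and> j \<le> m" if "j \<in> set u" for j using that assms by auto
  have x: "1 \<le> j \<and> j \<le> q" if "j \<in> set x" for j using that assms by auto
  have "word_subst (k + m - 1) q x (map (\<lambda>j. j + i - 1) u) = map (\<lambda>j. j + i - 1) u"
    using assms(1,2) by (subst word_subst_notin) (auto intro!: map_idI simp: shift_letter_def dest!: u)
  moreover have "word_subst i m u (map (\<lambda>j. j + k - 1) x) = map (\<lambda>j. j + (k + m - 1) - 1) x"
    using assms(1,2) by (subst word_subst_notin) (auto simp: shift_letter_def dest!: x)
  ultimately have "word_subst (k + m - 1) q x (word_subst i m u [l]) = word_subst i m u (word_subst k q x [l])"
    using assms by (cases "l < i"; cases "l = i"; cases "l < k"; cases "l = k")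
      (auto simp: word_subst_def)
  then show ?case
    using Cons by (metis append_Cons append_Nil word_subst_append)
qed (simp add: word_subst_def)

lemma word_subst_unit_left: "set w \<subseteq> {1..n} \<Longrightarrow> word_subst 1 n w [1] = w"
  by (simp add: word_subst_def map_idI)

lemma word_subst_unit_right: "word_subst i 1 [1] w = w"
  by (induction w) (auto simp: word_subst_def)

lemma block_perm_eq:
  assumes "\<sigma> permutes {1..n}" "\<tau> permutes {1..m}" "i \<in> {1..n}"
  shows "block_perm n m i \<sigma> \<tau>
    = list_perm (word_subst (\<sigma> i) m (map \<tau> [1..<Suc m]) (map \<sigma> [1..<Suc n]))"
proof -
  have "\<sigma> i \<ge> 1" using assms permutes_in_image[of \<sigma> "{1..n}" i] by auto
  moreover have "\<sigma> a = \<sigma> i \<longleftrightarrow> a = i" for a using assms(1) by (metis permutes_inj injD)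
  ultimately show ?thesis
    unfolding block_perm_def word_subst_def map_map
    by (intro arg_cong[of _ _ list_perm] arg_cong[of _ _ concat] map_cong) auto
qed

lemma upt_split: "a \<le> b \<Longrightarrow> b \<le> c \<Longrightarrow> [a..<c] = [a..<b] @ [b..<c]"
  using upt_add_eq_append[of a b "c - b"] by simp

lemma append_eq_append_split:
  "a @ b @ c = a' @ b' @ c' \<Longrightarrow> length a = length a' \<Longrightarrow> length b = length b' \<Longrightarrow> a = a' \<and> b = b' \<and> c = c'"
  by simp

text \<open>The list of values of the block permutation is a substitution of the word of \<open>\<tau>\<close> into the word of
  \<open>\<sigma>\<close> (\<open>block_perm_eq\<close>), and the list \<open>1,\<dots>,n + m - 1\<close> is the same substitution for the identities. Comparing
  the two lists gives the value of the block permutation at every letter.\<close>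

lemma map_block_perm:
  assumes "\<sigma> permutes {1..n}" "\<tau> permutes {1..m}" "i \<in> {1..n}" "m \<noteq> 0"
    "a \<in> as_words n" "b \<in> as_words m"
  shows "map (block_perm n m i \<sigma> \<tau>) (word_subst i m b a) = word_subst (\<sigma> i) m (map \<tau> b) (map \<sigma> a)"
    and "block_perm n m i \<sigma> \<tau> permutes {1..n + m - 1}"
proof -
  let ?\<beta> = "block_perm n m i \<sigma> \<tau>" and ?f = "shift_letter i m" and ?g = "shift_letter (\<sigma> i) m"
  let ?L = "word_subst (\<sigma> i) m (map \<tau> [1..<Suc m]) (map \<sigma> [1..<Suc n])"
  have \<sigma>i: "\<sigma> i \<in> {1..n}" using assms permutes_in_image[of \<sigma> "{1..n}" i] by auto
  have L: "?L \<in> as_words (n + m - 1)"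
    using assms \<sigma>i by (intro word_subst_as_words map_as_words upt_as_words) auto
  then show "?\<beta> permutes {1..n + m - 1}"
    unfolding block_perm_eq[OF assms(1-3)] as_words_iff by (intro list_perm_permutes) auto
  have up: "[1..<Suc n] = [1..<i] @ i # [Suc i..<Suc n]"
    using assms(3) upt_split[of 1 i "Suc n"] by (simp add: upt_conv_Cons del: upt_Suc)
  have "map ?\<beta> [1..<Suc (n + m - 1)] = ?L"
    unfolding block_perm_eq[OF assms(1-3)] using length_as_words[OF L] by (rule map_list_perm_upt)
  moreover have "[1..<Suc (n + m - 1)]
      = map ?f [1..<i] @ map (\<lambda>j. j + i - 1) [1..<Suc m] @ map ?f [Suc i..<Suc n]"
  proof -
    have "map ?f [1..<i] = [1..<i]" by (intro map_idI) (auto simp: shift_letter_def)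
    moreover have "map (\<lambda>j. j + i - 1) [1..<Suc m] = [i..<i + m]"
      using assms(3) by (intro nth_equalityI) (auto simp del: upt_Suc)
    moreover have "map ?f [Suc i..<Suc n] = [i + m..<n + m]"
      using assms(3,4) by (intro nth_equalityI) (auto simp: shift_letter_def simp del: upt_Suc)
    moreover have "[1..<n + m] = [1..<i] @ [i..<i + m] @ [i + m..<n + m]"
      using assms(3) upt_split[of 1 i "n + m"] upt_split[of i "i + m" "n + m"] by simp
    moreover have "Suc (n + m - 1) = n + m" using assms(4) by auto
    ultimately show ?thesis by simp
  qed
  moreover have "?L = map ?g (map \<sigma> [1..<i]) @ map (\<lambda>j. j + \<sigma> i - 1) (map \<tau> [1..<Suc m])
      @ map ?g (map \<sigma> [Suc i..<Suc n])"
    unfolding up list.map map_append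
    by (intro word_subst_split) (auto dest!: injD[OF permutes_inj[OF assms(1)]])
  ultimately have "map ?\<beta> (map ?f [1..<i]) = map ?g (map \<sigma> [1..<i])
    \<and> map ?\<beta> (map (\<lambda>j. j + i - 1) [1..<Suc m]) = map (\<lambda>j. j + \<sigma> i - 1) (map \<tau> [1..<Suc m])
    \<and> map ?\<beta> (map ?f [Suc i..<Suc n]) = map ?g (map \<sigma> [Suc i..<Suc n])"
    by (intro append_eq_append_split) (simp_all only: map_append length_map)
  then have \<beta>: "\<And>l. l \<in> set [1..<i] \<union> set [Suc i..<Suc n] \<Longrightarrow> ?\<beta> (?f l) = ?g (\<sigma> l)"
    "\<And>j. j \<in> set [1..<Suc m] \<Longrightarrow> ?\<beta> (j + i - 1) = \<tau> j + \<sigma> i - 1"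
    unfolding map_map map_eq_conv by auto
  obtain us vs where a: "a = us @ i # vs" "i \<notin> set us" "i \<notin> set vs" "set us \<union> set vs = {1..n} - {i}"
    using as_words_split[OF assms(5,3)] .
  have "l \<in> set [1..<i] \<union> set [Suc i..<Suc n]" if "l \<in> set us \<union> set vs" for l
  proof -
    have "l \<in> {1..n} - {i}" using that a(4) by blast
    then show ?thesis by (auto simp del: upt_Suc)
  qed
  then have "map ?\<beta> (map ?f us) = map ?g (map \<sigma> us)" "map ?\<beta> (map ?f vs) = map ?g (map \<sigma> vs)"
    unfolding map_map o_def map_eq_conv using \<beta>(1) by (metis UnCI)+
  moreover have "j \<in> set [1..<Suc m]" if "j \<in> set b" for j
    using that assms(6) by (auto simp: as_words_iff simp del: upt_Suc)
  then have "map ?\<beta> (map (\<lambda>j. j + i - 1) b) = map (\<lambda>j. j + \<sigma> i - 1) (map \<tau> b)"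
    unfolding map_map o_def map_eq_conv using \<beta>(2) by metis
  moreover have "word_subst (\<sigma> i) m (map \<tau> b) (map \<sigma> us @ \<sigma> i # map \<sigma> vs)
      = map ?g (map \<sigma> us) @ map (\<lambda>j. j + \<sigma> i - 1) (map \<tau> b) @ map ?g (map \<sigma> vs)"
    using a by (intro word_subst_split) (auto dest!: injD[OF permutes_inj[OF assms(1)]])
  ultimately show "map ?\<beta> (word_subst i m b a) = word_subst (\<sigma> i) m (map \<tau> b) (map \<sigma> a)"
    unfolding a(1) word_subst_split[OF a(2,3)] by simp
qed

text \<open>The sign of a permutation is visible on any word. On \<open>word_subst i m b a\<close> the block permutation
  changes the inversions as computed by \<open>inversions_word_subst\<close>, and the position of \<open>\<sigma> i\<close> in \<open>map \<sigma> a\<close>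
  is that of \<open>i\<close> in \<open>a\<close>, so that only the labels \<open>i\<close> and \<open>\<sigma> i\<close> remain.\<close>

lemma perm_parity_block_perm:
  assumes "\<sigma> permutes {1..n}" "\<tau> permutes {1..m}" "i \<in> {1..n}" "a \<in> as_words n" "b \<in> as_words m"
  shows "even (perm_parity (block_perm n m i \<sigma> \<tau>) + (int i - 1) * (1 - int m))
    = even (perm_parity \<sigma> + perm_parity \<tau> + (int (\<sigma> i) - 1) * (1 - int m))"
proof -
  have m: "m \<noteq> 0" using assms(5) by (auto simp: as_words_iff)
  have \<sigma>i: "\<sigma> i \<in> {1..n}" using assms permutes_in_image[of \<sigma> "{1..n}" i] by auto
  note b = map_block_perm[OF assms(1-3) m assms(4,5)]
  note 1 = inversions_as_words[OF b(2) word_subst_as_words[OF assms(4,5,3)], unfolded b(1)]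
  note 2 = inversions_word_subst[OF assms(4,5,3)]
  note 3 = inversions_word_subst[OF map_as_words[OF assms(4,1)] map_as_words[OF assms(5,2)] \<sigma>i]
  have 4: "position (\<sigma> i) (map \<sigma> a) = position i a"
    using permutes_inj_on[OF assms(1)] by (rule position_map)
  show ?thesis
    using 1 2 3 inversions_as_words[OF assms(1,4)] inversions_as_words[OF assms(2,5)]
    unfolding 4 by (simp add: even_mult_iff) argo
qed

lemma LAs_equivariant:
  assumes "v \<in> carr LAs n d" "w \<in> carr LAs m e" "i \<in> {1..n}" "\<sigma> permutes {1..n}" "\<tau> permutes {1..m}"
  shows "ins LAs n d m e (\<sigma> i) (act LAs n d \<sigma> v) (act LAs m e \<tau> w)
    = act LAs (n + m - 1) (d + e) (block_perm n m i \<sigma> \<tau>) (ins LAs n d m e i v w)"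
proof (cases "v = 0 \<or> w = 0")
  case True
  then show ?thesis by (auto simp: LAs_simps bilin_left bilin_right)
next
  case False
  then have vw: "d = 1 - int n" "supp v \<subseteq> as_words n"
    "e = 1 - int m" "supp w \<subseteq> as_words m"
    using assms(1,2) by (auto simp: LAs_simps split: if_splits)
  have eq: "bilin (\<lambda>a b. sg (perm_parity \<sigma> + perm_parity \<tau> + (int (\<sigma> i) - 1) * (1 - int m))
        (single (word_subst (\<sigma> i) m (map \<tau> b) (map \<sigma> a)) 1)) v w
    = bilin (\<lambda>a b. sg (perm_parity (block_perm n m i \<sigma> \<tau>) + (int i - 1) * (1 - int m))
        (single (map (block_perm n m i \<sigma> \<tau>) (word_subst i m b a)) (1::'a))) v w"
  proof (rule bilin_cong)
    fix a b assume "a \<in> supp v" "b \<in> supp w"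
    then have ab: "a \<in> as_words n" "b \<in> as_words m" using vw by auto
    then have "m \<noteq> 0" by (auto simp: as_words_iff)
    show "sg (perm_parity \<sigma> + perm_parity \<tau> + (int (\<sigma> i) - 1) * (1 - int m))
        (single (word_subst (\<sigma> i) m (map \<tau> b) (map \<sigma> a)) 1)
      = sg (perm_parity (block_perm n m i \<sigma> \<tau>) + (int i - 1) * (1 - int m))
        (single (map (block_perm n m i \<sigma> \<tau>) (word_subst i m b a)) (1::'a))"
      unfolding map_block_perm(1)[OF assms(4,5,3) \<open>m \<noteq> 0\<close> ab]
      by (rule sg_cong) (rule perm_parity_block_perm[OF assms(4,5,3) ab, symmetric])
  qed
  have "ins LAs n d m e (\<sigma> i) (act LAs n d \<sigma> v) (act LAs m e \<tau> w)
    = bilin (\<lambda>a b. sg (perm_parity \<sigma> + perm_parity \<tau> + (int (\<sigma> i) - 1) * (1 - int m))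
        (single (word_subst (\<sigma> i) m (map \<tau> b) (map \<sigma> a)) 1)) v w"
    unfolding LAs_simps bilin_fun_sg
    by (simp add: vw(1) bilin_def free_vs.lin_lin free_vs.lin_sg free_vs.lin_fun_sg sg_sg add_ac)
  moreover have "act LAs (n + m - 1) (d + e) (block_perm n m i \<sigma> \<tau>) (ins LAs n d m e i v w)
    = bilin (\<lambda>a b. sg (perm_parity (block_perm n m i \<sigma> \<tau>) + (int i - 1) * (1 - int m))
        (single (map (block_perm n m i \<sigma> \<tau>) (word_subst i m b a)) (1::'a))) v w"
    unfolding LAs_simps bilin_fun_sg free_vs.lin_sg sg_sg
    by (simp add: vw(1) bilin_def free_vs.lin_lin)
  ultimately show ?thesis using eq by simp
qed

lemma LAs_assoc_sequential:
  assumes "u \<in> carr LAs n d" "v \<in> carr LAs m e" "w \<in> carr LAs q f" "i \<in> {1..n}" "j \<in> {1..m}"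
  shows "ins LAs (n + m - 1) (d + e) q f (i + j - 1) (ins LAs n d m e i u v) w
    = ins LAs n d (m + q - 1) (e + f) i u (ins LAs m e q f j v w)"
proof (cases "u = 0 \<or> v = 0 \<or> w = 0")
  case False
  then have d: "d = 1 - int n" "e = 1 - int m" and k: "supp v \<subseteq> as_words m"
    using assms(1-3) by (auto simp: LAs_simps split: if_splits)
  have eq: "lin pscale (\<lambda>a. lin pscale (\<lambda>b. lin pscale (\<lambda>c.
      single (word_subst (i + j - 1) q c (word_subst i m b a)) (1::'a)) w) v) u
    = lin pscale (\<lambda>a. lin pscale (\<lambda>b. lin pscale (\<lambda>c.
      single (word_subst i (m + q - 1) (word_subst j q c b) a) 1) w) v) u"
  proof (intro free_vs.lin_cong)
    fix a b c assume "b \<in> supp v"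
    then have "set b \<subseteq> {1..m}" using k by (auto simp: as_words_iff)
    then show "single (word_subst (i + j - 1) q c (word_subst i m b a)) (1::'a)
        = single (word_subst i (m + q - 1) (word_subst j q c b) a) 1"
      using assms by (subst word_subst_assoc_sequential) auto
  qed
  have sign: "(d + e - (1 - int (n + m - 1))) * (1 - int q) + (int (i + j - 1) - 1) * (1 - int q)
      + ((d - (1 - int n)) * (1 - int m) + (int i - 1) * (1 - int m))
    = (d - (1 - int n)) * (1 - int (m + q - 1)) + (int i - 1) * (1 - int (m + q - 1))
      + ((e - (1 - int m)) * (1 - int q) + (int j - 1) * (1 - int q))"
    using assms(4,5) by (simp add: d of_nat_diff algebra_simps)
  have "ins LAs (n + m - 1) (d + e) q f (i + j - 1) (ins LAs n d m e i u v) w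
    = sg ((d + e - (1 - int (n + m - 1))) * (1 - int q) + (int (i + j - 1) - 1) * (1 - int q)
      + ((d - (1 - int n)) * (1 - int m) + (int i - 1) * (1 - int m)))
      (lin pscale (\<lambda>a. lin pscale (\<lambda>b. lin pscale (\<lambda>c.
      single (word_subst (i + j - 1) q c (word_subst i m b a)) (1::'a)) w) v) u)"
    unfolding LAs_simps bilin_left sg_sg by (simp add: bilin_def free_vs.lin_lin)
  also have "\<dots> = ins LAs n d (m + q - 1) (e + f) i u (ins LAs m e q f j v w)"
    unfolding sign eq unfolding LAs_simps bilin_right sg_sg by (simp add: bilin_def free_vs.lin_lin)
  finally show ?thesis .
qed auto

lemma LAs_assoc_parallel:
  assumes "u \<in> carr LAs n d" "v \<in> carr LAs m e" "w \<in> carr LAs q f" "1 \<le> i" "i < k" "k \<le> n"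
  shows "ins LAs (n + m - 1) (d + e) q f (k + m - 1) (ins LAs n d m e i u v) w
    = sg (e * f) (ins LAs (n + q - 1) (d + f) m e i (ins LAs n d q f k u w) v)"
proof (cases "u = 0 \<or> v = 0 \<or> w = 0")
  case False
  then have d: "d = 1 - int n" "e = 1 - int m" "f = 1 - int q"
    and k: "supp v \<subseteq> as_words m" "supp w \<subseteq> as_words q"
    using assms(1-3) by (auto simp: LAs_simps split: if_splits)
  have eq: "lin pscale (\<lambda>a. lin pscale (\<lambda>b. lin pscale (\<lambda>c.
      single (word_subst (k + m - 1) q c (word_subst i m b a)) (1::'a)) w) v) u
    = lin pscale (\<lambda>a. lin pscale (\<lambda>c. lin pscale (\<lambda>b.
      single (word_subst i m b (word_subst k q c a)) 1) v) w) u"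
    unfolding free_vs.lin_swap[of _ v w]
  proof (intro free_vs.lin_cong)
    fix a b c assume "b \<in> supp v" "c \<in> supp w"
    then have "set b \<subseteq> {1..m}" "set c \<subseteq> {1..q}" using k by (auto simp: as_words_iff)
    then show "single (word_subst (k + m - 1) q c (word_subst i m b a)) (1::'a)
        = single (word_subst i m b (word_subst k q c a)) 1"
      using assms by (subst word_subst_assoc_parallel) auto
  qed
  have sign: "(d + e - (1 - int (n + m - 1))) * (1 - int q) + (int (k + m - 1) - 1) * (1 - int q)
      + ((d - (1 - int n)) * (1 - int m) + (int i - 1) * (1 - int m))
    = e * f + ((d + f - (1 - int (n + q - 1))) * (1 - int m) + (int i - 1) * (1 - int m)
      + ((d - (1 - int n)) * (1 - int q) + (int k - 1) * (1 - int q))) - 2 * (1 - int m) * (1 - int q)"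
    using assms(4-6) by (simp add: d of_nat_diff algebra_simps)
  have "ins LAs (n + m - 1) (d + e) q f (k + m - 1) (ins LAs n d m e i u v) w
    = sg ((d + e - (1 - int (n + m - 1))) * (1 - int q) + (int (k + m - 1) - 1) * (1 - int q)
      + ((d - (1 - int n)) * (1 - int m) + (int i - 1) * (1 - int m)))
      (lin pscale (\<lambda>a. lin pscale (\<lambda>b. lin pscale (\<lambda>c.
      single (word_subst (k + m - 1) q c (word_subst i m b a)) (1::'a)) w) v) u)"
    unfolding LAs_simps bilin_left sg_sg by (simp add: bilin_def free_vs.lin_lin)
  also have "\<dots> = sg (e * f + ((d + f - (1 - int (n + q - 1))) * (1 - int m) + (int i - 1) * (1 - int m)
      + ((d - (1 - int n)) * (1 - int q) + (int k - 1) * (1 - int q)))) (lin pscale (\<lambda>a. lin pscale (\<lambda>c. lin pscale (\<lambda>b.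
      single (word_subst i m b (word_subst k q c a)) 1) v) w) u)"
    unfolding sign eq by (rule sg_cong) simp
  also have "\<dots> = sg (e * f) (ins LAs (n + q - 1) (d + f) m e i (ins LAs n d q f k u w) v)"
    unfolding LAs_simps bilin_left sg_sg by (simp add: bilin_def free_vs.lin_lin)
  finally show ?thesis .
qed auto

lemma evenperm_permutes_comp:
  "finite S \<Longrightarrow> \<sigma> permutes S \<Longrightarrow> \<tau> permutes S \<Longrightarrow> even (perm_parity (\<sigma> \<circ> \<tau>)) = even (perm_parity \<sigma> + perm_parity \<tau>)"
  using evenperm_comp[of \<sigma> \<tau>] permutation_permutes by (auto simp: perm_parity_def)

lemma subspace_LAs: "free_vs.subspace (carr LAs n d)"
proof (rule free_vs.subspaceI)
  fix x y :: "'a ncpoly" and c :: 'a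
  assume x: "x \<in> carr LAs n d" and "y \<in> carr LAs n d"
  then show "x + y \<in> carr LAs n d"
    using Poly_Mapping.keys_add[of x y] by (auto simp: LAs_simps split: if_splits)
  show "pscale c x \<in> carr LAs n d"
    using x free_vs.keys_pscale_subset[of c x] by (auto simp: LAs_simps split: if_splits)
qed simp

lemma keys_ins_words:
  assumes "supp v \<subseteq> as_words n" "supp w \<subseteq> as_words m" "i \<in> {1..n}"
  shows "supp (bilin (\<lambda>w u. single (word_subst i m u w) 1) v w)
    \<subseteq> as_words (n + m - 1)"
  by (rule keys_bilin_subset[OF assms(1,2)]) (auto intro!: word_subst_as_words[OF _ _ assms(3)] simp del: One_nat_def)

lemma LAs_ins_closed:
  assumes "v \<in> carr LAs n d" "w \<in> carr LAs m e" "i \<in> {1..n}"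
  shows "ins LAs n d m e i v w \<in> carr LAs (n + m - 1) (d + e)"
proof (cases "v = 0 \<or> w = 0")
  case False
  then have "d = 1 - int n" "e = 1 - int m" "supp v \<subseteq> as_words n" "supp w \<subseteq> as_words m"
    using assms(1-2) by (auto simp: LAs_simps split: if_splits)
  then show ?thesis
    using keys_ins_words[of v n w m i] assms(3) by (simp add: LAs_simps of_nat_diff)
qed auto

lemma LAs_act_closed:
  assumes "v \<in> carr LAs n d" "\<sigma> permutes {1..n}" shows "act LAs n d \<sigma> v \<in> carr LAs n d"
  using assms(1)
proof (cases rule: LAs_carr_cases)
  case 2
  then have "supp (relabel \<sigma> v) \<subseteq> as_words n"
    using map_as_words[OF _ assms(2)] by (intro keys_relabel) auto
  then show ?thesis using 2 by (simp add: LAs_simps)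
qed (simp add: LAs_simps)

lemma dg_operad_LAs: "dg_operad (LAs :: ('k::field_char_0, 'k ncpoly) dgop)"
proof (intro dg_operad.intro dg_operad_axioms.intro)
  show "vector_space (scl (LAs :: ('k, 'k ncpoly) dgop))"
    by (simp add: LAs_simps free_vs.vector_space_axioms)
next
  fix n d show "module.subspace (scl (LAs :: ('k, 'k ncpoly) dgop)) (carr LAs n d)"
    using subspace_LAs by (simp add: LAs_simps(2))
next
  show "unt (LAs :: ('k, 'k ncpoly) dgop) \<in> carr LAs 1 0"
    by (auto simp: LAs_simps as_words_def)
next
  fix w :: "'k ncpoly" and m e i n d
  show "linear_from (carr LAs n d) (scl LAs) (scl LAs) (\<lambda>v. ins LAs n d m e i v w)"
    unfolding linear_from_def LAs_simps(2) by (simp add: LAs_ins_linear)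
next
  fix v :: "'k ncpoly" and m e i n d
  show "linear_from (carr LAs m e) (scl LAs) (scl LAs) (ins LAs n d m e i v)"
    unfolding linear_from_def LAs_simps(2) by (simp add: LAs_ins_linear)
next
  fix \<sigma> n d show "linear_from (carr LAs n d) (scl (LAs :: ('k, 'k ncpoly) dgop)) (scl LAs) (act LAs n d \<sigma>)"
    unfolding linear_from_def LAs_simps(2,4) by (simp add: free_vs.lin_add free_vs.lin_pscale sg_add pscale_sg)
next
  fix n d show "linear_from (carr LAs n d) (scl (LAs :: ('k, 'k ncpoly) dgop)) (scl LAs) (dif LAs n d)"
    unfolding linear_from_def by (simp add: LAs_simps)
next
  fix v :: "'k ncpoly" and n d assume "v \<in> carr LAs n d"
  then show "act LAs n d id v = v" by (simp add: LAs_simps perm_parity_def evenperm_id)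
next
  fix v :: "'k ncpoly" and n d \<sigma> \<tau>
  assume "v \<in> carr LAs n d" "\<sigma> permutes {1..n}" "\<tau> permutes {1..n}"
  then show "act LAs n d (\<sigma> \<circ> \<tau>) v = act LAs n d \<sigma> (act LAs n d \<tau> v)"
    unfolding LAs_simps(4) free_vs.lin_sg relabel_relabel sg_sg
    by (intro sg_cong evenperm_permutes_comp) auto
next
  fix v :: "'k ncpoly" and n d assume v: "v \<in> carr LAs n d"
  then have "lin pscale (\<lambda>u. single (word_subst 1 n u [1]) (1::'k)) v
    = lin pscale (\<lambda>u. single u 1) v"
    by (intro free_vs.lin_cong) (subst word_subst_unit_left, auto simp: LAs_simps as_words_iff split: if_splits)
  then show "ins LAs 1 0 n d 1 (unt LAs) v = v"
    by (simp add: LAs_simps bilin_def)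
next
  fix v :: "'k ncpoly" and n d i
  show "ins LAs n d 1 0 i v (unt LAs) = v"
    by (simp add: LAs_simps bilin_def word_subst_unit_right[simplified])
next
  fix v w :: "'k ncpoly" and n d m e i
  show "dif LAs (n + m - 1) (d + e) (ins LAs n d m e i v w)
    = ins LAs n (d + 1) m e i (dif LAs n d v) w + sg d (ins LAs n d m (e + 1) i v (dif LAs m e w))"
    by (simp add: LAs_simps(5))
qed (assumption | rule LAs_ins_closed LAs_act_closed LAs_assoc_sequential LAs_assoc_parallel
       LAs_equivariant | simp add: LAs_simps(5) | simp add: LAs_simps(4))+

section \<open>Signed words\<close>

text \<open>The change between the words \<open>w\<close> and the signed words \<open>sgn(w) w\<close>, which is an involution. The
  action becomes relabelling without a sign, and the sign of an insertion depends on the position of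
  the input in the word instead of its label.\<close>

definition theta :: "'k::field ncpoly \<Rightarrow> 'k ncpoly" where
  "theta = lin pscale (\<lambda>w. sg (int (inversions w)) (single w 1))"

lemma lookup_theta: "coeff (theta x) w = sg (int (inversions w)) (coeff x w)"
proof -
  have "coeff (theta x) w
      = (\<Sum>b\<in>supp x. if b = w then sg (int (inversions w)) (coeff x w) else 0)"
    unfolding theta_def lookup_lin
    by (intro sum.cong) (auto simp: lookup_sg lookup_single when_def sg_mult)
  then show ?thesis by (simp add: in_keys_iff)
qed

lemma keys_theta [simp]: "supp (theta x) = supp x"
  by (auto simp: in_keys_iff lookup_theta)

lemma theta_theta [simp]: "theta (theta x) = x"
  by (rule poly_mapping_eqI) (auto simp: lookup_theta sg_sg sg_def)

lemma theta_linear: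
  "theta 0 = 0" "theta (x + y) = theta x + theta y" "theta (- x) = - theta x"
  "theta (sg e x) = sg e (theta x)" "theta (pscale c x) = pscale c (theta x)"
  "theta (sum f A) = (\<Sum>a\<in>A. theta (f a))"
  "theta (x - y) = theta x - theta y"
  "theta (lin pscale k z) = lin pscale (\<lambda>b. theta (k b)) z"
  by (simp_all add: theta_def free_vs.lin_add free_vs.lin_uminus free_vs.lin_diff
      free_vs.lin_sg free_vs.lin_pscale free_vs.lin_sum free_vs.lin_lin)

lemma theta_single: "theta (single w c) = sg (int (inversions w)) (single w c)"
  by (rule poly_mapping_eqI) (auto simp: lookup_theta lookup_sg lookup_single when_def)

definition signed_ins :: "nat \<Rightarrow> nat \<Rightarrow> 'k::field ncpoly \<Rightarrow> 'k ncpoly \<Rightarrow> 'k ncpoly" where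
  "signed_ins i m = bilin (\<lambda>w u. sg ((int m - 1) * int (position i w)) (single (word_subst i m u w) 1))"

lemma LAs_act_theta:
  assumes "supp x \<subseteq> as_words n" "\<sigma> permutes {1..n}"
  shows "act LAs n d \<sigma> (theta x) = theta (relabel \<sigma> x)"
proof -
  have "relabel \<sigma> (theta x) = lin pscale (\<lambda>w. sg (int (inversions w)) (single (map \<sigma> w) 1)) x"
    by (simp add: theta_def free_vs.lin_lin free_vs.lin_sg)
  also have "sg (perm_parity \<sigma>) \<dots> = lin pscale (\<lambda>w. sg (int (inversions (map \<sigma> w))) (single (map \<sigma> w) 1)) x"
    unfolding free_vs.lin_fun_sg[symmetric]
  proof (rule free_vs.lin_cong)
    fix w assume "w \<in> supp x"
    then have "w \<in> as_words n" using assms(1) by auto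
    from inversions_as_words[OF assms(2) this]
    show "sg (perm_parity \<sigma>) (sg (int (inversions w)) (single (map \<sigma> w) 1))
        = sg (int (inversions (map \<sigma> w))) (single (map \<sigma> w) 1)"
      unfolding sg_sg by (intro sg_cong) simp
  qed
  also have "\<dots> = theta (relabel \<sigma> x)"
    by (simp add: theta_linear theta_single)
  finally show ?thesis by (simp add: LAs_simps)
qed

text \<open>The label \<open>i\<close> contributes \<open>(i - 1)(m - 1)\<close> to the sign of the insertion in \<open>Lam As\<close> and to the number of
  inversions of the substituted word, so that only the position of \<open>i\<close> survives.\<close>

lemma LAs_ins_theta:
  assumes "supp x \<subseteq> as_words n" "supp y \<subseteq> as_words m" "i \<in> {1..n}"
  shows "ins LAs n (1 - int n) m e i (theta x) (theta y) = theta (signed_ins i m x y)"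
proof -
  have "ins LAs n (1 - int n) m e i (theta x) (theta y)
    = bilin (\<lambda>w u. sg ((int i - 1) * (1 - int m) + (int (inversions w) + int (inversions u)))
        (single (word_subst i m u w) 1)) x y"
    by (simp add: LAs_simps theta_def bilin_def free_vs.lin_lin free_vs.lin_sg)
      (simp add: sg_sg add.assoc flip: free_vs.lin_fun_sg)
  also have "\<dots> = bilin (\<lambda>w u. sg ((int m - 1) * int (position i w) + int (inversions (word_subst i m u w)))
        (single (word_subst i m u w) 1)) x y"
  proof (intro bilin_cong sg_cong)
    fix w u assume "w \<in> supp x" "u \<in> supp y"
    then have "w \<in> as_words n" "u \<in> as_words m" using assms by auto
    from inversions_word_subst[OF this assms(3)]
    show "even ((int i - 1) * (1 - int m) + (int (inversions w) + int (inversions u)))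
      = even ((int m - 1) * int (position i w) + int (inversions (word_subst i m u w)))"
      by (simp add: even_mult_iff) argo
  qed
  also have "\<dots> = theta (signed_ins i m x y)"
    by (simp add: signed_ins_def bilin_def theta_linear theta_single sg_sg)
  finally show ?thesis .
qed

lemma keys_signed_ins:
  assumes "supp x \<subseteq> as_words n" "supp y \<subseteq> as_words m" "i \<in> {1..n}"
  shows "supp (signed_ins i m x y) \<subseteq> as_words (n + m - 1)"
  unfolding signed_ins_def
  by (rule keys_bilin_subset[OF assms(1,2)]) (auto intro!: word_subst_as_words[OF _ _ assms(3)] simp del: One_nat_def)

section \<open>Substitution into products of words\<close>

text \<open>Here \<open>e\<close> is the degree with which the inserted words move past the letters to the left of \<open>i\<close>:
  \<open>e = 0\<close> is the insertion of \<open>As\<close>, and \<open>e = m - 1\<close> is the insertion of signed words.\<close>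

definition signed_subst :: "int \<Rightarrow> nat \<Rightarrow> nat \<Rightarrow> 'k::field ncpoly \<Rightarrow> 'k ncpoly \<Rightarrow> 'k ncpoly" where
  "signed_subst e i m = bilin (\<lambda>w u. sg (e * int (position i w)) (single (word_subst i m u w) 1))"

lemma signed_ins_signed_subst: "signed_ins i m = signed_subst (int m - 1) i m"
  by (simp add: signed_ins_def signed_subst_def)

lemma signed_subst_0: "bilin (\<lambda>w u. single (word_subst i m u w) 1) = signed_subst 0 i m"
  by (simp add: signed_subst_def)

lemma word_mult_left:
  "word_mult 0 y = 0" "word_mult (x + x') y = word_mult x y + word_mult x' y"
  "word_mult (- x) y = - word_mult x y" "word_mult (x - x') y = word_mult x y - word_mult x' y"
  "word_mult (pscale c x) y = pscale c (word_mult x y)" "word_mult (sg e x) y = sg e (word_mult x y)"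
  "word_mult (\<Sum>a\<in>A. h a) y = (\<Sum>a\<in>A. word_mult (h a) y)"
  "word_mult (lin pscale k z) y = lin pscale (\<lambda>b. word_mult (k b) y) z"
  unfolding word_mult_def by (rule bilin_left)+

lemma word_mult_right:
  "word_mult x 0 = 0" "word_mult x (y + y') = word_mult x y + word_mult x y'"
  "word_mult x (- y) = - word_mult x y" "word_mult x (y - y') = word_mult x y - word_mult x y'"
  "word_mult x (pscale c y) = pscale c (word_mult x y)" "word_mult x (sg e y) = sg e (word_mult x y)"
  "word_mult x (\<Sum>a\<in>A. h a) = (\<Sum>a\<in>A. word_mult x (h a))"
  "word_mult x (lin pscale k z) = lin pscale (\<lambda>b. word_mult x (k b)) z"
  unfolding word_mult_def by (rule bilin_right)+

lemma word_mult_single: "word_mult (single u 1) (single v 1) = single (u @ v) 1"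
  by (simp add: word_mult_def)

lemma word_mult_assoc: "word_mult (word_mult x y) z = word_mult x (word_mult y z)"
  by (simp add: word_mult_def bilin_def free_vs.lin_lin)

lemma relabel_word_mult: "relabel \<sigma> (word_mult x y) = word_mult (relabel \<sigma> x) (relabel \<sigma> y)"
  by (simp add: word_mult_def bilin_def free_vs.lin_lin)

lemma keys_word_mult:
  assumes "w \<in> supp (word_mult x y)"
  obtains u v where "u \<in> supp x" "v \<in> supp y" "w = u @ v"
proof -
  have "supp (word_mult x y)
      \<subseteq> {u @ v | u v. u \<in> supp x \<and> v \<in> supp y}"
    unfolding word_mult_def by (rule keys_bilin_subset[OF order_refl order_refl]) auto
  then show thesis using assms that by blast
qed

lemma signed_subst_diff: "signed_subst e i m (x - y) z = signed_subst e i m x z - signed_subst e i m y z"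
  by (simp add: signed_subst_def bilin_left)

lemma signed_subst_mult_left:
  assumes "\<And>w. w \<in> supp x \<Longrightarrow> i \<in> set w" "\<And>w. w \<in> supp y \<Longrightarrow> i \<notin> set w"
  shows "signed_subst e i m (word_mult x y) z = word_mult (signed_subst e i m x z) (relabel (shift_letter i m) y)"
proof -
  have "signed_subst e i m (word_mult x y) z = lin pscale (\<lambda>a. lin pscale (\<lambda>b. lin pscale (\<lambda>c.
      sg (e * int (position i (a @ b))) (single (word_subst i m c (a @ b)) 1)) z) y) x"
    by (simp add: signed_subst_def word_mult_def bilin_def free_vs.lin_lin)
  also have "\<dots> = lin pscale (\<lambda>a. lin pscale (\<lambda>b. lin pscale (\<lambda>c.
      sg (e * int (position i a)) (single (word_subst i m c a @ map (shift_letter i m) b) 1)) z) y) x"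
    by (intro free_vs.lin_cong) (simp add: assms position_append word_subst_append word_subst_notin)
  also have "\<dots> = word_mult (signed_subst e i m x z) (relabel (shift_letter i m) y)"
    by (simp add: signed_subst_def word_mult_def bilin_def free_vs.lin_lin free_vs.lin_sg free_vs.lin_fun_sg
        free_vs.lin_swap[of _ z y])
  finally show ?thesis .
qed

lemma signed_subst_mult_right:
  assumes "\<And>w. w \<in> supp x \<Longrightarrow> i \<notin> set w \<and> length w = l"
  shows "signed_subst e i m (word_mult x y) z = sg (e * int l) (word_mult (relabel (shift_letter i m) x) (signed_subst e i m y z))"
proof -
  have "signed_subst e i m (word_mult x y) z = lin pscale (\<lambda>a. lin pscale (\<lambda>b. lin pscale (\<lambda>c.
      sg (e * int (position i (a @ b))) (single (word_subst i m c (a @ b)) 1)) z) y) x"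
    by (simp add: signed_subst_def word_mult_def bilin_def free_vs.lin_lin)
  also have "\<dots> = lin pscale (\<lambda>a. lin pscale (\<lambda>b. lin pscale (\<lambda>c.
      sg (e * int l) (sg (e * int (position i b)) (single (map (shift_letter i m) a @ word_subst i m c b) 1))) z) y) x"
    by (intro free_vs.lin_cong)
      (auto simp: assms position_append word_subst_append word_subst_notin sg_sg algebra_simps)
  also have "\<dots> = sg (e * int l) (word_mult (relabel (shift_letter i m) x) (signed_subst e i m y z))"
    unfolding free_vs.lin_fun_sg
    by (simp add: signed_subst_def word_mult_def bilin_def free_vs.lin_lin free_vs.lin_sg free_vs.lin_fun_sg)
  finally show ?thesis .
qed

section \<open>From Lie to associative algebras\<close>

lemma lookup_map_of_int:
  "coeff (Poly_Mapping.map of_int x) b = of_int (coeff x b)"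
  by (simp add: Poly_Mapping.map.rep_eq when_def)

lemma map_of_int_add: "Poly_Mapping.map of_int (x + y) = Poly_Mapping.map of_int x + Poly_Mapping.map of_int y"
  by (rule poly_mapping_eqI) (simp add: lookup_map_of_int lookup_add)

lemma map_of_int_diff: "Poly_Mapping.map of_int (x - y) = Poly_Mapping.map of_int x - Poly_Mapping.map of_int y"
  by (rule poly_mapping_eqI) (simp add: lookup_map_of_int lookup_minus)

lemma map_of_int_single: "Poly_Mapping.map of_int (single b c) = single b (of_int c)"
  by (rule poly_mapping_eqI) (simp add: lookup_map_of_int lookup_single when_def)

lemma map_of_int_sum: "Poly_Mapping.map of_int (\<Sum>a\<in>A. f a) = (\<Sum>a\<in>A. Poly_Mapping.map of_int (f a))"
  by (rule poly_mapping_eqI) (simp add: lookup_map_of_int lookup_sum)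

lemma lin_map_of_int:
  "lin pscale f (Poly_Mapping.map of_int x)
    = (\<Sum>b\<in>supp x. pscale (of_int (coeff x b)) (f b))"
  by (subst free_vs.lin_superset[of "supp x"])
    (auto simp: lookup_map_of_int in_keys_iff)

text \<open>The free associative algebra is a Lie algebra under the commutator; the closure rules \<open>left\<close> and
  \<open>right\<close> for the relations are respected because the commutator is bilinear.\<close>

lemma kills_relators_commutator: "kills_relators (commutator :: lie_mon \<Rightarrow> 'k::field ncpoly)"
  unfolding kills_relators_def relators_lie_mon_def
proof
  fix r assume "r \<in> lie_relators"
  then show "lin pscale (commutator :: _ \<Rightarrow> 'k ncpoly) (Poly_Mapping.map of_int r) = 0"
  proof induction
    case (left x t)
    have "lin pscale (commutator :: _ \<Rightarrow> 'k ncpoly) (Poly_Mapping.map of_int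
        (\<Sum>s\<in>supp x. single (Br s t) (coeff x s)))
      = word_mult (lin pscale commutator (Poly_Mapping.map of_int x)) (commutator t)
        - word_mult (commutator t) (lin pscale commutator (Poly_Mapping.map of_int x))"
      unfolding lin_map_of_int[of _ x]
      by (simp add: map_of_int_sum map_of_int_single free_vs.lin_sum word_mult_left word_mult_right
          free_vs.scale_right_diff_distrib sum_subtractf)
    then show ?case by (simp add: left.IH word_mult_left word_mult_right)
  next
    case (right x t)
    have "lin pscale (commutator :: _ \<Rightarrow> 'k ncpoly) (Poly_Mapping.map of_int
        (\<Sum>s\<in>supp x. single (Br t s) (coeff x s)))
      = word_mult (commutator t) (lin pscale commutator (Poly_Mapping.map of_int x))
        - word_mult (lin pscale commutator (Poly_Mapping.map of_int x)) (commutator t)"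
      unfolding lin_map_of_int[of _ x]
      by (simp add: map_of_int_sum map_of_int_single free_vs.lin_sum word_mult_left word_mult_right
          free_vs.scale_right_diff_distrib sum_subtractf)
    then show ?case by (simp add: right.IH word_mult_left word_mult_right)
  qed (simp_all add: map_of_int_add map_of_int_single free_vs.lin_add word_mult_left word_mult_right
      word_mult_assoc)
qed

lemma keys_commutator: "w \<in> supp (commutator t) \<Longrightarrow> mset w = mset (lie_leaves t)"
proof (induction t arbitrary: w)
  case (Br s t)
  have "w \<in> supp (word_mult (commutator s) (commutator t) :: 'a ncpoly)
      \<union> supp (word_mult (commutator t) (commutator s) :: 'a ncpoly)"
    using Br.prems keys_diff by fastforce
  then show ?case using Br.IH by (auto elim!: keys_word_mult)
qed simp

lemma set_keys_commutator: "w \<in> supp (commutator t) \<Longrightarrow> set w = set (lie_leaves t)"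
  by (metis keys_commutator set_mset_mset)

lemma commutator_relabel: "commutator (lie_bind (\<lambda>j. X (\<sigma> j)) t) = relabel \<sigma> (commutator t)"
  by (induction t) (simp_all add: relabel_word_mult free_vs.lin_diff)

lemma lie_bind_cong: "(\<And>j. j \<in> set (lie_leaves t) \<Longrightarrow> f j = g j) \<Longrightarrow> lie_bind f t = lie_bind g t"
  by (induction t) auto

lemma lie_subst_notin: "i \<notin> set (lie_leaves t) \<Longrightarrow> lie_subst i m s t = lie_bind (\<lambda>j. X (shift_letter i m j)) t"
  unfolding lie_subst_def by (rule lie_bind_cong) (auto simp: shift_letter_def)

lemma commutator_subst:
  "distinct (lie_leaves t) \<Longrightarrow> i \<in> set (lie_leaves t)
    \<Longrightarrow> (commutator (lie_subst i m s t) :: 'k::field ncpoly) = signed_subst 0 i m (commutator t) (commutator s)"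
proof (induction t)
  case (X j)
  then have "lie_subst i m s (X j) = lie_bind (\<lambda>j. X (j + i - 1)) s" by (simp add: lie_subst_def)
  then show ?case using X
    by (simp add: commutator_relabel signed_subst_def bilin_def word_subst_def)
next
  case (Br t1 t2)
  have bind: "lie_subst i m s (Br t1 t2) = Br (lie_subst i m s t1) (lie_subst i m s t2)"
    by (simp add: lie_subst_def)
  have len: "length w = length (lie_leaves t)"
    if "w \<in> supp (commutator t :: 'k ncpoly)" for w t
    using that by (metis keys_commutator size_mset)
  from Br.prems consider "i \<in> set (lie_leaves t1)" "i \<notin> set (lie_leaves t2)"
    | "i \<notin> set (lie_leaves t1)" "i \<in> set (lie_leaves t2)" by auto
  then show ?case
  proof cases
    case 1
    then have "(commutator (lie_subst i m s t1) :: 'k ncpoly) = signed_subst 0 i m (commutator t1) (commutator s)"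
      "(commutator (lie_subst i m s t2) :: 'k ncpoly) = relabel (shift_letter i m) (commutator t2)"
      using Br by (simp_all add: lie_subst_notin commutator_relabel)
    moreover have "signed_subst 0 i m (word_mult (commutator t1) (commutator t2)) (commutator s :: 'k ncpoly)
      = word_mult (signed_subst 0 i m (commutator t1) (commutator s)) (relabel (shift_letter i m) (commutator t2))"
      by (rule signed_subst_mult_left) (use 1 in \<open>auto simp: set_keys_commutator\<close>)
    moreover have "signed_subst 0 i m (word_mult (commutator t2) (commutator t1)) (commutator s :: 'k ncpoly)
      = sg (0 * int (length (lie_leaves t2))) (word_mult (relabel (shift_letter i m) (commutator t2)) (signed_subst 0 i m (commutator t1) (commutator s)))"
      by (rule signed_subst_mult_right) (use 1 in \<open>auto simp: set_keys_commutator len\<close>)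
    ultimately show ?thesis by (simp add: bind signed_subst_diff)
  next
    case 2
    then have "(commutator (lie_subst i m s t2) :: 'k ncpoly) = signed_subst 0 i m (commutator t2) (commutator s)"
      "(commutator (lie_subst i m s t1) :: 'k ncpoly) = relabel (shift_letter i m) (commutator t1)"
      using Br by (simp_all add: lie_subst_notin commutator_relabel)
    moreover have "signed_subst 0 i m (word_mult (commutator t2) (commutator t1)) (commutator s :: 'k ncpoly)
      = word_mult (signed_subst 0 i m (commutator t2) (commutator s)) (relabel (shift_letter i m) (commutator t1))"
      by (rule signed_subst_mult_left) (use 2 in \<open>auto simp: set_keys_commutator\<close>)
    moreover have "signed_subst 0 i m (word_mult (commutator t1) (commutator t2)) (commutator s :: 'k ncpoly)
      = sg (0 * int (length (lie_leaves t1))) (word_mult (relabel (shift_letter i m) (commutator t1)) (signed_subst 0 i m (commutator t2) (commutator s)))"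
      by (rule signed_subst_mult_right) (use 2 in \<open>auto simp: set_keys_commutator len\<close>)
    ultimately show ?thesis by (simp add: bind signed_subst_diff)
  qed
qed

lemma lie_leaves_bind: "lie_leaves (lie_bind f t) = concat (map (\<lambda>l. lie_leaves (f l)) (lie_leaves t))"
  by (induction t) auto

lemma lie_leaves_relabel: "lie_leaves (lie_bind (\<lambda>j. X (\<sigma> j)) t) = map \<sigma> (lie_leaves t)"
  by (induction t) auto

lemma lie_leaves_subst: "lie_leaves (lie_subst i m s t) = word_subst i m (lie_leaves s) (lie_leaves t)"
  unfolding lie_subst_def lie_leaves_bind word_subst_def
  by (intro arg_cong[of _ _ concat] map_cong) (auto simp: lie_leaves_relabel)

lemma lie_mons_iff: "t \<in> lie_mons n \<longleftrightarrow> lie_leaves t \<in> as_words n"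
proof -
  have "lie_leaves t \<noteq> []" by (induction t) auto
  then show ?thesis by (auto simp: lie_mons_def as_words_def)
qed

text \<open>The component of arity \<open>n\<close> in all degrees at once: it contains the zero spaces, and the operations
  of \<open>Lie\<close> are given by the same formula in every degree. So the recursion \<open>planar\<close> can be followed
  inside \<open>lie_comp\<close> without tracking degrees.\<close>

definition lie_comp :: "nat \<Rightarrow> (lie_mon, 'k::field) pres set" where
  "lie_comp n = abs_pres ` {x. supp x \<subseteq> lie_mons n}"

definition lie_word :: "(lie_mon, 'k::field) pres \<Rightarrow> 'k ncpoly" where
  "lie_word = pres_lin commutator"

lemmas lie_word_linear = pres_lin_linear[OF kills_relators_commutator, folded lie_word_def]
lemmas lie_word_abs = pres_lin_abs[OF kills_relators_commutator, folded lie_word_def]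

lemma abs_pres_sg: "abs_pres (sg e x) = sg e (abs_pres x)"
  by (simp add: sg_def uminus_pres.abs_eq)

lemma lie_word_sg: "lie_word (sg e x) = sg e (lie_word x)"
  by (simp add: sg_def lie_word_linear)

lemma lie_comp_sg: "x \<in> lie_comp n \<Longrightarrow> sg e x \<in> lie_comp n"
  unfolding lie_comp_def by (auto simp flip: abs_pres_sg)

lemma lie_comp_linear:
  "0 \<in> lie_comp n"
  "x \<in> lie_comp n \<Longrightarrow> y \<in> lie_comp n \<Longrightarrow> x + y \<in> lie_comp n"
  "x \<in> lie_comp n \<Longrightarrow> qscale c x \<in> lie_comp n"
proof -
  show "0 \<in> lie_comp n" by (auto simp: lie_comp_def simp flip: abs_pres_0 intro!: imageI)
  show "x \<in> lie_comp n \<Longrightarrow> y \<in> lie_comp n \<Longrightarrow> x + y \<in> lie_comp n"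
    using Poly_Mapping.keys_add by (fastforce simp: lie_comp_def simp flip: abs_pres_add)
  show "x \<in> lie_comp n \<Longrightarrow> qscale c x \<in> lie_comp n"
    using free_vs.keys_pscale_subset by (fastforce simp: lie_comp_def simp flip: abs_pres_pscale)
qed

lemma lin_lie_comp:
  assumes "\<And>b. b \<in> supp z \<Longrightarrow> f b \<in> lie_comp n"
  shows "lin qscale f z \<in> lie_comp n"
proof -
  have "finite S \<Longrightarrow> S \<subseteq> supp z \<Longrightarrow> (\<Sum>b\<in>S. qscale (c b) (f b)) \<in> lie_comp n" for S c
    by (induction S rule: finite_induct) (auto intro!: lie_comp_linear assms)
  then show ?thesis unfolding lin_def by simp
qed

lemma Lie_to_As_eq: "x \<in> lie_comp n \<Longrightarrow> Lie_to_As n d x = lie_word x"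
  unfolding Lie_to_As_def lie_word_def lie_comp_def by (rule lin_hrep[OF kills_relators_commutator])

abbreviation LLie :: "('k::field, (lie_mon, 'k) pres) dgop" where "LLie \<equiv> Lam Lie"

lemma LLie_simps:
  "scl LLie = qscale"
  "ins LLie n d m e i x y = sg ((d - (1 - int n)) * (1 - int m) + (int i - 1) * (1 - int m))
    (abs_pres (bilin (\<lambda>t s. single (lie_subst i m s t) 1)
              (hrep (lie_mons n) x) (hrep (lie_mons m) y)))"
  "act LLie n d \<sigma> x = sg (perm_parity \<sigma>) (abs_pres (lin pscale (\<lambda>t. single (lie_bind (\<lambda>j. X (\<sigma> j)) t) 1)
              (hrep (lie_mons n) x)))"
  "unt LLie = abs_pres (single (X 1) 1)"
  by (auto simp: Lam_def Lie_def Let_def perm_parity_def sg_def)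

lemma lie_word_ins:
  assumes "x \<in> lie_comp n" "y \<in> lie_comp m" "i \<in> {1..n}"
  shows "ins LLie n d m e i x y \<in> lie_comp (n + m - 1)"
    and "lie_word (ins LLie n d m e i x y) = ins LAs n d m e i (lie_word x) (lie_word y)"
proof -
  define x' y' where "x' = hrep (lie_mons n) x" and "y' = hrep (lie_mons m) y"
  have k: "supp x' \<subseteq> lie_mons n" "supp y' \<subseteq> lie_mons m"
    and xy: "abs_pres x' = x" "abs_pres y' = y"
    using hrep assms(1,2) unfolding lie_comp_def x'_def y'_def by blast+
  have "lie_subst i m s t \<in> lie_mons (n + m - 1)" if "t \<in> lie_mons n" "s \<in> lie_mons m" for s t
    using that assms(3) unfolding lie_mons_iff lie_leaves_subst by (intro word_subst_as_words)
  then have "supp (bilin (\<lambda>t s. single (lie_subst i m s t) (1::'a)) x' y')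
      \<subseteq> lie_mons (n + m - 1)"
    by (intro keys_bilin_subset[OF k]) auto
  then show "ins LLie n d m e i x y \<in> lie_comp (n + m - 1)"
    unfolding LLie_simps x'_def[symmetric] y'_def[symmetric]
    by (intro lie_comp_sg) (auto simp: lie_comp_def)
  have "lie_word (abs_pres (bilin (\<lambda>t s. single (lie_subst i m s t) (1::'a)) x' y'))
    = bilin (\<lambda>t s. commutator (lie_subst i m s t)) x' y'"
    by (simp add: lie_word_abs lin_bilin)
  also have "\<dots> = bilin (\<lambda>t s. signed_subst 0 i m (commutator t) (commutator s)) x' y'"
    using k assms(3) by (intro bilin_cong commutator_subst) (auto simp: lie_mons_def)
  also have "\<dots> = signed_subst 0 i m (lin pscale commutator x') (lin pscale commutator y')"
    unfolding signed_subst_def bilin_left by (simp add: bilin_right bilin_def[of _ x' y'])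
  also have "\<dots> = signed_subst 0 i m (lie_word x) (lie_word y)"
    by (simp add: lie_word_abs flip: xy)
  finally show "lie_word (ins LLie n d m e i x y) = ins LAs n d m e i (lie_word x) (lie_word y)"
    by (simp add: LLie_simps LAs_simps lie_word_sg signed_subst_0 flip: x'_def y'_def)
qed

lemma lie_word_act:
  assumes "x \<in> lie_comp n" "\<sigma> permutes {1..n}"
  shows "act LLie n d \<sigma> x \<in> lie_comp n"
    and "lie_word (act LLie n d \<sigma> x) = act LAs n d \<sigma> (lie_word x)"
proof -
  define x' where "x' = hrep (lie_mons n) x"
  have k: "supp x' \<subseteq> lie_mons n" and x: "abs_pres x' = x"
    using hrep assms(1) unfolding lie_comp_def x'_def by blast+
  have "lie_bind (\<lambda>j. X (\<sigma> j)) t \<in> lie_mons n" if "t \<in> lie_mons n" for t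
    using that assms(2) unfolding lie_mons_iff lie_leaves_relabel by (intro map_as_words)
  then have "supp (lin pscale (\<lambda>t. single (lie_bind (\<lambda>j. X (\<sigma> j)) t) (1::'a)) x')
      \<subseteq> lie_mons n"
    by (intro keys_lin_subset[OF k]) auto
  then show "act LLie n d \<sigma> x \<in> lie_comp n"
    unfolding LLie_simps x'_def[symmetric] by (intro lie_comp_sg) (auto simp: lie_comp_def)
  show "lie_word (act LLie n d \<sigma> x) = act LAs n d \<sigma> (lie_word x)"
    unfolding LLie_simps x'_def[symmetric]
    by (simp add: LAs_simps lie_word_sg lie_word_abs free_vs.lin_lin commutator_relabel flip: x)
qed

lemma lie_word_unt: "unt LLie \<in> lie_comp 1" "lie_word (unt LLie) = unt LAs"
  by (auto simp: LLie_simps LAs_simps lie_word_abs lie_comp_def lie_mons_def)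

definition as_bracket :: "'k::field ncpoly" where
  "as_bracket = single [1, 2] 1 - single [2, 1] 1"

lemma lie_word_bracket: "lie_bracket \<in> lie_comp 2" "lie_word lie_bracket = as_bracket"
proof -
  have "{1..2} = {1, 2 :: nat}" by auto
  then show "lie_bracket \<in> lie_comp 2"
    by (auto simp: lie_bracket_def lie_comp_def lie_mons_def intro!: imageI)
  show "lie_word lie_bracket = as_bracket"
    by (simp add: lie_bracket_def lie_word_abs word_mult_single as_bracket_def)
qed

section \<open>Values of trees\<close>

lemma graft_related:
  assumes ins: "\<And>n d m e i u u' w w'. R n u u' \<Longrightarrow> R m w w' \<Longrightarrow> i \<in> {1..n}
      \<Longrightarrow> R (n + m - 1) (ins P n d m e i u w) (ins Q n d m e i u' w')"
    and "R n u u'" "1 \<le> i" "i + length ts \<le> n + 1" "\<And>t. t \<in> set ts \<Longrightarrow> R (len t) (w t) (w' t)"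
  shows "R (n + sum_list (map len ts) - length ts)
    (graft P u n d i (map (\<lambda>t. (len t, e t, w t)) ts)) (graft Q u' n d i (map (\<lambda>t. (len t, e t, w' t)) ts))"
  using assms(2-)
proof (induction ts arbitrary: u u' n d i)
  case (Cons t ts)
  have "R (n + len t - 1) (ins P n d (len t) (e t) i u (w t)) (ins Q n d (len t) (e t) i u' (w' t))"
    using Cons.prems by (intro ins) auto
  then have "R (n + len t - 1 + sum_list (map len ts) - length ts)
    (graft P (ins P n d (len t) (e t) i u (w t)) (n + len t - 1) (d + e t) (i + len t) (map (\<lambda>t. (len t, e t, w t)) ts))
    (graft Q (ins Q n d (len t) (e t) i u' (w' t)) (n + len t - 1) (d + e t) (i + len t) (map (\<lambda>t. (len t, e t, w' t)) ts))"
    using Cons.prems by (intro Cons.IH) auto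
  moreover have "n + len t - 1 + sum_list (map len ts) - length ts = n + sum_list (map len (t # ts)) - length (t # ts)"
    using Cons.prems by simp
  ultimately show ?case by simp
qed simp

text \<open>A relation between two operads that is compatible with units, insertions and the values of the
  generators holds between the values of every tree. It is applied to a map of operads, or to its graph
  together with membership in a component.\<close>

lemma planar_related:
  assumes ins: "\<And>n d m e i u u' w w'. R n u u' \<Longrightarrow> R m w w' \<Longrightarrow> i \<in> {1..n}
      \<Longrightarrow> R (n + m - 1) (ins P n d m e i u w) (ins Q n d m e i u' w')"
    and unt: "R 1 (unt P) (unt Q)" and gen: "\<And>n. 2 \<le> n \<Longrightarrow> R n (g n) (g' n)"
    and "stable t"
  shows "R (length (leaves t)) (planar P g t) (planar Q g' t)"
  using \<open>stable t\<close>
proof (induction t)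
  case (Nd ts)
  have "R (length ts + sum_list (map (\<lambda>t. length (leaves t)) ts) - length ts) (planar P g (Nd ts)) (planar Q g' (Nd ts))"
    unfolding planar.simps
  proof (rule graft_related[where R = R and len = "\<lambda>t. length (leaves t)" and e = tdeg
        and w = "planar P g" and w' = "planar Q g'"])
    show "R (n + m - 1) (ins P n d m e i u w) (ins Q n d m e i u' w')"
      if "R n u u'" "R m w w'" "i \<in> {1..n}" for n d m e i u u' w w'
      using that by (rule ins)
    show "R (length ts) (g (length ts)) (g' (length ts))" using Nd.prems by (intro gen) simp
    show "R (length (leaves t)) (planar P g t) (planar Q g' t)" if "t \<in> set ts" for t
      using Nd that by auto
  qed auto
  then show ?case by (simp add: length_concat o_def)
qed (use unt in simp)

lemma ltrees_leaves: "t \<in> ltrees n d \<longleftrightarrow> stable t \<and> leaves t \<in> as_words n \<and> tdeg t = d"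
proof -
  have "stable t \<Longrightarrow> leaves t \<noteq> []"
  proof (induction t)
    case (Nd ts) then show ?case by (cases ts) auto
  qed simp
  then show ?thesis by (auto simp: ltrees_def as_words_def)
qed

definition as_gen :: "nat \<Rightarrow> 'k::field ncpoly" where
  "as_gen n = (if n = 2 then as_bracket else 0)"

lemma LLinf_carr: "carr LLinf n d = abs_pres ` {x. supp x \<subseteq> ltrees n d}"
  by (simp add: LLinf_def)

text \<open>Both sides evaluate the trees of one and the same representative of \<open>x\<close>, so that it is enough to
  compare the values of single trees.\<close>

lemma LLinf_to_LAs_free_map:
  assumes "x \<in> carr LLinf n d"
  shows "LLinf_to_LAs n d x = free_map LAs as_gen n d x"
proof -
  let ?g = "\<lambda>n. if n = 2 then lie_bracket else 0 :: (lie_mon, 'a) pres"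
  have k: "supp (hrep (ltrees n d) x) \<subseteq> ltrees n d"
    using hrep(1)[of x "ltrees n d"] assms by (simp add: LLinf_carr)
  have *: "planar LLie ?g t \<in> lie_comp (length (leaves t)) \<and> lie_word (planar LLie ?g t) = planar LAs as_gen t"
    if "stable t" for t
    by (rule planar_related[where R = "\<lambda>n x y. x \<in> lie_comp n \<and> lie_word x = y", OF _ _ _ that])
      (auto simp: lie_word_ins lie_word_unt lie_word_bracket as_gen_def lie_comp_linear lie_word_linear simp del: One_nat_def)
  have **: "act LLie n d (list_perm (leaves t)) (planar LLie ?g t) \<in> lie_comp n \<and>
      lie_word (act LLie n d (list_perm (leaves t)) (planar LLie ?g t)) = act LAs n d (list_perm (leaves t)) (planar LAs as_gen t)"
    if "t \<in> supp (hrep (ltrees n d) x)" for t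
  proof -
    have t: "stable t" "leaves t \<in> as_words n" using k that by (auto simp: ltrees_leaves)
    then have "list_perm (leaves t) permutes {1..n}" by (intro list_perm_permutes) (auto simp: as_words_iff)
    then show ?thesis using *[OF t(1)] lie_word_act length_as_words[OF t(2)] by metis
  qed
  have "free_map LLie ?g n d x \<in> lie_comp n"
    unfolding free_map_def LLie_simps(1) using ** by (intro lin_lie_comp) blast
  then have "LLinf_to_LAs n d x = lie_word (free_map LLie ?g n d x)"
    by (simp add: LLinf_to_LAs_def gcomp_def Lam_map_def LLinf_to_LLie_def Lie_to_As_eq)
  also have "\<dots> = free_map LAs as_gen n d x"
    unfolding free_map_def LLie_simps(1) LAs_simps(2) lie_word_linear
    using ** by (intro free_vs.lin_cong) blast
  finally show ?thesis .
qed

text \<open>The value of a tree in the basis of signed words, with arbitrary labels. The bracket is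
  $e_{12}+e_{21}$. The sign of the first product comes from moving the value of \<open>t\<close> past the letters of \<open>s\<close>,
  that of the second from moving the value of \<open>s\<close> past the other input.\<close>

fun tree_val :: "ltree \<Rightarrow> 'k::field ncpoly" where
  "tree_val (Lf j) = single [j] 1"
| "tree_val (Nd [s, t]) =
     sg (int (length (leaves s)) * (int (length (leaves t)) - 1)) (word_mult (tree_val s) (tree_val t))
     + sg (int (length (leaves s)) - 1) (word_mult (tree_val t) (tree_val s))"
| "tree_val (Nd ts) = 0"

lemma tree_val_nonbinary: "length ts \<noteq> 2 \<Longrightarrow> tree_val (Nd ts) = 0"
  by (cases ts rule: remdups_adj.cases; cases "tl (tl ts)") auto

lemma keys_add_mem: "w \<in> supp (x + y) \<Longrightarrow> w \<in> supp x \<or> w \<in> supp y"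
  using Poly_Mapping.keys_add[of x y] by (auto dest!: subsetD)

lemma keys_tree_val: "w \<in> supp (tree_val t :: 'k::field ncpoly) \<Longrightarrow> mset w = mset (leaves t)"
  by (induction t arbitrary: w rule: tree_val.induct)
    (auto dest!: keys_add_mem elim!: keys_word_mult)

lemma set_keys_tree_val: "w \<in> supp (tree_val t) \<Longrightarrow> set w = set (leaves t)"
  by (metis keys_tree_val set_mset_mset)

lemma length_keys_tree_val: "w \<in> supp (tree_val t) \<Longrightarrow> length w = length (leaves t)"
  by (metis keys_tree_val size_mset)

lemma tdeg_tree_val: "(tree_val t :: 'k::field ncpoly) \<noteq> 0 \<Longrightarrow> tdeg t = 1 - int (length (leaves t))"
proof (induction t rule: tree_val.induct)
  case (2 s t)
  then have "(tree_val s :: 'k ncpoly) \<noteq> 0" "(tree_val t :: 'k ncpoly) \<noteq> 0"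
    by (auto simp: word_mult_left word_mult_right)
  then show ?case using 2 by simp
qed auto

lemma leaves_tbind: "leaves (tbind f t) = concat (map (\<lambda>l. leaves (f l)) (leaves t))"
proof (induction t)
  case (Nd ts)
  then show ?case by (induction ts) auto
qed simp

lemma leaves_relabel: "leaves (tbind (\<lambda>j. Lf (f j)) t) = map f (leaves t)"
  by (simp add: leaves_tbind)

lemma leaves_tree_subst: "leaves (tree_subst i m s t) = word_subst i m (leaves s) (leaves t)"
  unfolding tree_subst_def leaves_tbind word_subst_def
  by (intro arg_cong[of _ _ concat] map_cong) (auto simp: leaves_relabel)

lemma tbind_cong: "(\<And>j. j \<in> set (leaves t) \<Longrightarrow> f j = g j) \<Longrightarrow> tbind f t = tbind g t"
  by (induction t) auto

lemma tree_subst_notin: "i \<notin> set (leaves t) \<Longrightarrow> tree_subst i m s t = tbind (\<lambda>j. Lf (shift_letter i m j)) t"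
  unfolding tree_subst_def by (rule tbind_cong) (auto simp: shift_letter_def)

lemma tree_val_relabel: "tree_val (tbind (\<lambda>j. Lf (\<sigma> j)) t) = relabel \<sigma> (tree_val t)"
  by (induction t rule: tree_val.induct)
    (simp_all add: leaves_relabel relabel_word_mult free_vs.lin_add free_vs.lin_sg)

lemma length_word_subst:
  assumes "distinct w" "i \<in> set w" shows "int (length (word_subst i m u w)) = int (length w) + int (length u) - 1"
proof -
  obtain us vs where "w = us @ i # vs" using assms by (meson split_list)
  then show ?thesis using word_subst_split[of i us vs m u] assms by auto
qed

lemma signed_subst_linear:
  "signed_subst e i m (x + y) z = signed_subst e i m x z + signed_subst e i m y z"
  "signed_subst e i m (sg k x) z = sg k (signed_subst e i m x z)"
  "signed_subst e i m 0 z = 0" "signed_subst e i m x 0 = 0"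
  by (simp_all add: signed_subst_def bilin_left bilin_right)

lemma signed_subst_letter: "signed_subst e i m (single [i] 1) y = relabel (\<lambda>j. j + i - 1) y"
  by (simp add: signed_subst_def bilin_def word_subst_def position_def)

lemma tree_subst_Nd: "tree_subst i m s (Nd ts) = Nd (map (tree_subst i m s) ts)"
  by (simp add: tree_subst_def)

text \<open>Grafting \<open>s\<close> on the leaf \<open>i\<close> moves the \<open>m - 1\<close> products of \<open>s\<close> past those of \<open>t\<close>: on the side of trees
  past the vertices that come after the leaf, which are counted by \<open>deg_after\<close>, and on the side of words
  past the letters to the left of \<open>i\<close>. The induction goes through at a binary vertex because its own sign
  changes with the number of leaves below it.\<close>

lemma tree_val_subst:
  "distinct (leaves t) \<Longrightarrow> i \<in> set (leaves t) \<Longrightarrow> length (leaves s) = m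
    \<Longrightarrow> (tree_val (tree_subst i m s t) :: 'k::field ncpoly)
      = sg ((int m - 1) * deg_after i t) (signed_subst (int m - 1) i m (tree_val t) (tree_val s))"
proof (induction t rule: tree_val.induct)
  case (1 j)
  then have "tree_subst i m s (Lf j) = tbind (\<lambda>j. Lf (j + i - 1)) s" by (simp add: tree_subst_def)
  then show ?case using 1 by (simp add: tree_val_relabel signed_subst_letter)
next
  case (2 t1 t2)
  let ?v = "tree_val :: ltree \<Rightarrow> 'k ncpoly" and ?l = "\<lambda>t. int (length (leaves t))"
    and ?W = "\<lambda>x. signed_subst (int m - 1) i m x (tree_val s :: 'k ncpoly)"
  show ?case
  proof (cases "?v t1 = 0 \<or> ?v t2 = 0")
    case True
    then have "?v (tree_subst i m s t1) = 0 \<or> ?v (tree_subst i m s t2) = 0"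
      using 2 by (cases "i \<in> set (leaves t1)"; cases "i \<in> set (leaves t2)")
        (auto simp: signed_subst_linear tree_subst_notin tree_val_relabel)
    with True show ?thesis by (auto simp: tree_subst_Nd word_mult_left word_mult_right signed_subst_linear)
  next
    case False
    \<comment> \<open>Nonzero values come from binary trees only, whose degree is determined by the number of leaves.\<close>
    then have d: "tdeg t1 = 1 - ?l t1" "tdeg t2 = 1 - ?l t2" using tdeg_tree_val by blast+
    from 2 consider "i \<in> set (leaves t1)" "i \<notin> set (leaves t2)"
      | "i \<notin> set (leaves t1)" "i \<in> set (leaves t2)" by auto
    then show ?thesis
    proof cases
      case 1
      then have IH: "?v (tree_subst i m s t1) = sg ((int m - 1) * deg_after i t1) (?W (?v t1))"
        "?v (tree_subst i m s t2) = relabel (shift_letter i m) (?v t2)"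
        and len: "?l (tree_subst i m s t1) = ?l t1 + int m - 1" "?l (tree_subst i m s t2) = ?l t2"
        using 2 by (auto simp: tree_subst_notin tree_val_relabel leaves_relabel leaves_tree_subst
            length_word_subst)
      have L: "?W (word_mult (?v t1) (?v t2)) = word_mult (?W (?v t1)) (relabel (shift_letter i m) (?v t2))"
        by (rule signed_subst_mult_left) (use 1 in \<open>auto simp: set_keys_tree_val\<close>)
      have R: "?W (word_mult (?v t2) (?v t1)) = sg ((int m - 1) * ?l t2) (word_mult (relabel (shift_letter i m) (?v t2)) (?W (?v t1)))"
        by (rule signed_subst_mult_right) (use 1 in \<open>auto simp: set_keys_tree_val length_keys_tree_val\<close>)
      have D: "deg_after i (Nd [t1, t2]) = deg_after i t1 + (1 - ?l t2)" using 1 d by simp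
      show ?thesis
        unfolding tree_subst_Nd list.map tree_val.simps IH len L R D signed_subst_linear word_mult_left(6)
          word_mult_right(6) sg_add sg_sg
        by (intro arg_cong2[of _ _ _ _ "(+)"] sg_cong) (auto simp: even_mult_iff)
    next
      case 2
      then have IH: "?v (tree_subst i m s t2) = sg ((int m - 1) * deg_after i t2) (?W (?v t2))"
        "?v (tree_subst i m s t1) = relabel (shift_letter i m) (?v t1)"
        and len: "?l (tree_subst i m s t2) = ?l t2 + int m - 1" "?l (tree_subst i m s t1) = ?l t1"
        using "2.IH" "2.prems" by (auto simp: tree_subst_notin tree_val_relabel leaves_relabel leaves_tree_subst
            length_word_subst)
      have L: "?W (word_mult (?v t2) (?v t1)) = word_mult (?W (?v t2)) (relabel (shift_letter i m) (?v t1))"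
        by (rule signed_subst_mult_left) (use 2 in \<open>auto simp: set_keys_tree_val\<close>)
      have R: "?W (word_mult (?v t1) (?v t2)) = sg ((int m - 1) * ?l t1) (word_mult (relabel (shift_letter i m) (?v t1)) (?W (?v t2)))"
        by (rule signed_subst_mult_right) (use 2 in \<open>auto simp: set_keys_tree_val length_keys_tree_val\<close>)
      have D: "deg_after i (Nd [t1, t2]) = deg_after i t2" using 2 by simp
      show ?thesis
        unfolding tree_subst_Nd list.map tree_val.simps IH len L R D signed_subst_linear word_mult_left(6)
          word_mult_right(6) sg_add sg_sg
        by (intro arg_cong2[of _ _ _ _ "(+)"] sg_cong) (auto simp: even_mult_iff)
    qed
  qed
qed (simp_all add: tree_subst_Nd signed_subst_linear)

text \<open>The element $e_{12}+e_{21}$ is symmetric, so that an exchange of children costs the Koszul sign; the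
  degrees are those of \<open>tdeg\<close> as soon as the values do not vanish (\<open>tdeg_tree_val\<close>).\<close>

lemma exchange_tree_val:
  "exchange s t e \<Longrightarrow> (tree_val s :: 'k::field ncpoly) = sg e (tree_val t)
    \<and> length (leaves s) = length (leaves t)"
proof (induction rule: exchange.induct)
  case (here us s t vs)
  show ?case
  proof (cases "us = [] \<and> vs = []")
    case True
    show ?thesis
    proof (cases "(tree_val s :: 'k ncpoly) = 0 \<or> (tree_val t :: 'k ncpoly) = 0")
      case True
      then show ?thesis using \<open>us = [] \<and> vs = []\<close> by (auto simp: word_mult_left word_mult_right)
    next
      case False
      then have d: "tdeg s = 1 - int (length (leaves s))" "tdeg t = 1 - int (length (leaves t))"
        using tdeg_tree_val by blast+
      have "(tree_val (Nd [s, t]) :: 'k ncpoly) = sg (tdeg s * tdeg t) (tree_val (Nd [t, s]))"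
        unfolding d tree_val.simps sg_add sg_sg add.commute[of "sg (_ * _) (word_mult (tree_val s) _)"]
        by (intro arg_cong2[of _ _ _ _ "(+)"] sg_cong) (auto simp: even_mult_iff)
      then show ?thesis using \<open>us = [] \<and> vs = []\<close> by simp
    qed
  next
    case False
    then have l: "length (us @ s # t # vs) \<noteq> 2" "length (us @ t # s # vs) \<noteq> 2" by auto
    show ?thesis
      unfolding tree_val_nonbinary[OF l(1)] tree_val_nonbinary[OF l(2)] by simp
  qed
next
  case (inside s t e us vs)
  show ?case
  proof (cases "length (us @ s # vs) = 2")
    case True
    then consider x where "us = []" "vs = [x]" | x where "us = [x]" "vs = []"
      by (cases us; cases vs) auto
    then show ?thesis
      using inside by cases (simp_all add: word_mult_left word_mult_right sg_add sg_sg add.commute)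
  next
    case False
    then have l: "length (us @ s # vs) \<noteq> 2" "length (us @ t # vs) \<noteq> 2" by auto
    show ?thesis
      unfolding tree_val_nonbinary[OF l(1)] tree_val_nonbinary[OF l(2)] using inside by simp
  qed
qed

lemma kills_relators_tree_val: "kills_relators (tree_val :: ltree \<Rightarrow> 'k::field ncpoly)"
  unfolding kills_relators_def relators_ltree_def
proof safe
  fix s t e assume "exchange s t e"
  moreover have "Poly_Mapping.map of_int (sg e (single t 1))
    = sg e (single t (1 :: 'k))"
    by (rule poly_mapping_eqI) (simp add: lookup_map_of_int lookup_sg lookup_single sg_def when_def)
  ultimately show "lin pscale tree_val (Poly_Mapping.map of_int
      (single s 1 - sg e (single t 1))) = (0 :: 'k ncpoly)"
    using exchange_tree_val[of s t e, where 'k = 'k]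
    by (simp add: map_of_int_diff map_of_int_single free_vs.lin_diff free_vs.lin_sg)
qed

section \<open>The Jacobi identity for signed words\<close>

text \<open>Each of the six products of \<open>x\<close>, \<open>y\<close>, \<open>z\<close> in some order occurs twice, with opposite signs.\<close>

lemma jacobi_signed_words:
  fixes x y z :: "'k::field ncpoly" and a b c :: int
  defines "br \<equiv> \<lambda>l u m v. sg (l * (m - 1)) (word_mult u v) + sg (l - 1) (word_mult v u)"
  shows "br (a + b) (br a x b y) c z + sg ((1 - c) * (1 - b)) (br (a + c) (br a x c z) b y)
    + sg ((1 - b) * (1 - a) + (1 - c) * (1 - a)) (br (b + c) (br b y c z) a x) = 0"
  unfolding br_def
  by (cases "even a"; cases "even b"; cases "even c")
    (simp_all add: sg_def word_mult_left word_mult_right word_mult_assoc)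

lemma Sh_2_1: "Sh 2 1 = {list_perm [1, 2, 3], list_perm [1, 3, 2], list_perm [2, 3, 1]}"
proof (intro equalityI subsetI)
  have 123: "{1..2 + 1} = {1, 2, 3 :: nat}" by auto
  fix \<sigma> assume "\<sigma> \<in> Sh 2 1"
  then have p: "\<sigma> permutes {1, 2, 3}" and "strict_mono_on {1..2} \<sigma>"
    unfolding Sh_def mem_Collect_eq 123 by blast+
  then have lt: "\<sigma> 1 < \<sigma> 2" by (auto simp: strict_mono_on_def)
  have "\<sigma> 1 \<in> {1, 2, 3}" "\<sigma> 2 \<in> {1, 2, 3}" "\<sigma> 3 \<in> {1, 2, 3}"
    using permutes_in_image[OF p] by blast+
  moreover have "\<sigma> 3 \<noteq> \<sigma> 1" "\<sigma> 3 \<noteq> \<sigma> 2" by (simp_all add: inj_eq[OF permutes_inj[OF p]])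
  ultimately have "[\<sigma> 1, \<sigma> 2, \<sigma> 3] \<in> {[1, 2, 3], [1, 3, 2], [2, 3, 1]}" using lt by auto
  moreover have "\<sigma> = list_perm [\<sigma> 1, \<sigma> 2, \<sigma> 3]"
  proof
    fix j :: nat
    consider "j = 1" | "j = 2" | "j = 3" | "j \<notin> {1, 2, 3}" by blast
    then show "\<sigma> j = list_perm [\<sigma> 1, \<sigma> 2, \<sigma> 3] j"
    proof cases
      case 4
      then have "\<sigma> j = j" using p by (auto simp: permutes_def)
      then show ?thesis using 4 by (auto simp: list_perm_def)
    qed (auto simp: list_perm_def)
  qed
  ultimately show "\<sigma> \<in> {list_perm [1, 2, 3], list_perm [1, 3, 2], list_perm [2, 3, 1]}" by auto
next
  have *: "{1..2 + 1} = {1, 2, 3 :: nat}" "{1..2} = {1, 2 :: nat}" "{2 + 1..2 + 1} = {3 :: nat}" by auto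
  fix \<sigma> assume "\<sigma> \<in> {list_perm [1, 2, 3], list_perm [1, 3, 2], list_perm [2, 3, 1]}"
  then consider "\<sigma> = list_perm [1, 2, 3]" | "\<sigma> = list_perm [1, 3, 2]" | "\<sigma> = list_perm [2, 3, 1]" by blast
  then show "\<sigma> \<in> Sh 2 1"
  proof cases
    case 1
    have "\<sigma> permutes {1..2 + 1}" unfolding 1 by (rule list_perm_permutes) auto
    then show ?thesis unfolding Sh_def mem_Collect_eq *
      by (auto simp: 1 strict_mono_on_def list_perm_def)
  next
    case 2
    have "\<sigma> permutes {1..2 + 1}" unfolding 2 by (rule list_perm_permutes) auto
    then show ?thesis unfolding Sh_def mem_Collect_eq *
      by (auto simp: 2 strict_mono_on_def list_perm_def)
  next
    case 3
    have "\<sigma> permutes {1..2 + 1}" unfolding 3 by (rule list_perm_permutes) auto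
    then show ?thesis unfolding Sh_def mem_Collect_eq *
      by (auto simp: 3 strict_mono_on_def list_perm_def)
  qed
qed

lemma sum_Sh_2_1:
  "(\<Sum>\<sigma>\<in>Sh 2 1. f \<sigma>) = f (list_perm [1, 2, 3]) + f (list_perm [1, 3, 2]) + f (list_perm [2, 3, 1])"
proof -
  have "list_perm [1, 2, 3] 3 \<noteq> list_perm [1, 3, 2] 3" "list_perm [1, 2, 3] 3 \<noteq> list_perm [2, 3, 1] 3"
    "list_perm [1, 3, 2] 3 \<noteq> list_perm [2, 3, 1] 3" by (auto simp: list_perm_def)
  then have "list_perm [1, 2, 3] \<noteq> list_perm [1, 3, 2]" "list_perm [1, 2, 3] \<noteq> list_perm [2, 3, 1]"
    "list_perm [1, 3, 2] \<noteq> list_perm [2, 3, 1]" by metis+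
  then show ?thesis unfolding Sh_2_1 by (simp add: add.assoc)
qed

lemma koszul_Sh_2_1:
  "koszul (list_perm [1, 2, 3]) [x, y, z] = 0"
  "koszul (list_perm [1, 3, 2]) [x, y, z] = tdeg z * tdeg y"
  "koszul (list_perm [2, 3, 1]) [x, y, z] = tdeg y * tdeg x + tdeg z * tdeg x"
proof -
  have P: "1 \<le> a \<and> a < b \<and> b \<le> length [x, y, z] \<longleftrightarrow> (a, b) = (1, 2) \<or> (a, b) = (1, 3) \<or> (a, b) = (2, 3)"
    for a b :: nat by auto
  have "{(a, b). 1 \<le> a \<and> a < b \<and> b \<le> length [x, y, z] \<and> \<sigma> a > \<sigma> b}
    = {(a, b). ((a, b) = (1, 2) \<or> (a, b) = (1, 3) \<or> (a, b) = (2, 3)) \<and> \<sigma> a > \<sigma> b}" for \<sigma> :: "nat \<Rightarrow> nat"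
    unfolding P[symmetric] by auto
  then have K: "koszul \<sigma> [x, y, z] = (\<Sum>(a, b) \<in> {(a, b). ((a, b) = (1, 2) \<or> (a, b) = (1, 3) \<or> (a, b) = (2, 3)) \<and> \<sigma> a > \<sigma> b}.
     tdeg ([x, y, z] ! (\<sigma> a - 1)) * tdeg ([x, y, z] ! (\<sigma> b - 1)))" for \<sigma>
    unfolding koszul_def by simp
  have v: "list_perm [1, 2, 3] 1 = 1" "list_perm [1, 2, 3] 2 = 2" "list_perm [1, 2, 3] 3 = 3"
    "list_perm [1, 3, 2] 1 = 1" "list_perm [1, 3, 2] 2 = 3" "list_perm [1, 3, 2] 3 = 2"
    "list_perm [2, 3, 1] 1 = 2" "list_perm [2, 3, 1] 2 = 3" "list_perm [2, 3, 1] 3 = 1"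
    by (auto simp: list_perm_def)
  have s1: "{(a, b). ((a, b) = (1, 2) \<or> (a, b) = (1, 3) \<or> (a, b) = (2, 3)) \<and> list_perm [1, 2, 3] a > list_perm [1, 2, 3] b} = {}"
    using v by (auto simp del: One_nat_def)
  have s2: "{(a, b). ((a, b) = (1, 2) \<or> (a, b) = (1, 3) \<or> (a, b) = (2, 3)) \<and> list_perm [1, 3, 2] a > list_perm [1, 3, 2] b} = {(2, 3)}"
    using v by (auto simp del: One_nat_def)
  have s3: "{(a, b). ((a, b) = (1, 2) \<or> (a, b) = (1, 3) \<or> (a, b) = (2, 3)) \<and> list_perm [2, 3, 1] a > list_perm [2, 3, 1] b} = {(1, 3), (2, 3)}"
    using v by (auto simp del: One_nat_def)
  show "koszul (list_perm [1, 2, 3]) [x, y, z] = 0" unfolding K s1 by simp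
  show "koszul (list_perm [1, 3, 2]) [x, y, z] = tdeg z * tdeg y" unfolding K s2 by (simp add: v del: One_nat_def)
  show "koszul (list_perm [2, 3, 1]) [x, y, z] = tdeg y * tdeg x + tdeg z * tdeg x"
    unfolding K s3 by (simp add: v del: One_nat_def)
qed

lemma keys_sum_mem:
  assumes "w \<in> supp (\<Sum>a\<in>A. f a)" obtains a where "a \<in> A" "w \<in> supp (f a)"
proof -
  have "(\<Sum>a\<in>A. coeff (f a) w) \<noteq> 0" using assms by (simp add: in_keys_iff lookup_sum)
  then obtain a where "a \<in> A" "coeff (f a) w \<noteq> 0" by (meson sum.neutral)
  then show thesis using that by (simp add: in_keys_iff)
qed

lemma leaves_Nd_mset: "mset (leaves (Nd ts)) = (\<Sum>t\<in>#mset ts. mset (leaves t))"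
  by (simp add: mset_concat o_def flip: sum_mset_sum_list)

lemma tdeg_Nd_mset: "tdeg (Nd ts) = 3 - 2 * int (size (mset ts)) + (\<Sum>t\<in>#mset ts. tdeg t)"
  by (simp flip: sum_mset_sum_list)

lemma mset_map_permutes_nth:
  assumes "\<sigma> permutes {1..length ts}"
  shows "mset (map (\<lambda>j. ts ! (\<sigma> j - 1)) [1..<Suc (length ts)]) = mset ts"
proof -
  have "mset (map \<sigma> [1..<Suc (length ts)]) = mset [1..<Suc (length ts)]"
    using assms by (intro set_eq_iff_mset_eq_distinct[THEN iffD1])
      (auto simp: distinct_map permutes_inj_on permutes_image atLeastLessThanSuc_atLeastAtMost simp del: upt_Suc)
  then have "mset (map (\<lambda>j. ts ! (j - 1)) (map \<sigma> [1..<Suc (length ts)])) = mset (map (\<lambda>j. ts ! (j - 1)) [1..<Suc (length ts)])"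
    by (simp only: mset_map)
  moreover have "map (\<lambda>j. ts ! (j - 1)) [1..<Suc (length ts)] = ts"
    by (rule nth_equalityI) (auto simp del: upt_Suc)
  ultimately show ?thesis by (simp only: map_map o_def)
qed

lemma keys_uminus: "supp (- x) = supp x"
  by (auto simp: in_keys_iff)

lemma keys_tree_dif:
  "u \<in> supp (tree_dif t :: ltree \<Rightarrow>\<^sub>0 'k::field)
    \<Longrightarrow> mset (leaves u) = mset (leaves t) \<and> tdeg u = tdeg t + 1 \<and> (stable t \<longrightarrow> stable u)"
proof (induction t arbitrary: u)
  case (Nd ts)
  let ?k = "length ts"
  let ?A = "\<Sum>p\<in>{2..<length ts}. \<Sum>\<sigma>\<in>Sh p (length ts - p). sg (koszul \<sigma> ts)
         (single
           (Nd (Nd (map (\<lambda>j. ts ! (\<sigma> j - 1)) [1..<Suc p])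
                # map (\<lambda>j. ts ! (\<sigma> j - 1)) [Suc p..<Suc (length ts)])) (1 :: 'k))"
  let ?B = "\<Sum>j<length ts. sg (3 - 2 * int (length ts) + sum_list (map tdeg (take j ts)))
         (lin pscale (\<lambda>t. single (Nd (ts[j := t])) (1 :: 'k)) (map tree_dif ts ! j))"
  have "u \<in> supp (- ?A + ?B)" using Nd.prems unfolding tree_dif.simps .
  from keys_add_mem[OF this] have "u \<in> supp ?A \<or> u \<in> supp ?B"
    unfolding keys_uminus .
  then consider (a) "u \<in> supp ?A" | (b) "u \<in> supp ?B" by blast
  then show ?case
  proof cases
    case a
    then obtain p \<sigma> where p: "2 \<le> p" "p < ?k" and "\<sigma> \<in> Sh p (?k - p)"
      and u: "u = Nd (Nd (map (\<lambda>j. ts ! (\<sigma> j - 1)) [1..<Suc p])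
                # map (\<lambda>j. ts ! (\<sigma> j - 1)) [Suc p..<Suc ?k])"
      by (auto elim!: keys_sum_mem simp del: upt_Suc)
    then have \<sigma>: "\<sigma> permutes {1..?k}" by (simp add: Sh_def)
    let ?xs = "map (\<lambda>j. ts ! (\<sigma> j - 1)) [1..<Suc p]" and ?ys = "map (\<lambda>j. ts ! (\<sigma> j - 1)) [Suc p..<Suc ?k]"
    have "map (\<lambda>j. ts ! (\<sigma> j - 1)) [1..<Suc ?k] = ?xs @ ?ys"
      using p upt_split[of 1 "Suc p" "Suc ?k"] by (simp del: upt_Suc)
    then have m: "mset (?xs @ ?ys) = mset ts" using mset_map_permutes_nth[OF \<sigma>] by simp
    then have s: "set (?xs @ ?ys) = set ts" by (metis set_mset_mset)
    have len: "length ?xs = p" "length ?ys = ?k - p" by (simp_all del: upt_Suc)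
    have "mset (leaves u) = mset (leaves (Nd (?xs @ ?ys)))" unfolding u by (simp del: upt_Suc)
    then have 1: "mset (leaves u) = mset (leaves (Nd ts))" unfolding leaves_Nd_mset m .
    have "tdeg u = tdeg (Nd (?xs @ ?ys)) + 1" unfolding u using len p by (simp del: upt_Suc)
    then have 2: "tdeg u = tdeg (Nd ts) + 1" unfolding tdeg_Nd_mset m .
    have "stable (Nd ts) \<longrightarrow> stable u" unfolding u using s len p by (auto simp del: upt_Suc)
    with 1 2 show ?thesis by blast
  next
    case b
    then obtain j where j: "j < ?k" and "u \<in> supp (lin pscale (\<lambda>t. single (Nd (ts[j := t])) (1 :: 'k)) (tree_dif (ts ! j)))"
      by (auto elim!: keys_sum_mem)
    then obtain t' where t': "t' \<in> supp (tree_dif (ts ! j) :: ltree \<Rightarrow>\<^sub>0 'k)" and u: "u = Nd (ts[j := t'])"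
      using keys_lin by fastforce
    have IH: "mset (leaves t') = mset (leaves (ts ! j)) \<and> tdeg t' = tdeg (ts ! j) + 1 \<and> (stable (ts ! j) \<longrightarrow> stable t')"
      using Nd.IH[OF _ t'] j by simp
    have ts: "ts = take j ts @ ts ! j # drop (Suc j) ts" using j by (simp add: id_take_nth_drop)
    have u': "ts[j := t'] = take j ts @ t' # drop (Suc j) ts" using j by (simp add: upd_conv_take_nth_drop)
    have "mset (leaves u) = mset (leaves (Nd ts))" unfolding u u' by (subst (3) ts) (simp add: IH)
    moreover have "tdeg u = tdeg (Nd ts) + 1" unfolding u u' by (subst (3) ts) (use j IH in simp)
    moreover have "stable (Nd ts) \<longrightarrow> stable u" unfolding u using IH j by (auto dest!: set_update_subset_insert[THEN subsetD])
    ultimately show ?thesis by blast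
  qed
qed simp

text \<open>A tree with a vertex that is not binary has the value zero. Splitting a vertex of arity \<open>k\<close> produces
  two vertices of arities \<open>p\<close> and \<open>k - p + 1\<close>, which are both binary only if \<open>k = 3\<close>; at a ternary root the
  three shuffles give the Jacobi identity, and a binary root leaves the differentials of its children.\<close>

lemma tree_val_tree_dif: "lin pscale tree_val (tree_dif t) = (0 :: 'k::field ncpoly)"
proof (induction t)
  case (Nd ts)
  let ?k = "length ts" and ?v = "tree_val :: ltree \<Rightarrow> 'k ncpoly"
  let ?T = "\<lambda>p \<sigma>. Nd (Nd (map (\<lambda>j. ts ! (\<sigma> j - 1)) [1..<Suc p])
                # map (\<lambda>j. ts ! (\<sigma> j - 1)) [Suc p..<Suc (length ts)])"
  have A: "(\<Sum>p\<in>{2..<length ts}. \<Sum>\<sigma>\<in>Sh p (length ts - p). sg (koszul \<sigma> ts) (?v (?T p \<sigma>))) = 0"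
  proof (cases "?k = 3")
    case False
    have "?v (?T p \<sigma>) = 0" if "p \<in> {2..<?k}" for p \<sigma>
    proof (cases "length (map (\<lambda>j. ts ! (\<sigma> j - 1)) [Suc p..<Suc ?k]) = 1")
      case True
      then obtain y where y: "map (\<lambda>j. ts ! (\<sigma> j - 1)) [Suc p..<Suc ?k] = [y]" by (metis One_nat_def length_0_conv length_Suc_conv)
      \<comment> \<open>The root is binary and \<open>k \<noteq> 3\<close>, so that the new vertex above it has arity \<open>p = k - 1 \<noteq> 2\<close>.\<close>
      have "p \<noteq> 2" using True that False by (simp del: upt_Suc) 
      then have "?v (Nd (map (\<lambda>j. ts ! (\<sigma> j - 1)) [1..<Suc p])) = 0" by (intro tree_val_nonbinary) (simp del: upt_Suc)
      then show ?thesis unfolding y by (simp add: word_mult_left word_mult_right del: upt_Suc)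
    next
      case False
      then show ?thesis by (intro tree_val_nonbinary) (simp del: upt_Suc)
    qed
    then show ?thesis by (intro sum.neutral ballI) simp
  next
    case True
    then obtain x y z where ts: "ts = [x, y, z]" by (auto simp: numeral_3_eq_3 length_Suc_conv)
    have up: "[1..<Suc 2] = [1, 2]" "[Suc 2..<Suc 3] = [3]" "{2..<3} = {2::nat}" "3 - 2 = (1::nat)"
      by (auto simp: upt_rec)
    have v: "list_perm [1, 2, 3] 1 = 1" "list_perm [1, 2, 3] 2 = 2" "list_perm [1, 2, 3] 3 = 3"
      "list_perm [1, 3, 2] 1 = 1" "list_perm [1, 3, 2] 2 = 3" "list_perm [1, 3, 2] 3 = 2"
      "list_perm [2, 3, 1] 1 = 2" "list_perm [2, 3, 1] 2 = 3" "list_perm [2, 3, 1] 3 = 1"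
      by (auto simp: list_perm_def)
    have n: "[x, y, z] ! (1 - 1) = x" "[x, y, z] ! (2 - 1) = y" "[x, y, z] ! (3 - 1) = z" by auto
    have "(\<Sum>p\<in>{2..<length ts}. \<Sum>\<sigma>\<in>Sh p (length ts - p). sg (koszul \<sigma> ts) (?v (?T p \<sigma>)))
      = ?v (Nd [Nd [x, y], z]) + sg (tdeg z * tdeg y) (?v (Nd [Nd [x, z], y]))
        + sg (tdeg y * tdeg x + tdeg z * tdeg x) (?v (Nd [Nd [y, z], x]))"
    proof -
      have T: "?T 2 \<sigma> = Nd [Nd [ts ! (\<sigma> 1 - 1), ts ! (\<sigma> 2 - 1)], ts ! (\<sigma> 3 - 1)]" for \<sigma>
        by (simp only: True up list.map)
      have "(\<Sum>p\<in>{2..<length ts}. \<Sum>\<sigma>\<in>Sh p (length ts - p). sg (koszul \<sigma> ts) (?v (?T p \<sigma>)))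
        = (\<Sum>\<sigma>\<in>Sh 2 1. sg (koszul \<sigma> ts) (?v (?T 2 \<sigma>)))"
        by (simp only: True up(3,4) sum.insert finite.emptyI empty_iff not_False_eq_True sum.empty add_0_right)
      then show ?thesis unfolding T sum_Sh_2_1 unfolding ts koszul_Sh_2_1 v n sg_0 .
    qed
    also have "\<dots> = 0"
    proof (cases "?v x = 0 \<or> ?v y = 0 \<or> ?v z = 0")
      case True
      then show ?thesis by (auto simp: word_mult_left word_mult_right)
    next
      case False
      then have d: "tdeg x = 1 - int (length (leaves x))" "tdeg y = 1 - int (length (leaves y))"
        "tdeg z = 1 - int (length (leaves z))" using tdeg_tree_val by blast+
      show ?thesis
        using jacobi_signed_words[where a = "int (length (leaves x))" and b = "int (length (leaves y))"
            and c = "int (length (leaves z))" and x = "?v x" and y = "?v y" and z = "?v z"]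
        by (simp add: d)
    qed
    finally show ?thesis .
  qed
  have B: "lin pscale (\<lambda>t. ?v (Nd (ts[j := t]))) (tree_dif (ts ! j)) = 0" if "j < ?k" for j
  proof (cases "?k = 2")
    case True
    then obtain s t where ts: "ts = [s, t]" by (auto simp: numeral_2_eq_2 length_Suc_conv)
    \<comment> \<open>The signs in \<open>tree_val\<close> depend on the numbers of leaves only, which the differential preserves.\<close>
    have len: "length (leaves u) = length (leaves t)" if "u \<in> supp (tree_dif t :: ltree \<Rightarrow>\<^sub>0 'k)" for u t
      using keys_tree_dif[OF that] by (metis size_mset)
    have IH: "lin pscale ?v (tree_dif s) = 0" "lin pscale ?v (tree_dif t) = 0" using Nd.IH ts by auto
    consider "j = 0" | "j = 1" using \<open>j < ?k\<close> True by linarith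
    then show ?thesis
    proof cases
      case 1
      have "lin pscale (\<lambda>u. ?v (Nd [u, t])) (tree_dif s) = lin pscale (\<lambda>u.
        sg (int (length (leaves s)) * (int (length (leaves t)) - 1)) (word_mult (?v u) (?v t))
         + sg (int (length (leaves s)) - 1) (word_mult (?v t) (?v u))) (tree_dif s)"
        by (rule free_vs.lin_cong) (simp add: len)
      then show ?thesis using 1 IH
        by (simp add: ts free_vs.lin_fun_add free_vs.lin_fun_sg word_mult_left(1) word_mult_right(1)
            flip: word_mult_left(8) word_mult_right(8))
    next
      case 2
      have "lin pscale (\<lambda>u. ?v (Nd [s, u])) (tree_dif t) = lin pscale (\<lambda>u.
        sg (int (length (leaves s)) * (int (length (leaves t)) - 1)) (word_mult (?v s) (?v u))
         + sg (int (length (leaves s)) - 1) (word_mult (?v u) (?v s))) (tree_dif t)"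
        by (rule free_vs.lin_cong) (simp add: len)
      then show ?thesis using 2 IH
        by (simp add: ts free_vs.lin_fun_add free_vs.lin_fun_sg word_mult_left(1) word_mult_right(1)
            flip: word_mult_left(8) word_mult_right(8))
    qed
  next
    case False
    then show ?thesis by (simp add: tree_val_nonbinary)
  qed
  have "lin pscale ?v (tree_dif (Nd ts))
    = - (\<Sum>p\<in>{2..<length ts}. \<Sum>\<sigma>\<in>Sh p (length ts - p). sg (koszul \<sigma> ts) (?v (?T p \<sigma>)))
      + (\<Sum>j<length ts. sg (3 - 2 * int (length ts) + sum_list (map tdeg (take j ts)))
         (lin pscale (\<lambda>t. ?v (Nd (ts[j := t]))) (tree_dif (ts ! j))))"
    unfolding tree_dif.simps free_vs.lin_add free_vs.lin_uminus free_vs.lin_sum free_vs.lin_sg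
      free_vs.lin_single free_vs.lin_lin by (simp del: upt_Suc)
  then show ?case unfolding A using B by simp
qed simp

section \<open>The map from shifted homotopy Lie algebras\<close>

text \<open>The value of a tree whose leaves have been renumbered from left to right, which is what \<open>planar\<close>
  computes.\<close>

fun planar_val :: "ltree \<Rightarrow> 'k::field ncpoly" where
  "planar_val (Lf j) = single [1] 1"
| "planar_val (Nd [s, t]) =
     sg (int (length (leaves s)) * (int (length (leaves t)) - 1))
       (word_mult (planar_val s) (relabel (\<lambda>j. j + length (leaves s)) (planar_val t)))
     + sg (int (length (leaves s)) - 1)
       (word_mult (relabel (\<lambda>j. j + length (leaves s)) (planar_val t)) (planar_val s))"
| "planar_val (Nd ts) = 0"

lemma keys_relabel_mem: "w \<in> supp (relabel \<sigma> x) \<Longrightarrow> \<exists>u\<in>supp x. w = map \<sigma> u"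
  using keys_lin[of "\<lambda>w. single (map \<sigma> w) 1" x] by auto

lemma keys_planar_val:
  "w \<in> supp (planar_val t :: 'k::field ncpoly) \<Longrightarrow> w \<in> as_words (length (leaves t))"
proof (induction t arbitrary: w rule: planar_val.induct)
  case (2 s t)
  let ?l = "length (leaves s)"
  obtain u v where uv: "u \<in> supp (planar_val s :: 'k ncpoly)"
    "v \<in> supp (planar_val t :: 'k ncpoly)"
    and w: "w = u @ map (\<lambda>j. j + ?l) v \<or> w = map (\<lambda>j. j + ?l) v @ u"
    using "2.prems" by (auto dest!: keys_add_mem keys_relabel_mem elim!: keys_word_mult)
  have "u \<in> as_words ?l" "v \<in> as_words (length (leaves t))" using 2 uv by auto
  moreover have "set (map (\<lambda>j. j + ?l) v) = {?l + 1..?l + length (leaves t)}" if "set v = {1..length (leaves t)}"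
    using that image_add_atLeastAtMost'[of ?l 1 "length (leaves t)"] by (simp add: add.commute)
  ultimately have "distinct w" "set w = {1..?l} \<union> {?l + 1..?l + length (leaves t)}" "?l \<noteq> 0"
    using w by (auto simp: as_words_iff distinct_map inj_on_def)
  moreover have "{1..?l} \<union> {?l + 1..?l + length (leaves t)} = {1..?l + length (leaves t)}" by auto
  ultimately show ?case by (simp add: as_words_iff)
qed (auto simp: as_words_def split: if_splits)

lemma tdeg_planar_val: "(planar_val t :: 'k::field ncpoly) \<noteq> 0 \<Longrightarrow> tdeg t = 1 - int (length (leaves t))"
proof (induction t rule: planar_val.induct)
  case (2 s t)
  then have "(planar_val s :: 'k ncpoly) \<noteq> 0" "(planar_val t :: 'k ncpoly) \<noteq> 0"
    by (auto simp: word_mult_left(1) word_mult_right(1))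
  then show ?case using 2 by simp
qed auto

lemma relabel_cong:
  "(\<And>w j. w \<in> supp x \<Longrightarrow> j \<in> set w \<Longrightarrow> f j = g j) \<Longrightarrow> relabel f x = relabel g x"
  by (intro free_vs.lin_cong arg_cong[where f = "\<lambda>w. single w 1"] map_cong) auto

lemma relabel_cong_id:
  "(\<And>w j. w \<in> supp x \<Longrightarrow> j \<in> set w \<Longrightarrow> f j = j) \<Longrightarrow> relabel f x = x"
  using relabel_cong[of x f id] by simp

lemma tree_val_relabel_planar_val: "(tree_val t :: 'k::field ncpoly) = relabel (list_perm (leaves t)) (planar_val t)"
proof (induction t rule: planar_val.induct)
  case (2 s t)
  let ?l = "length (leaves s)" and ?\<sigma> = "list_perm (leaves s @ leaves t)"
  have letters: "1 \<le> j \<and> j \<le> length (leaves t)"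
    if "w \<in> supp (planar_val t :: 'k ncpoly)" "j \<in> set w" for w j t
    using keys_planar_val[OF that(1)] that(2) by (auto simp: as_words_iff)
  have s: "relabel ?\<sigma> (planar_val s) = (tree_val s :: 'k ncpoly)"
    unfolding 2(1) by (rule relabel_cong) (auto dest!: letters simp: list_perm_def nth_append)
  have t: "relabel ?\<sigma> (relabel (\<lambda>j. j + ?l) (planar_val t)) = (tree_val t :: 'k ncpoly)"
    unfolding 2(2) relabel_relabel by (rule relabel_cong) (auto dest!: letters simp: list_perm_def nth_append)
  show ?case
    using s t by (simp add: free_vs.lin_add free_vs.lin_sg relabel_word_mult relabel_relabel)
qed (simp_all add: list_perm_def)

definition sgn_bracket :: "'k::field ncpoly" where
  "sgn_bracket = single [1, 2] 1 + single [2, 1] 1"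

lemma theta_sgn_bracket: "theta sgn_bracket = as_bracket"
  by (simp add: sgn_bracket_def as_bracket_def theta_linear theta_single sg_def)

lemma keys_sgn_bracket: "supp sgn_bracket \<subseteq> as_words 2"
proof -
  have "{1..2} = {1, 2 :: nat}" by auto
  then show ?thesis unfolding sgn_bracket_def by (auto simp: as_words_iff dest!: keys_add_mem)
qed

lemma sgn_bracket_mult:
  "sgn_bracket = word_mult (single [1] 1) (single [2] 1)
    + word_mult (single [2] 1) (single [1] 1)"
  by (simp add: sgn_bracket_def word_mult_single)

lemma graft_zero: "graft LAs 0 n d i ws = 0"
  by (induction ws arbitrary: n d i) auto

text \<open>The values of the children are inserted into $e_{12}+e_{21}$ one after the other: the first at input 1,
  where only $e_{21}$ gives a sign, the second at input \<open>length (leaves s) + 1\<close>, which has moved to the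
  right of the letters of \<open>s\<close> in the first summand and is leftmost in the second.\<close>

lemma planar_eq_theta_planar_val: "planar LAs as_gen t = (theta (planar_val t) :: 'k::field ncpoly)"
proof (induction t rule: planar_val.induct)
  case (1 j)
  then show ?case by (simp add: LAs_simps theta_single)
next
  case (2 s t)
  let ?x = "planar_val s :: 'k ncpoly" and ?y = "planar_val t :: 'k ncpoly"
  let ?l = "length (leaves s)" and ?m = "length (leaves t)"
  have p: "planar LAs as_gen (Nd [s, t])
    = ins LAs (2 + ?l - 1) (- 1 + tdeg s) ?m (tdeg t) (1 + ?l) (ins LAs 2 (- 1) ?l (tdeg s) 1 as_bracket (theta ?x)) (theta ?y)"
    by (simp add: 2 as_gen_def[of "Suc (Suc 0)"] numeral_2_eq_2)
  show ?case
  proof (cases "?x = 0 \<or> ?y = 0")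
    case True
    then show ?thesis unfolding p by (auto simp: theta_linear word_mult_left(1) word_mult_right(1))
  next
    case False
    then have d: "tdeg s = 1 - int ?l" using tdeg_planar_val by blast
    have k: "supp ?x \<subseteq> as_words ?l" "supp ?y \<subseteq> as_words ?m"
      using keys_planar_val by blast+
    have letters: "1 \<le> j \<and> j \<le> ?l" if "w \<in> supp ?x" "j \<in> set w" for w j
      using keys_planar_val[OF that(1)] that(2) by (auto simp: as_words_iff)
    have len: "length w = ?l" if "w \<in> supp ?x" for w
      using keys_planar_val[OF that] length_as_words by blast
    let ?b = "single [?l + 1] (1 :: 'k)"
    have L1: "signed_subst (int ?l - 1) 1 ?l (word_mult (single [1] 1) (single [2] 1)) ?x = word_mult ?x ?b"
      by (subst signed_subst_mult_left) (auto simp: signed_subst_letter[of _ 1, simplified] shift_letter_def)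
    have R1: "signed_subst (int ?l - 1) 1 ?l (word_mult (single [2] 1) (single [1] 1)) ?x
      = sg ((int ?l - 1) * int 1) (word_mult ?b ?x)"
      by (subst signed_subst_mult_right[where l = 1]) (auto simp: signed_subst_letter[of _ 1, simplified] shift_letter_def)
    have S1: "signed_ins 1 ?l sgn_bracket ?x = word_mult ?x ?b + sg (int ?l - 1) (word_mult ?b ?x)"
      unfolding signed_ins_signed_subst sgn_bracket_mult signed_subst_linear L1 R1 by simp
    have e: "- 1 = 1 - int 2" "- 1 + tdeg s = 1 - int (2 + ?l - 1)" using d by auto
    have I1: "ins LAs 2 (- 1) ?l (tdeg s) 1 as_bracket (theta ?x) = theta (signed_ins 1 ?l sgn_bracket ?x)"
      unfolding e(1) theta_sgn_bracket[symmetric] by (rule LAs_ins_theta[OF keys_sgn_bracket k(1)]) simp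
    have K: "supp (signed_ins 1 ?l sgn_bracket ?x) \<subseteq> as_words (2 + ?l - 1)"
      by (rule keys_signed_ins[OF keys_sgn_bracket k(1)]) simp
    have I2: "planar LAs as_gen (Nd [s, t]) = theta (signed_ins (1 + ?l) ?m (signed_ins 1 ?l sgn_bracket ?x) ?y)"
      unfolding p I1 e(2) by (rule LAs_ins_theta[OF K k(2)]) simp
    let ?y' = "relabel (\<lambda>j. j + ?l) ?y"
    have x: "relabel (shift_letter (1 + ?l) ?m) ?x = ?x"
      by (rule relabel_cong_id) (auto dest!: letters simp: shift_letter_def)
    have y: "signed_subst (int ?m - 1) (1 + ?l) ?m ?b ?y = ?y'"
      using signed_subst_letter[of _ "1 + ?l" ?m ?y] by (simp add: add.commute)
    have R2: "signed_subst (int ?m - 1) (1 + ?l) ?m (word_mult ?x ?b) ?y = sg ((int ?m - 1) * int ?l) (word_mult ?x ?y')"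
      using letters len by (subst signed_subst_mult_right[where l = ?l]) (fastforce, simp only: x y)
    have L2: "signed_subst (int ?m - 1) (1 + ?l) ?m (word_mult ?b ?x) ?y = word_mult ?y' ?x"
      using letters by (subst signed_subst_mult_left) (simp, fastforce, simp only: x y)
    show ?thesis
      unfolding I2 signed_ins_signed_subst[of "1 + ?l"] S1 signed_subst_linear R2 L2
      by (simp add: mult.commute)
  qed
qed (simp_all add: as_gen_def graft_zero theta_linear)

definition word_val :: "(ltree, 'k::field) pres \<Rightarrow> 'k ncpoly" where
  "word_val = pres_lin tree_val"

lemmas word_val_linear = pres_lin_linear[OF kills_relators_tree_val, folded word_val_def]
lemmas word_val_abs = pres_lin_abs[OF kills_relators_tree_val, folded word_val_def]

lemma LLinf_to_LAs_eq:
  assumes "x \<in> carr LLinf n d"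
  shows "LLinf_to_LAs n d x = theta (word_val x)"
proof -
  have k: "supp (hrep (ltrees n d) x) \<subseteq> ltrees n d"
    using hrep(1)[of x "ltrees n d"] assms by (simp add: LLinf_carr)
  have "act LAs n d (list_perm (leaves t)) (planar LAs as_gen t) = theta (tree_val t :: 'a ncpoly)"
    if "t \<in> ltrees n d" for t
  proof -
    have t: "leaves t \<in> as_words n" using that by (simp add: ltrees_leaves)
    then have "list_perm (leaves t) permutes {1..n}" by (intro list_perm_permutes) (auto simp: as_words_iff)
    moreover have "supp (planar_val t :: 'a ncpoly) \<subseteq> as_words n"
      using keys_planar_val[of _ t] length_as_words[OF t] by auto
    ultimately show ?thesis unfolding planar_eq_theta_planar_val tree_val_relabel_planar_val by (intro LAs_act_theta)
  qed
  then have "free_map LAs as_gen n d x = lin pscale (\<lambda>t. theta (tree_val t)) (hrep (ltrees n d) x)"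
    unfolding free_map_def LAs_simps(2) using k by (intro free_vs.lin_cong) blast
  also have "\<dots> = theta (word_val x)"
    unfolding theta_linear[symmetric] word_val_def
    by (subst lin_hrep[OF kills_relators_tree_val]) (use assms in \<open>simp_all add: LLinf_carr\<close>)
  finally show ?thesis by (simp add: LLinf_to_LAs_free_map[OF assms])
qed

lemma word_val_carr:
  assumes "x \<in> carr LLinf n d"
  shows "supp (word_val x) \<subseteq> as_words n" "d \<noteq> 1 - int n \<Longrightarrow> word_val x = 0"
proof -
  obtain y where y: "x = abs_pres y" "supp y \<subseteq> ltrees n d" using assms by (auto simp: LLinf_carr)
  show "supp (word_val x) \<subseteq> as_words n"
    unfolding y(1) word_val_abs
  proof (rule keys_lin_subset[OF y(2)], rule subsetI)
    fix t w assume t: "t \<in> ltrees n d" and "w \<in> supp (tree_val t :: 'a ncpoly)"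
    then have "mset w = mset (leaves t)" using keys_tree_val by blast
    moreover from this have "set w = set (leaves t)" by (metis set_mset_mset)
    ultimately show "w \<in> as_words n" using t mset_eq_imp_distinct_iff[of w "leaves t"]
      by (auto simp: ltrees_leaves as_words_iff)
  qed
  assume d: "d \<noteq> 1 - int n"
  have "lin pscale tree_val y = lin pscale (\<lambda>t. 0 :: 'a ncpoly) y"
  proof (rule free_vs.lin_cong)
    fix t assume "t \<in> supp y"
    then have "leaves t \<in> as_words n" "tdeg t = d" using y by (auto simp: ltrees_leaves)
    then show "tree_val t = (0 :: 'a ncpoly)" using tdeg_tree_val[of t] d length_as_words by metis
  qed
  then show "word_val x = 0" by (simp add: y(1) word_val_abs)
qed

lemma LLinf_carr_linear:
  assumes "x \<in> carr LLinf n d"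
  shows "y \<in> carr LLinf n d \<Longrightarrow> x + y \<in> carr LLinf n d" "qscale c x \<in> carr LLinf n d"
proof -
  obtain x' where x: "x = abs_pres x'" "supp x' \<subseteq> ltrees n d" using assms by (auto simp: LLinf_carr)
  show "qscale c x \<in> carr LLinf n d"
    unfolding x(1) LLinf_carr abs_pres_pscale[symmetric]
    using x(2) free_vs.keys_pscale_subset[of c x'] by auto
  assume "y \<in> carr LLinf n d"
  then obtain y' where y: "y = abs_pres y'" "supp y' \<subseteq> ltrees n d" by (auto simp: LLinf_carr)
  show "x + y \<in> carr LLinf n d"
    unfolding x(1) y(1) LLinf_carr abs_pres_add[symmetric]
    using x(2) y(2) Poly_Mapping.keys_add[of x' y'] by auto
qed

lemma stable_tbind: "stable t \<Longrightarrow> (\<And>j. stable (f j)) \<Longrightarrow> stable (tbind f t)"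
  by (induction t) auto

lemma tdeg_relabel: "tdeg (tbind (\<lambda>j. Lf (f j)) t) = tdeg t"
proof (induction t)
  case (Nd ts)
  then have "sum_list (map (\<lambda>t. tdeg (tbind (\<lambda>j. Lf (f j)) t)) ts) = sum_list (map tdeg ts)"
    by (intro arg_cong[where f = sum_list] map_cong) auto
  then show ?case by (simp add: o_def)
qed simp

lemma tdeg_tree_subst:
  "distinct (leaves t) \<Longrightarrow> i \<in> set (leaves t) \<Longrightarrow> tdeg (tree_subst i m s t) = tdeg t + tdeg s"
proof (induction t)
  case (Lf j)
  then have "tree_subst i m s (Lf j) = tbind (\<lambda>j. Lf (j + i - 1)) s" by (simp add: tree_subst_def)
  then show ?case by (simp add: tdeg_relabel)
next
  case (Nd ts)
  from Nd.prems obtain t where t: "t \<in> set ts" "i \<in> set (leaves t)" by auto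
  then obtain us vs where ts: "ts = us @ t # vs" by (meson split_list)
  then have "i \<notin> set (leaves u)" if "u \<in> set us \<union> set vs" for u using that Nd.prems t by auto
  then have "tdeg (tree_subst i m s u) = tdeg u" if "u \<in> set us \<union> set vs" for u
    using that by (simp add: tree_subst_notin tdeg_relabel)
  then have "sum_list (map (\<lambda>u. tdeg (tree_subst i m s u)) us) = sum_list (map tdeg us)"
    "sum_list (map (\<lambda>u. tdeg (tree_subst i m s u)) vs) = sum_list (map tdeg vs)"
    by (auto intro!: arg_cong[where f = sum_list] map_cong simp del: map_eq_conv)
  moreover have "tdeg (tree_subst i m s t) = tdeg t + tdeg s"
    using Nd.IH[OF t(1)] t(2) Nd.prems ts by auto
  ultimately show ?case by (simp add: tree_subst_Nd ts o_def)
qed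

lemma tree_subst_ltrees:
  assumes "t \<in> ltrees n d" "s \<in> ltrees m e" "i \<in> {1..n}"
  shows "tree_subst i m s t \<in> ltrees (n + m - 1) (d + e)"
proof -
  have "stable (tree_subst i m s t)"
    using assms unfolding tree_subst_def ltrees_leaves by (intro stable_tbind) (auto intro!: stable_tbind)
  moreover have "leaves (tree_subst i m s t) \<in> as_words (n + m - 1)"
    using assms unfolding leaves_tree_subst ltrees_leaves by (intro word_subst_as_words) auto
  moreover have "tdeg (tree_subst i m s t) = d + e"
    using assms by (subst tdeg_tree_subst) (auto simp: ltrees_leaves as_words_iff)
  ultimately show ?thesis by (simp add: ltrees_leaves)
qed

lemma word_val_ins:
  assumes "x \<in> carr LLinf n d" "y \<in> carr LLinf m e" "i \<in> {1..n}"
  shows "ins LLinf n d m e i x y \<in> carr LLinf (n + m - 1) (d + e)"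
    and "word_val (ins LLinf n d m e i x y) = signed_ins i m (word_val x) (word_val y)"
proof -
  define x' y' where "x' = hrep (ltrees n d) x" and "y' = hrep (ltrees m e) y"
  have k: "supp x' \<subseteq> ltrees n d" "supp y' \<subseteq> ltrees m e"
    and xy: "abs_pres x' = x" "abs_pres y' = y"
    using hrep assms(1,2) unfolding LLinf_carr x'_def y'_def by blast+
  have ins: "ins LLinf n d m e i x y = abs_pres (bilin (\<lambda>t s. sg (e * deg_after i t)
      (single (tree_subst i m s t) 1)) x' y')"
    by (simp add: LLinf_def x'_def y'_def)
  have "supp (bilin (\<lambda>t s. sg (e * deg_after i t)
      (single (tree_subst i m s t) (1::'a))) x' y') \<subseteq> ltrees (n + m - 1) (d + e)"
    using tree_subst_ltrees[OF _ _ assms(3)] by (intro keys_bilin_subset[OF k]) auto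
  then show "ins LLinf n d m e i x y \<in> carr LLinf (n + m - 1) (d + e)"
    unfolding ins LLinf_carr by auto
  have "word_val (ins LLinf n d m e i x y) = bilin (\<lambda>t s. sg (e * deg_after i t) (tree_val (tree_subst i m s t))) x' y'"
    unfolding ins by (simp add: word_val_abs lin_bilin free_vs.lin_sg)
  also have "\<dots> = bilin (\<lambda>t s. signed_ins i m (tree_val t) (tree_val s)) x' y'"
  proof (rule bilin_cong)
    fix t s assume "t \<in> supp x'" "s \<in> supp y'"
    then have t: "distinct (leaves t)" "i \<in> set (leaves t)" and s: "leaves s \<in> as_words m" "tdeg s = e"
      using k assms(3) by (auto simp: ltrees_leaves as_words_iff)
    have "(tree_val (tree_subst i m s t) :: 'a ncpoly)
        = sg ((int m - 1) * deg_after i t) (signed_ins i m (tree_val t) (tree_val s))"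
      unfolding signed_ins_signed_subst using t length_as_words[OF s(1)] by (rule tree_val_subst)
    \<comment> \<open>The two signs cancel because \<open>e = 1 - m\<close> unless the value of \<open>s\<close> is zero.\<close>
    moreover have "sg (e * deg_after i t) (sg ((int m - 1) * deg_after i t) (signed_ins i m (tree_val t) (tree_val s)))
        = (signed_ins i m (tree_val t) (tree_val s) :: 'a ncpoly)"
    proof (cases "(tree_val s :: 'a ncpoly) = 0")
      case True
      then show ?thesis by (simp add: signed_ins_signed_subst signed_subst_linear)
    next
      case False
      then have "e = 1 - int m" using tdeg_tree_val s length_as_words by metis
      then show ?thesis unfolding sg_sg by (simp add: sg_def)
    qed
    ultimately show "sg (e * deg_after i t) (tree_val (tree_subst i m s t))
      = (signed_ins i m (tree_val t) (tree_val s) :: 'a ncpoly)" by simp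
  qed
  also have "\<dots> = signed_ins i m (lin pscale tree_val x') (lin pscale tree_val y')"
    unfolding signed_ins_def bilin_left by (simp add: bilin_right bilin_def[of _ x' y'])
  finally show "word_val (ins LLinf n d m e i x y) = signed_ins i m (word_val x) (word_val y)"
    by (simp add: word_val_abs flip: xy)
qed

lemma word_val_act:
  assumes "x \<in> carr LLinf n d" "\<sigma> permutes {1..n}"
  shows "act LLinf n d \<sigma> x \<in> carr LLinf n d" "word_val (act LLinf n d \<sigma> x) = relabel \<sigma> (word_val x)"
proof -
  define x' where "x' = hrep (ltrees n d) x"
  have k: "supp x' \<subseteq> ltrees n d" and x: "abs_pres x' = x"
    using hrep assms(1) unfolding LLinf_carr x'_def by blast+
  have a: "act LLinf n d \<sigma> x = abs_pres (lin pscale (\<lambda>t. single (tbind (\<lambda>j. Lf (\<sigma> j)) t) 1) x')"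
    by (simp add: LLinf_def x'_def)
  have "tbind (\<lambda>j. Lf (\<sigma> j)) t \<in> ltrees n d" if "t \<in> ltrees n d" for t
    using that assms(2) by (auto simp: ltrees_leaves leaves_relabel tdeg_relabel map_as_words intro!: stable_tbind)
  then have "supp (lin pscale (\<lambda>t. single (tbind (\<lambda>j. Lf (\<sigma> j)) t) (1::'a)) x') \<subseteq> ltrees n d"
    by (intro keys_lin_subset[OF k]) auto
  then show "act LLinf n d \<sigma> x \<in> carr LLinf n d" unfolding a LLinf_carr by auto
  show "word_val (act LLinf n d \<sigma> x) = relabel \<sigma> (word_val x)"
    unfolding a by (simp add: word_val_abs free_vs.lin_lin tree_val_relabel flip: x)
qed

lemma word_val_dif:
  assumes "x \<in> carr LLinf n d"
  shows "dif LLinf n d x \<in> carr LLinf n (d + 1)" "word_val (dif LLinf n d x) = 0"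
proof -
  define x' where "x' = hrep (ltrees n d) x"
  have k: "supp x' \<subseteq> ltrees n d"
    using hrep assms(1) unfolding LLinf_carr x'_def by blast+
  have a: "dif LLinf n d x = abs_pres (lin pscale tree_dif x')"
    by (simp add: LLinf_def x'_def)
  have "u \<in> ltrees n (d + 1)" if t: "t \<in> ltrees n d" and u: "u \<in> supp (tree_dif t :: ltree \<Rightarrow>\<^sub>0 'a)" for t u
  proof -
    have "mset (leaves u) = mset (leaves t)" using keys_tree_dif[OF u] by blast
    moreover from this have "set (leaves u) = set (leaves t)" by (metis set_mset_mset)
    ultimately show ?thesis using t keys_tree_dif[OF u] mset_eq_imp_distinct_iff[of "leaves u" "leaves t"]
      by (auto simp: ltrees_leaves as_words_iff)
  qed
  then have "supp (lin pscale tree_dif x') \<subseteq> ltrees n (d + 1)"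
    by (intro keys_lin_subset[OF k]) auto
  then show "dif LLinf n d x \<in> carr LLinf n (d + 1)" unfolding a LLinf_carr by auto
  show "word_val (dif LLinf n d x) = 0"
    unfolding a by (simp add: word_val_abs free_vs.lin_lin tree_val_tree_dif)
qed

text \<open>Since \<open>tree_val\<close> respects the exchange relations, it is defined on the quotient, where it is compatible
  with grafting, relabelling and the differential. An element of degree other than \<open>1 - n\<close> has the value
  zero, so that the degree in the sign of an insertion is the right one whenever it matters.\<close>

lemma LLinf_to_LAs_map: "dg_operad_map LLinf LAs (LLinf_to_LAs :: ((ltree, 'k::field) pres, _) gmap)"
  unfolding dg_operad_map_def
proof (intro conjI allI ballI impI)
  note [simp] = LLinf_to_LAs_eq
  fix n d m e i \<sigma> and x :: "(ltree, 'k) pres" and y :: "(ltree, 'k) pres"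
  show "LLinf_to_LAs n d ` carr LLinf n d \<subseteq> carr LAs n d"
    using word_val_carr by (fastforce simp: LAs_simps theta_linear)
  show "linear_from (carr LLinf n d) (scl LLinf) (scl LAs) (LLinf_to_LAs n d)"
    unfolding linear_from_def LAs_simps
    by (auto simp: LLinf_carr_linear word_val_linear theta_linear LLinf_def[THEN arg_cong, of scl])
  have "unt LLinf \<in> (carr LLinf 1 0 :: (ltree, 'k) pres set)"
    by (auto simp: LLinf_def ltrees_def intro!: imageI)
  then show "LLinf_to_LAs 1 0 (unt LLinf) = (unt LAs :: 'k ncpoly)"
    by (simp add: LAs_simps) (simp add: LLinf_def word_val_abs theta_single)
  assume x: "x \<in> carr LLinf n d"
  {
    assume y: "y \<in> carr LLinf m e" and i: "i \<in> {1..n}"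
    show "LLinf_to_LAs (n + m - 1) (d + e) (ins LLinf n d m e i x y)
      = ins LAs n d m e i (LLinf_to_LAs n d x) (LLinf_to_LAs m e y)"
    proof (cases "d = 1 - int n")
      case True
      have "ins LAs n d m e i (theta (word_val x)) (theta (word_val y)) = theta (signed_ins i m (word_val x) (word_val y))"
        unfolding True by (rule LAs_ins_theta[OF word_val_carr(1)[OF x] word_val_carr(1)[OF y] i])
      then show ?thesis
        by (simp only: LLinf_to_LAs_eq[OF word_val_ins(1)[OF x y i]] LLinf_to_LAs_eq[OF x]
            LLinf_to_LAs_eq[OF y] word_val_ins(2)[OF x y i])
    next
      case False
      then show ?thesis
        by (simp only: LLinf_to_LAs_eq[OF word_val_ins(1)[OF x y i]] LLinf_to_LAs_eq[OF x]
            LLinf_to_LAs_eq[OF y] word_val_ins(2)[OF x y i] word_val_carr(2)[OF x False]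
            signed_ins_signed_subst signed_subst_linear theta_linear LAs_ins_zero)
    qed
  }
  {
    assume \<sigma>: "\<sigma> permutes {1..n}"
    show "LLinf_to_LAs n d (act LLinf n d \<sigma> x) = act LAs n d \<sigma> (LLinf_to_LAs n d x)"
      by (simp only: LLinf_to_LAs_eq[OF word_val_act(1)[OF x \<sigma>]] LLinf_to_LAs_eq[OF x]
          word_val_act(2)[OF x \<sigma>] LAs_act_theta[OF word_val_carr(1)[OF x] \<sigma>])
  }
  show "LLinf_to_LAs n (d + 1) (dif LLinf n d x) = dif LAs n d (LLinf_to_LAs n d x)"
    by (simp only: LLinf_to_LAs_eq[OF word_val_dif(1)[OF x]] word_val_dif(2)[OF x] LAs_simps(5) theta_linear)
qed

lemma mc_LLinf_to_LAs: "2 \<le> n \<Longrightarrow> mc LLinf_to_LAs n = (as_gen n :: 'k::field ncpoly)"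
  and mc_LLinf_to_LAs_small: "n < 2 \<Longrightarrow> mc LLinf_to_LAs n = (0 :: 'k ncpoly)"
proof -
  assume n: "2 \<le> n"
  let ?t = "Nd (map Lf [1..<Suc n])"
  have "leaves ?t = [1..<Suc n]" by (simp add: o_def del: upt_Suc)
  moreover have "tdeg ?t = 3 - 2 * int n" by (simp add: o_def sum_list_0 del: upt_Suc)
  moreover have "stable ?t" using n by (auto simp del: upt_Suc)
  ultimately have "?t \<in> ltrees n (3 - 2 * int n)"
    using n upt_as_words[of n] unfolding ltrees_leaves by simp
  then have "lam n \<in> (carr LLinf n (3 - 2 * int n) :: (ltree, 'k) pres set)"
    unfolding LLinf_carr lam_def by (intro imageI) simp
  then have "mc LLinf_to_LAs n = theta (tree_val ?t :: 'k ncpoly)"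
    using n by (simp add: mc_def LLinf_to_LAs_eq word_val_abs lam_def del: upt_Suc)
  also have "\<dots> = as_gen n"
  proof (cases "n = 2")
    case True
    have "[1..<Suc 2] = [1, 2]" by (simp add: upt_rec)
    then have "tree_val ?t = (sgn_bracket :: 'k ncpoly)"
      unfolding True by (simp add: word_mult_single sgn_bracket_def)
    then show ?thesis by (simp add: as_gen_def True theta_sgn_bracket)
  next
    case False
    then have "tree_val ?t = (0 :: 'k ncpoly)" by (intro tree_val_nonbinary) (simp del: upt_Suc)
    then show ?thesis using False by (simp add: as_gen_def theta_linear)
  qed
  finally show "mc LLinf_to_LAs n = (as_gen n :: 'k ncpoly)" .
qed (simp add: mc_def)

section \<open>The embedding\<close>

abbreviation embed :: "'a::zero \<Rightarrow> nat \<Rightarrow> 'a" where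
  "embed v \<equiv> (\<lambda>r. if r = 0 then v else 0)"

lemma LAs_act_zero [simp]: "act LAs n d \<sigma> 0 = 0"
  by (simp add: LAs_simps)

lemma Sh_0_0: "Sh 0 0 = {id}"
  by (auto simp: Sh_def strict_mono_on_def)

lemma list_perm_upt: "list_perm [1..<k] = id"
  by (rule ext) (auto simp: list_perm_def)

lemma LAs_act_id: "act LAs n d id v = v"
  by (simp add: LAs_simps perm_parity_def evenperm_id)

lemma Tw_ins_0:
  assumes "i \<in> {1..n}"
  shows "Tw_ins LAs n d m e i f g 0 = ins LAs n d m e i (f 0) (g 0)"
proof -
  have "[1..<i] @ [i..<n + m] = [1..<n + m]" using assms upt_split[of 1 i "n + m"] by simp
  then show ?thesis
    unfolding Tw_ins_def using list_perm_upt[of "n + m"] LAs_act_id by (simp add: Sh_0_0)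
qed

lemma Tw_ins_embed:
  assumes "i \<in> {1..n}"
  shows "Tw_ins LAs n d m e i (embed v) (embed w) = embed (ins LAs n d m e i v w)"
proof
  fix r show "Tw_ins LAs n d m e i (embed v) (embed w) r = embed (ins LAs n d m e i v w) r"
  proof (cases r)
    case 0
    then show ?thesis using Tw_ins_0[OF assms, of d m e "embed v" "embed w"] by simp
  next
    case (Suc r')
    then show ?thesis unfolding Tw_ins_def by (auto intro!: sum.neutral)
  qed
qed

lemma Tw_simps:
  "carr (Tw P \<phi>) n d = {f. \<forall>r. f r \<in> carr P (r + n) (d - 2 * int r) \<and>
              (\<forall>\<sigma>. \<sigma> permutes {1..r} \<longrightarrow> act P (r + n) (d - 2 * int r) \<sigma> (f r) = f r)}"
  "scl (Tw P \<phi>) = (\<lambda>c f r. scl P c (f r))"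
  "ins (Tw P \<phi>) = Tw_ins P"
  "act (Tw P \<phi>) n d \<sigma> f = (\<lambda>r. act P (r + n) (d - 2 * int r)
              (\<lambda>j. if j \<le> r then j else r + \<sigma> (j - r)) (f r))"
  "dif (Tw P \<phi>) = Tw_dif P \<phi>"
  "unt (Tw P \<phi>) = embed (unt P)"
  by (simp_all add: Tw_def)

lemma Tw_act_embed:
  assumes "\<sigma> permutes {1..n}"
  shows "act (Tw LAs \<phi>) n d \<sigma> (embed v) = embed (act LAs n d \<sigma> v)"
proof
  have "\<sigma> 0 = 0" using assms by (auto simp: permutes_def)
  then have "(\<lambda>j. if j \<le> 0 then j else 0 + \<sigma> (j - 0)) = \<sigma>" by auto
  then show "act (Tw LAs \<phi>) n d \<sigma> (embed v) r = embed (act LAs n d \<sigma> v) r" for r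
    by (cases r) (simp_all add: Tw_simps)
qed

lemma sum_fun_apply: "(\<Sum>a\<in>A. f a) r = (\<Sum>a\<in>A. f a r)"
  by (induction A rule: infinite_finite_induct) auto

text \<open>The generators satisfy $\beta(\lambda_n)=(\varphi_n,0,0,\dots)$ because $\varphi_{r+n}=0$ for $r>0$ and $n\ge2$, and the
  embedding is compatible with insertions and the action; this propagates to all trees.\<close>

lemma Tw_beta_embed:
  assumes "x \<in> carr LLinf n d"
  shows "Tw_beta LAs LLinf_to_LAs n d x = (embed (LLinf_to_LAs n d x) :: nat \<Rightarrow> 'k::field ncpoly)"
proof -
  have k: "supp (hrep (ltrees n d) x) \<subseteq> ltrees n d"
    using hrep(1)[of x "ltrees n d"] assms by (simp add: LLinf_carr)
  let ?\<phi> = "LLinf_to_LAs :: ((ltree, 'k) pres, 'k ncpoly) gmap"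
  let ?g = "\<lambda>n r. mc ?\<phi> (r + n)"
  have p: "planar (Tw LAs ?\<phi>) ?g t = embed (planar LAs as_gen t)" if "stable t" for t
  proof (rule planar_related[where R = "\<lambda>n x y. y = embed x", OF _ _ _ that])
    show "ins (Tw LAs ?\<phi>) n d m e i u' w' = embed (ins LAs n d m e i u w)"
      if "u' = embed u" "w' = embed w" "i \<in> {1..n}" for n d m e i u u' w w'
      unfolding that(1,2) Tw_simps by (rule Tw_ins_embed[OF that(3)])
    show "?g n = embed (as_gen n)" if "2 \<le> n" for n
      using that by (auto simp: mc_LLinf_to_LAs as_gen_def)
  qed (simp add: Tw_simps)
  have a: "act (Tw LAs ?\<phi>) n d (list_perm (leaves t)) (planar (Tw LAs ?\<phi>) ?g t)
      = embed (act LAs n d (list_perm (leaves t)) (planar LAs as_gen t))"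
    if "t \<in> ltrees n d" for t
  proof -
    have t: "stable t" "leaves t \<in> as_words n" using that by (auto simp: ltrees_leaves)
    then have "list_perm (leaves t) permutes {1..n}" by (intro list_perm_permutes) (auto simp: as_words_iff)
    from Tw_act_embed[OF this] show ?thesis unfolding p[OF t(1)] .
  qed
  show ?thesis
  proof
    fix r
    have "Tw_beta LAs ?\<phi> n d x r = (\<Sum>t\<in>supp (hrep (ltrees n d) x).
        pscale (coeff (hrep (ltrees n d) x) t)
          (act (Tw LAs ?\<phi>) n d (list_perm (leaves t)) (planar (Tw LAs ?\<phi>) ?g t) r))"
      by (simp only: Tw_beta_def free_map_def lin_def sum_fun_apply Tw_simps(2) LAs_simps(2))
    also have "\<dots> = (\<Sum>t\<in>supp (hrep (ltrees n d) x).
        pscale (coeff (hrep (ltrees n d) x) t)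
          (embed (act LAs n d (list_perm (leaves t)) (planar LAs as_gen t)) r))"
    proof (rule sum.cong[OF refl])
      fix t assume "t \<in> supp (hrep (ltrees n d) x)"
      then have "t \<in> ltrees n d" using k by blast
      from a[OF this] show "pscale (coeff (hrep (ltrees n d) x) t)
          (act (Tw LAs ?\<phi>) n d (list_perm (leaves t)) (planar (Tw LAs ?\<phi>) ?g t) r)
        = pscale (coeff (hrep (ltrees n d) x) t)
          (embed (act LAs n d (list_perm (leaves t)) (planar LAs as_gen t)) r)" by (simp only:)
    qed
    also have "\<dots> = embed (LLinf_to_LAs n d x) r"
      by (simp add: LLinf_to_LAs_free_map[OF assms] free_map_def lin_def LAs_simps(2))
    finally show "Tw_beta LAs ?\<phi> n d x r = embed (LLinf_to_LAs n d x) r" .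
  qed
qed

section \<open>Sums over shuffles\<close>

lemma finite_Sh: "finite (Sh p q)"
  by (rule finite_subset[OF _ finite_permutations[of "{1..p + q}"]]) (auto simp: Sh_def)

lemma Sh_unique:
  assumes "\<sigma> \<in> Sh p q" "\<tau> \<in> Sh p q" "\<sigma> ` {1..p} = \<tau> ` {1..p}"
  shows "\<sigma> = \<tau>"
proof -
  have blocks: "\<rho> ` {p + 1..p + q} = {1..p + q} - \<rho> ` {1..p}" if "\<rho> \<in> Sh p q" for \<rho>
  proof -
    have \<rho>: "\<rho> permutes {1..p + q}" using that by (simp add: Sh_def)
    have "\<rho> ` {p + 1..p + q} = \<rho> ` ({1..p + q} - {1..p})" by (intro arg_cong[where f = "image \<rho>"]) auto
    also have "\<dots> = \<rho> ` {1..p + q} - \<rho> ` {1..p}" by (rule image_set_diff[OF permutes_inj[OF \<rho>]])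
    finally show ?thesis using permutes_image[OF \<rho>] by simp
  qed
  have mono: "\<sigma> j = \<tau> j" if s: "strict_mono_on {a..b} \<sigma>" "strict_mono_on {a..b} \<tau>"
    and im: "\<sigma> ` {a..b} = \<tau> ` {a..b}" and j: "j \<in> {a..b}" for a b j :: nat
  proof -
    have "sorted (map \<rho> [a..<Suc b]) \<and> distinct (map \<rho> [a..<Suc b])" if "strict_mono_on {a..b} \<rho>" for \<rho> :: "nat \<Rightarrow> nat"
    proof
      show "sorted (map \<rho> [a..<Suc b])"
        unfolding sorted_iff_nth_mono by (auto intro!: strict_mono_on_leD[OF that] simp del: upt_Suc)
      show "distinct (map \<rho> [a..<Suc b])"
        using strict_mono_on_imp_inj_on[OF that]
        by (simp add: distinct_map atLeastLessThanSuc_atLeastAtMost del: upt_Suc)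
    qed
    with s have "map \<sigma> [a..<Suc b] = map \<tau> [a..<Suc b]"
      using im by (intro sorted_distinct_set_unique) (auto simp: atLeastLessThanSuc_atLeastAtMost simp del: upt_Suc)
    then show ?thesis using j by (auto simp: atLeastLessThanSuc_atLeastAtMost simp del: upt_Suc)
  qed
  show ?thesis
  proof
    fix j consider "j \<in> {1..p}" | "j \<in> {p + 1..p + q}" | "j \<notin> {1..p + q}" by fastforce
    then show "\<sigma> j = \<tau> j"
    proof cases
      case 1
      show ?thesis by (rule mono[OF _ _ assms(3) 1]) (use assms in \<open>auto simp: Sh_def\<close>)
    next
      case 2
      show ?thesis by (rule mono[OF _ _ _ 2]) (use assms blocks[of \<sigma>] blocks[of \<tau>] in \<open>auto simp: Sh_def\<close>)
    next
      case 3
      then show ?thesis using assms(1,2) unfolding Sh_def permutes_def by auto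
    qed
  qed
qed

lemma Sh_exists:
  assumes "A \<subseteq> {1..p + q}" "card A = p"
  obtains \<sigma> where "\<sigma> \<in> Sh p q" "\<sigma> ` {1..p} = A"
proof -
  let ?B = "{1..p + q} - A"
  have fin: "finite A" using assms(1) finite_subset by blast
  then have cB: "card ?B = q" using assms by (simp add: card_Diff_subset)
  let ?a = "sorted_list_of_set A" and ?b = "sorted_list_of_set ?B"
  let ?\<sigma> = "list_perm (?a @ ?b)"
  have len: "length ?a = p" "length ?b = q" using assms(2) cB by simp_all
  have perm: "?\<sigma> permutes {1..p + q}"
    by (rule list_perm_permutes) (use fin assms(1) in auto)
  have 1: "?\<sigma> j = ?a ! (j - 1)" if "j \<in> {1..p}" for j
    using that len by (auto simp: list_perm_def nth_append)
  have 2: "?\<sigma> j = ?b ! (j - p - 1)" if "j \<in> {p + 1..p + q}" for j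
    using that len by (auto simp: list_perm_def nth_append)
  have "strict_mono_on {1..p} ?\<sigma>"
    using 1 len sorted_wrt_nth_less[OF strict_sorted_list_of_set[of A]] by (intro strict_mono_onI) auto
  moreover have "strict_mono_on {p + 1..p + q} ?\<sigma>"
    using 2 len sorted_wrt_nth_less[OF strict_sorted_list_of_set[of ?B]] by (intro strict_mono_onI) auto
  moreover have "?\<sigma> ` {1..p} = A"
  proof -
    have "?\<sigma> ` {1..p} = (\<lambda>j. ?a ! (j - 1)) ` {1..p}" using 1 by (intro image_cong) auto
    also have "\<dots> = (\<lambda>j. ?a ! j) ` {..<p}"
    proof -
      have "{..<p} = (\<lambda>j. j - 1) ` {1..p}" by (force intro: image_eqI[of _ _ "Suc _"])
      then show ?thesis by (simp add: image_image)
    qed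
    also have "\<dots> = set ?a" using len by (auto simp: in_set_conv_nth)
    finally show ?thesis using fin by simp
  qed
  ultimately show thesis using that perm by (auto simp: Sh_def)
qed

text \<open>A shuffle is determined by the set of letters in its first block, and every set of the right size
  occurs.\<close>

lemma sum_Sh_first_block:
  "(\<Sum>\<sigma>\<in>Sh p q. if \<sigma> ` {1..p} = A then x else 0) = (if A \<subseteq> {1..p + q} \<and> card A = p then x else 0)"
proof (cases "A \<subseteq> {1..p + q} \<and> card A = p")
  case True
  then obtain \<sigma> where \<sigma>: "\<sigma> \<in> Sh p q" "\<sigma> ` {1..p} = A" using Sh_exists by blast
  have "\<tau> ` {1..p} = A \<longleftrightarrow> \<tau> = \<sigma>" if "\<tau> \<in> Sh p q" for \<tau>
    using Sh_unique[OF that \<sigma>(1)] \<sigma>(2) by blast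
  then have "(\<Sum>\<tau>\<in>Sh p q. if \<tau> ` {1..p} = A then x else 0) = (\<Sum>\<tau>\<in>Sh p q. if \<tau> = \<sigma> then x else 0)"
    by (intro sum.cong if_cong refl)
  then show ?thesis using \<sigma> True by (simp add: finite_Sh)
next
  case False
  have "\<sigma> ` {1..p} \<noteq> A" if "\<sigma> \<in> Sh p q" for \<sigma>
  proof
    assume A: "\<sigma> ` {1..p} = A"
    have \<sigma>: "\<sigma> permutes {1..p + q}" using that by (simp add: Sh_def)
    then have "A \<subseteq> {1..p + q}" using A permutes_image[OF \<sigma>] by fastforce
    moreover have "card A = p" unfolding A[symmetric] using permutes_inj_on[OF \<sigma>] by (subst card_image) auto
    ultimately show False using False by blast
  qed
  then have "(\<Sum>\<tau>\<in>Sh p q. if \<tau> ` {1..p} = A then x else 0) = 0" by (intro sum.neutral) auto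
  then show ?thesis unfolding if_not_P[OF False] .
qed

lemma sum_Sh_1: "(\<Sum>\<sigma>\<in>Sh 1 r. if \<sigma> 1 = a then x else 0) = (if a \<in> {1..Suc r} then x else 0)"
  using sum_Sh_first_block[where p = 1 and q = r and A = "{a}" and x = x] by simp

lemma sum_Sh_2:
  assumes "r \<ge> 1" "a \<noteq> b"
  shows "(\<Sum>\<sigma>\<in>Sh 2 (r - 1). if a = \<sigma> 1 \<and> b = \<sigma> 2 \<or> a = \<sigma> 2 \<and> b = \<sigma> 1 then x else 0)
    = (if a \<in> {1..Suc r} \<and> b \<in> {1..Suc r} then x else 0)"
proof -
  have 12: "{1..2} = {1, 2 :: nat}" by auto
  have "(\<Sum>\<sigma>\<in>Sh 2 (r - 1). if a = \<sigma> 1 \<and> b = \<sigma> 2 \<or> a = \<sigma> 2 \<and> b = \<sigma> 1 then x else 0)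
    = (\<Sum>\<sigma>\<in>Sh 2 (r - 1). if \<sigma> ` {1..2} = {a, b} then x else 0)"
    unfolding 12 by (intro sum.cong refl if_cong) (auto simp: doubleton_eq_iff)
  also have "\<dots> = (if a \<in> {1..Suc r} \<and> b \<in> {1..Suc r} then x else 0)"
    unfolding sum_Sh_first_block using assms by auto
  finally show ?thesis .
qed

lemma sum_Sh_last: "(\<Sum>\<sigma>\<in>Sh r 1. if \<sigma> (Suc r) = a then x else 0) = (if a \<in> {1..Suc r} then x else 0)"
proof -
  have last: "\<sigma> ` {1..r} = {1..Suc r} - {\<sigma> (Suc r)} \<and> \<sigma> (Suc r) \<in> {1..Suc r}" if "\<sigma> \<in> Sh r 1" for \<sigma>
  proof -
    have \<sigma>: "\<sigma> permutes {1..Suc r}" using that by (simp add: Sh_def)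
    have "{1..r} = {1..Suc r} - {Suc r}" by auto
    then have "\<sigma> ` {1..r} = \<sigma> ` {1..Suc r} - {\<sigma> (Suc r)}" using image_set_diff[OF permutes_inj[OF \<sigma>]] by force
    then show ?thesis using permutes_image[OF \<sigma>] permutes_in_image[OF \<sigma>, of "Suc r"] by simp
  qed
  show ?thesis
  proof (cases "a \<in> {1..Suc r}")
    case True
    have "(\<Sum>\<sigma>\<in>Sh r 1. if \<sigma> (Suc r) = a then x else 0)
      = (\<Sum>\<sigma>\<in>Sh r 1. if \<sigma> ` {1..r} = {1..Suc r} - {a} then x else 0)"
      using last True by (intro sum.cong refl if_cong) blast
    also have "\<dots> = x" unfolding sum_Sh_first_block using True by auto
    finally show ?thesis using True by simp
  next
    case False
    then have "\<sigma> (Suc r) \<noteq> a" if "\<sigma> \<in> Sh r 1" for \<sigma> using last[OF that] by blast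
    then have "(\<Sum>\<sigma>\<in>Sh r 1. if \<sigma> (Suc r) = a then x else 0) = 0" by (intro sum.neutral) auto
    then show ?thesis unfolding if_not_P[OF False] .
  qed
qed

section \<open>Coefficients of the twisted differential\<close>

definition merge_letter :: "nat \<Rightarrow> nat \<Rightarrow> nat" where
  "merge_letter i l = (if l \<le> i then l else l - 1)"

lemma merge_letter_eq: "merge_letter i l = i \<Longrightarrow> l = i \<or> l = Suc i"
  and merge_letter_inj: "merge_letter i l = merge_letter i l' \<Longrightarrow> l \<notin> {i, Suc i} \<Longrightarrow> l' \<notin> {i, Suc i} \<Longrightarrow> l = l'"
  and shift_merge_letter: "l \<notin> {i, Suc i} \<Longrightarrow> shift_letter i 2 (merge_letter i l) = l"
  and merge_letter_shift: "l \<noteq> i \<Longrightarrow> merge_letter i (shift_letter i 2 l) = l"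
  and merge_letter_range: "l \<in> {1..Suc N} \<Longrightarrow> i \<in> {1..N} \<Longrightarrow> merge_letter i l \<in> {1..N}"
  by (auto simp: merge_letter_def shift_letter_def split: if_splits)

text \<open>Inverse to the substitution of a word on two letters for \<open>i\<close>: the adjacent letters \<open>i\<close> and \<open>i + 1\<close>
  become one letter \<open>i\<close>.\<close>

definition contract :: "nat \<Rightarrow> nat list \<Rightarrow> nat list" where
  "contract i y = map (merge_letter i) (removeAll (Suc i) y)"

lemma split_adjacent:
  assumes "Suc k < length y"
  shows "y = take k y @ y ! k # y ! Suc k # drop (Suc (Suc k)) y"
  using assms by (metis Cons_nth_drop_Suc Suc_lessD id_take_nth_drop)

lemma contract_split:
  assumes "{a, b} = {i, Suc i}" "distinct (us @ a # b # vs)"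
  shows "contract i (us @ a # b # vs)
    = map (merge_letter i) us @ i # map (merge_letter i) vs"
proof -
  have "removeAll (Suc i) us = us" "removeAll (Suc i) vs = vs" "removeAll (Suc i) [a, b] = [i]"
    using assms by (auto simp: removeAll_id doubleton_eq_iff)
  then have "removeAll (Suc i) (us @ [a, b] @ vs) = us @ [i] @ vs" by (simp only: removeAll_append)
  then show ?thesis by (simp add: contract_def merge_letter_def)
qed

lemma pair_letters:
  "{p, q} = {1, 2 :: nat} \<Longrightarrow> i \<ge> 1 \<Longrightarrow> {p + i - 1, q + i - 1} = {i, Suc i}"
  by (auto simp: doubleton_eq_iff)

lemma contract_word_subst:
  assumes "u \<in> as_words N" "i \<in> {1..N}" "{p, q} = {1, 2 :: nat}"
  shows "contract i (word_subst i 2 [p, q] u) = u"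
    "word_subst i 2 [p, q] u ! position i u = p + i - 1" "word_subst i 2 [p, q] u ! Suc (position i u) = q + i - 1"
    "position i u < N"
proof -
  obtain us vs where w: "u = us @ i # vs" "i \<notin> set us" "i \<notin> set vs" "set us \<union> set vs = {1..N} - {i}"
    "distinct us" "distinct vs" "set us \<inter> set vs = {}"
    using as_words_split[OF assms(1,2)] .
  let ?W = "map (shift_letter i 2) us @ (p + i - 1) # (q + i - 1) # map (shift_letter i 2) vs"
  have W: "word_subst i 2 [p, q] u = ?W"
    unfolding w(1) word_subst_split[OF w(2,3)] by simp
  have pos: "position i u = length us" using w by simp
  have i: "i \<ge> 1" using assms(2) by simp
  have "[p, q] \<in> as_words 2" using assms(3) by (auto simp: as_words_iff doubleton_eq_iff)
  from word_subst_as_words[OF assms(1) this assms(2)] have dist: "distinct ?W"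
    unfolding W as_words_iff by blast
  have unshift: "map (merge_letter i) (map (shift_letter i 2) xs) = xs" if "i \<notin> set xs" for xs
    unfolding map_map by (rule map_idI) (metis comp_apply merge_letter_shift that)
  have "contract i ?W = us @ i # vs"
    unfolding contract_split[OF pair_letters[OF assms(3) i] dist] unshift[OF w(2)] unshift[OF w(3)] by (rule refl)
  then show "contract i (word_subst i 2 [p, q] u) = u" unfolding W using w(1) by simp
  show "word_subst i 2 [p, q] u ! position i u = p + i - 1" "word_subst i 2 [p, q] u ! Suc (position i u) = q + i - 1"
    unfolding W pos by (simp_all add: nth_append)
  show "position i u < N" unfolding pos using length_as_words[OF assms(1)] w(1) by simp
qed

lemma word_subst_contract:
  assumes "y \<in> as_words (Suc N)" "k < N" "y ! k = p + i - 1" "y ! Suc k = q + i - 1" "i \<in> {1..N}"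
    "{p, q} = {1, 2 :: nat}"
  shows "contract i y \<in> as_words N" "word_subst i 2 [p, q] (contract i y) = y" "position i (contract i y) = k"
proof -
  have i: "i \<ge> 1" using assms(5) by simp
  let ?a = "p + i - 1" and ?b = "q + i - 1" and ?us = "take k y" and ?vs = "drop (Suc (Suc k)) y"
  let ?c = "merge_letter i"
  note ab = pair_letters[OF assms(6) i]
  have len: "length y = Suc N" using length_as_words assms(1) by blast
  then have y: "y = ?us @ ?a # ?b # ?vs" using split_adjacent[of k y] assms(2,3,4) by simp
  have dist: "distinct (?us @ ?a # ?b # ?vs)" and set: "set (?us @ ?a # ?b # ?vs) = {1..Suc N}"
    using assms(1) y unfolding as_words_iff by metis+
  have letters: "l \<noteq> i \<and> l \<noteq> Suc i \<and> 1 \<le> l \<and> l \<le> Suc N" if "l \<in> set ?us \<union> set ?vs" for l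
  proof -
    have "l \<notin> {?a, ?b}" using that dist by auto
    moreover have "l \<in> {1..Suc N}" using that set by auto
    ultimately show ?thesis unfolding ab by auto
  qed
  have c: "contract i y = map ?c ?us @ i # map ?c ?vs"
    using contract_split[OF ab dist] y by simp
  have notin: "i \<notin> set (map ?c ?us)" "i \<notin> set (map ?c ?vs)" using letters merge_letter_eq[of i] by force+
  then show "position i (contract i y) = k" unfolding c using len assms(2) by simp
  have unshift: "map (shift_letter i 2) (map ?c xs) = xs" if "set xs \<subseteq> set ?us \<union> set ?vs" for xs
    unfolding map_map
  proof (rule map_idI)
    fix l assume "l \<in> set xs"
    then have "l \<noteq> i" "l \<noteq> Suc i" using letters that by blast+
    then show "(shift_letter i 2 \<circ> ?c) l = l" by (simp add: shift_merge_letter)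
  qed
  show "word_subst i 2 [p, q] (contract i y) = y"
    unfolding c word_subst_split[OF notin] using unshift[of ?us] unshift[of ?vs] y by simp
  have inj: "inj_on ?c (set ?us \<union> set ?vs)"
  proof (rule inj_onI)
    fix l l' assume "l \<in> set ?us \<union> set ?vs" "l' \<in> set ?us \<union> set ?vs" "?c l = ?c l'"
    then show "l = l'" using letters[of l] letters[of l'] merge_letter_inj[of i l l'] by simp
  qed
  have d1: "distinct (contract i y)"
  proof -
    have "distinct (map ?c ?us)" "distinct (map ?c ?vs)"
      unfolding distinct_map using dist inj by (auto intro: inj_on_subset)
    moreover have "?c ` set ?us \<inter> ?c ` set ?vs = ?c ` (set ?us \<inter> set ?vs)"
      using inj by (intro inj_on_image_Int[symmetric]) auto
    then have "set (map ?c ?us) \<inter> set (map ?c ?vs) = {}" using dist by auto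
    ultimately show ?thesis unfolding c using notin by auto
  qed
  have "set (contract i y) \<subseteq> {1..N}"
  proof
    fix x assume "x \<in> set (contract i y)"
    then have "x = i \<or> (\<exists>l\<in>set ?us \<union> set ?vs. x = ?c l)" unfolding c by auto
    then show "x \<in> {1..N}" using letters merge_letter_range[of _ N i] assms(5) by auto
  qed
  moreover have "length (contract i y) = N" unfolding c using len assms(2) by simp
  ultimately have "set (contract i y) = {1..N}"
    using distinct_card[OF d1] by (intro card_subset_eq) auto
  then show "contract i y \<in> as_words N" using d1 assms(2) by (simp add: as_words_iff)
qed

lemma lookup_signed_ins_pair:
  assumes "supp v \<subseteq> as_words N" "y \<in> as_words (Suc N)" "i \<in> {1..N}" "{p, q} = {1, 2 :: nat}"
  shows "coeff (signed_ins i 2 v (single [p, q] 1)) y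
    = (\<Sum>k<N. if y ! k = p + i - 1 \<and> y ! Suc k = q + i - 1
        then sg (int k) (coeff v (contract i y)) else 0)"
proof -
  let ?ws = "word_subst i 2 [p, q]"
  have L: "coeff (signed_ins i 2 v (single [p, q] 1)) y
    = (\<Sum>u\<in>supp v. if ?ws u = y then sg (int (position i u)) (coeff v u) else 0)"
    unfolding signed_ins_def bilin_def free_vs.lin_single lookup_lin free_vs.scale_one
    by (intro sum.cong) (auto simp: lookup_sg lookup_single when_def sg_mult)
  show ?thesis
  proof (cases "\<exists>k<N. y ! k = p + i - 1 \<and> y ! Suc k = q + i - 1")
    case True
    then obtain k where k: "k < N" "y ! k = p + i - 1" "y ! Suc k = q + i - 1" by blast
    note ps = word_subst_contract[OF assms(2) k assms(3,4)]
    have "?ws u = y \<longleftrightarrow> u = contract i y" if "u \<in> supp v" for u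
      using contract_word_subst(1)[OF _ assms(3,4), of u] ps(2) that assms(1) by (metis subsetD)
    then have "(\<Sum>u\<in>supp v. if ?ws u = y then sg (int (position i u)) (coeff v u) else 0)
      = (\<Sum>u\<in>supp v. if u = contract i y then sg (int k) (coeff v (contract i y)) else 0)"
      using ps(3) by (intro sum.cong) auto
    also have "\<dots> = sg (int k) (coeff v (contract i y))" by (simp add: in_keys_iff)
    also have "\<dots> = (\<Sum>j<N. if j = k then sg (int k) (coeff v (contract i y)) else 0)"
      using k by simp
    also have "\<dots> = (\<Sum>k<N. if y ! k = p + i - 1 \<and> y ! Suc k = q + i - 1
        then sg (int k) (coeff v (contract i y)) else 0)"
    proof (rule sum.cong[OF refl])
      fix j assume "j \<in> {..<N}"
      then have "y ! j = y ! k \<longleftrightarrow> j = k"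
        using assms(2) k(1) length_as_words[OF assms(2)] by (auto simp: as_words_iff nth_eq_iff_index_eq)
      then show "(if j = k then sg (int k) (coeff v (contract i y)) else 0)
        = (if y ! j = p + i - 1 \<and> y ! Suc j = q + i - 1
        then sg (int j) (coeff v (contract i y)) else 0)" using k by auto
    qed
    finally show ?thesis unfolding L .
  next
    case False
    have "?ws u \<noteq> y" if "u \<in> supp v" for u
      using contract_word_subst(2-4)[OF _ assms(3,4), of u] that assms(1) False by blast
    then have "(\<Sum>u\<in>supp v. if ?ws u = y then sg (int (position i u)) (coeff v u) else 0) = 0"
      by (intro sum.neutral) auto
    moreover have "(\<Sum>k<N. if y ! k = p + i - 1 \<and> y ! Suc k = q + i - 1
        then sg (int k) (coeff v (contract i y)) else 0) = 0"
      using False by (intro sum.neutral) auto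
    ultimately show ?thesis unfolding L by simp
  qed
qed

lemma signed_ins_linear:
  "signed_ins i m x (y + z) = signed_ins i m x y + signed_ins i m x z"
  "signed_ins i m (x + x') y = signed_ins i m x y + signed_ins i m x' y"
  "signed_ins i m 0 y = 0" "signed_ins i m x 0 = 0"
  by (simp_all add: signed_ins_def bilin_left bilin_right)

lemma lookup_signed_ins_bracket:
  assumes "supp v \<subseteq> as_words N" "y \<in> as_words (Suc N)" "i \<in> {1..N}"
  shows "coeff (signed_ins i 2 v sgn_bracket) y
    = (\<Sum>k<N. if y ! k = i \<and> y ! Suc k = Suc i \<or> y ! k = Suc i \<and> y ! Suc k = i
        then sg (int k) (coeff v (contract i y)) else 0)"
proof -
  have i: "1 + i - 1 = i" "2 + i - 1 = Suc i" using assms(3) by auto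
  have s: "{1, 2} = {1, 2 :: nat}" "{2, 1} = {1, 2 :: nat}" by auto
  show ?thesis
    unfolding sgn_bracket_def signed_ins_linear lookup_add
      lookup_signed_ins_pair[OF assms s(1)] lookup_signed_ins_pair[OF assms s(2)] i sum.distrib[symmetric]
    by (intro sum.cong) auto
qed

lemma lookup_bracket_signed_ins:
  assumes "supp v \<subseteq> as_words N" "y \<in> as_words (Suc N)"
  shows "coeff (signed_ins 2 N sgn_bracket v) y
    = (if y ! 0 = 1 then sg (int N - 1) (coeff v (map (\<lambda>l. l - 1) (tl y))) else 0)
      + (if y ! N = 1 then coeff v (map (\<lambda>l. l - 1) (butlast y)) else 0)"
proof -
  have len: "length y = Suc N" and y: "distinct y" "set y = {1..Suc N}"
    using length_as_words assms(2) by (auto simp: as_words_iff)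
  have up: "1 # map Suc u = y \<longleftrightarrow> y ! 0 = 1 \<and> u = map (\<lambda>l. l - 1) (tl y)" for u
  proof -
    obtain h t where ht: "y = h # t" using len by (cases y) auto
    have "map Suc (map (\<lambda>l. l - 1) t) = t"
      unfolding map_map using y ht by (intro map_idI) auto
    then show ?thesis unfolding ht by (auto simp: o_def)
  qed
  have merge_letter: "map Suc u @ [1] = y \<longleftrightarrow> y ! N = 1 \<and> u = map (\<lambda>l. l - 1) (butlast y)" for u
  proof -
    obtain t h where ht: "y = t @ [h]" using len by (cases y rule: rev_cases) auto
    have "map Suc (map (\<lambda>l. l - 1) t) = t"
      unfolding map_map using y ht by (intro map_idI) auto
    then show ?thesis unfolding ht using len ht by (auto simp: nth_append o_def)
  qed
  have e1: "position 2 [1, 2] = 1" "word_subst 2 N u [1, 2] = 1 # map Suc u" for u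
    by (auto simp: position_def word_subst_def)
  have e2: "position 2 [2, 1] = 0" "word_subst 2 N u [2, 1] = map Suc u @ [1]" for u
    by (auto simp: position_def word_subst_def)
  have "coeff (signed_ins 2 N sgn_bracket v) y
    = (\<Sum>u\<in>supp v. coeff v u * coeff (sg (int N - 1) (single (1 # map Suc u) 1)) y)
    + (\<Sum>u\<in>supp v. coeff v u * coeff (single (map Suc u @ [1]) 1) y)"
    unfolding sgn_bracket_def signed_ins_linear lookup_add
    by (simp add: signed_ins_def bilin_def e1 e2 lookup_lin del: One_nat_def)
  also have "(\<Sum>u\<in>supp v. coeff v u * coeff (sg (int N - 1) (single (1 # map Suc u) 1)) y)
    = (\<Sum>u\<in>supp v. if u = map (\<lambda>l. l - 1) (tl y) then (if y ! 0 = 1 then sg (int N - 1) (coeff v u) else 0) else 0)"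
    unfolding lookup_sg lookup_single when_def up by (intro sum.cong) (auto simp: sg_mult)
  also have "\<dots> = (if y ! 0 = 1 then sg (int N - 1) (coeff v (map (\<lambda>l. l - 1) (tl y))) else 0)"
    by (simp add: in_keys_iff)
  also have "(\<Sum>u\<in>supp v. coeff v u * coeff (single (map Suc u @ [1]) 1) y)
    = (\<Sum>u\<in>supp v. if u = map (\<lambda>l. l - 1) (butlast y) then (if y ! N = 1 then coeff v u else 0) else 0)"
    unfolding lookup_single when_def merge_letter by (intro sum.cong) auto
  also have "\<dots> = (if y ! N = 1 then coeff v (map (\<lambda>l. l - 1) (butlast y)) else 0)"
    by (simp add: in_keys_iff)
  finally show ?thesis .
qed

lemma lookup_relabel:
  assumes "\<pi> permutes S"
  shows "coeff (relabel \<pi> x) w = coeff x (map (inv \<pi>) w)"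
proof -
  have eq: "map \<pi> b = w \<longleftrightarrow> b = map (inv \<pi>) w" for b
    using permutes_inverses[OF assms] by (auto simp: map_idI o_def)
  have "coeff (relabel \<pi> x) w
    = (\<Sum>b\<in>supp x. if b = map (inv \<pi>) w then coeff x b else 0)"
    unfolding lookup_lin lookup_single when_def eq by (intro sum.cong) auto
  then show ?thesis by (simp add: in_keys_iff)
qed

text \<open>In a pattern the symmetric letters \<open>1,\<dots>,r\<close> all become \<open>0\<close>, which plays the role of \<open>z\<close>, and the
  letter \<open>r + j\<close> becomes \<open>j\<close>, which plays the role of $x_j$.\<close>

definition pattern_letter :: "nat \<Rightarrow> nat \<Rightarrow> nat" where "pattern_letter r l = (if l \<le> r then 0 else l - r)"

abbreviation pattern :: "nat \<Rightarrow> nat list \<Rightarrow> nat list" where "pattern r \<equiv> map (pattern_letter r)"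

lemma pattern_contract:
  assumes "w \<in> as_words (Suc N)" "k < N" "{\<rho> (w ! k), \<rho> (w ! Suc k)} = {i, Suc i}" "inj \<rho>"
    and "\<And>x. x \<in> set w \<Longrightarrow> \<rho> x \<noteq> i \<Longrightarrow> \<rho> x \<noteq> Suc i
      \<Longrightarrow> pattern_letter r (merge_letter i (\<rho> x)) = pattern_letter (Suc r) x"
  shows "pattern r (contract i (map \<rho> w)) = take k (pattern (Suc r) w) @ pattern_letter r i # drop (Suc (Suc k)) (pattern (Suc r) w)"
proof -
  let ?us = "take k w" and ?vs = "drop (Suc (Suc k)) w" and ?c = "merge_letter i"
  have len: "length w = Suc N" and dist: "distinct w" using length_as_words assms(1) by (auto simp: as_words_iff)
  have w: "w = ?us @ w ! k # w ! Suc k # ?vs" using split_adjacent[of k w] len assms(2) by simp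
  with dist have dist': "distinct (?us @ w ! k # w ! Suc k # ?vs)" by metis
  from w have map: "map \<rho> w = map \<rho> ?us @ \<rho> (w ! k) # \<rho> (w ! Suc k) # map \<rho> ?vs" by (metis list.map(2) map_append)
  have d: "distinct (map \<rho> w)" using dist inj_on_subset[OF assms(4) subset_UNIV] by (simp add: distinct_map)
  have letters: "x \<in> set w \<and> \<rho> x \<noteq> i \<and> \<rho> x \<noteq> Suc i" if "x \<in> set ?us \<union> set ?vs" for x
  proof -
    have "x \<in> set w" using that in_set_takeD in_set_dropD by fast
    moreover have "x \<noteq> w ! k \<and> x \<noteq> w ! Suc k" using that dist' by auto
    then have "\<rho> x \<noteq> \<rho> (w ! k)" "\<rho> x \<noteq> \<rho> (w ! Suc k)" using injD[OF assms(4)] by blast+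
    ultimately have "x \<in> set w" "\<rho> x \<notin> {\<rho> (w ! k), \<rho> (w ! Suc k)}" by blast+
    then show ?thesis unfolding assms(3) by auto
  qed
  have *: "map (pattern_letter r) (map ?c (map \<rho> xs)) = map (pattern_letter (Suc r)) xs" if "set xs \<subseteq> set ?us \<union> set ?vs" for xs
    unfolding map_map o_def by (rule map_cong[OF refl]) (use letters that assms(5) in blast)
  show ?thesis
    unfolding map contract_split[OF assms(3) d[unfolded map]]
    using *[of ?us] *[of ?vs] by (simp add: take_map drop_map)
qed

lemma drop_nth_eq: "k < length p \<Longrightarrow> p ! k = x \<Longrightarrow> x # drop (Suc k) p = drop k p"
  by (metis Cons_nth_drop_Suc)

lemma take_nth_eq: "k < length p \<Longrightarrow> p ! k = x \<Longrightarrow> take k p @ x # q = take (Suc k) p @ q"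
  by (simp add: take_Suc_conv_app_nth)

text \<open>The bracket inserted into a symmetric input: a word occurs if \<open>\<sigma> 1\<close> and \<open>\<sigma> 2\<close> are adjacent in it,
  in either order, and it comes from a word whose pattern has one of the two adjacent zeros removed.\<close>

lemma lookup_merge_term:
  assumes v: "supp v \<subseteq> as_words (r + n)"
    and P: "\<And>u. u \<in> as_words (r + n) \<Longrightarrow> coeff v u = P (pattern r u)"
    and w: "w \<in> as_words (Suc (r + n))" and \<sigma>: "\<sigma> \<in> Sh 2 (r - 1)" and r: "r \<ge> 1"
  defines "p \<equiv> pattern (Suc r) w"
  shows "coeff (relabel \<sigma> (signed_ins 1 2 v sgn_bracket)) w
    = (\<Sum>k<r + n. if w ! k = \<sigma> 1 \<and> w ! Suc k = \<sigma> 2 \<or> w ! k = \<sigma> 2 \<and> w ! Suc k = \<sigma> 1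
        then sg (int k) (P (take k p @ drop (Suc k) p)) else 0)"
proof -
  have perm: "\<sigma> permutes {1..Suc r}" using \<sigma> r by (simp add: Sh_def)
  then have perm': "\<sigma> permutes {1..Suc (r + n)}" by (rule permutes_subset) auto
  let ?y = "map (inv \<sigma>) w"
  have y: "?y \<in> as_words (Suc (r + n))" using map_as_words[OF w permutes_inv[OF perm']] .
  have len: "length w = Suc (r + n)" using length_as_words w by blast
  have nth: "?y ! k = j \<longleftrightarrow> w ! k = \<sigma> j" if "k < Suc (r + n)" for k j
    using that len permutes_inv_eq[OF perm] by auto
  have "coeff (relabel \<sigma> (signed_ins 1 2 v sgn_bracket)) w = (\<Sum>k<r + n. if ?y ! k = 1 \<and> ?y ! Suc k = Suc 1 \<or> ?y ! k = Suc 1 \<and> ?y ! Suc k = 1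
        then sg (int k) (coeff v (contract 1 ?y)) else 0)"
    unfolding lookup_relabel[OF perm] using r by (intro lookup_signed_ins_bracket[OF v y]) auto
  also have "\<dots> = (\<Sum>k<r + n. if w ! k = \<sigma> 1 \<and> w ! Suc k = \<sigma> 2 \<or> w ! k = \<sigma> 2 \<and> w ! Suc k = \<sigma> 1
        then sg (int k) (P (take k p @ drop (Suc k) p)) else 0)"
  proof (rule sum.cong[OF refl])
    fix k assume "k \<in> {..<r + n}"
    then have k: "k < r + n" by simp
    have c: "?y ! k = 1 \<and> ?y ! Suc k = Suc 1 \<or> ?y ! k = Suc 1 \<and> ?y ! Suc k = 1
      \<longleftrightarrow> w ! k = \<sigma> 1 \<and> w ! Suc k = \<sigma> 2 \<or> w ! k = \<sigma> 2 \<and> w ! Suc k = \<sigma> 1"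
      using k nth[of k] nth[of "Suc k"] by (simp add: numeral_2_eq_2)
    have "coeff v (contract 1 ?y) = P (take k p @ drop (Suc k) p)"
      if yk: "?y ! k = 1 \<and> ?y ! Suc k = Suc 1 \<or> ?y ! k = Suc 1 \<and> ?y ! Suc k = 1"
    proof -
      have "contract 1 ?y \<in> as_words (r + n)"
        using yk word_subst_contract(1)[OF y k, of 1 1 2] word_subst_contract(1)[OF y k, of 2 1 1] r by fastforce
      moreover have "pattern r (contract 1 ?y) = take k p @ pattern_letter r 1 # drop (Suc (Suc k)) p"
        unfolding p_def
      proof (rule pattern_contract[OF w k])
        show "{inv \<sigma> (w ! k), inv \<sigma> (w ! Suc k)} = {1, Suc 1}" using yk len k by auto
        show "inj (inv \<sigma>)" using permutes_inv[OF perm] permutes_inj by blast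
        fix x assume x: "x \<in> set w" "inv \<sigma> x \<noteq> 1" "inv \<sigma> x \<noteq> Suc 1"
        show "pattern_letter r (merge_letter 1 (inv \<sigma> x)) = pattern_letter (Suc r) x"
        proof (cases "x \<le> Suc r")
          case True
          then have "inv \<sigma> x \<in> {1..Suc r}" using permutes_in_image[OF permutes_inv[OF perm], of x] x(1) w by (auto simp: as_words_iff)
          then show ?thesis using True x by (auto simp: pattern_letter_def merge_letter_def)
        next
          case False
          then have "inv \<sigma> x = x" using permutes_inv[OF perm] by (auto simp: permutes_def)
          then show ?thesis using False by (auto simp: pattern_letter_def merge_letter_def)
        qed
      qed
      moreover have "p ! Suc k = pattern_letter r 1"
      proof -
        have "w ! Suc k = \<sigma> 1 \<or> w ! Suc k = \<sigma> 2" using yk c by blast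
        moreover have "\<sigma> 1 \<in> {1..Suc r}" "\<sigma> 2 \<in> {1..Suc r}"
          unfolding permutes_in_image[OF perm] using r by auto
        ultimately have "w ! Suc k \<in> {1..Suc r}" by auto
        then show ?thesis unfolding p_def using k len r by (simp add: pattern_letter_def)
      qed
      then have "pattern_letter r 1 # drop (Suc (Suc k)) p = drop (Suc k) p"
        using k len by (intro drop_nth_eq) (auto simp: p_def)
      ultimately show ?thesis using P by simp
    qed
    then show "(if ?y ! k = 1 \<and> ?y ! Suc k = Suc 1 \<or> ?y ! k = Suc 1 \<and> ?y ! Suc k = 1
        then sg (int k) (coeff v (contract 1 ?y)) else 0)
      = (if w ! k = \<sigma> 1 \<and> w ! Suc k = \<sigma> 2 \<or> w ! k = \<sigma> 2 \<and> w ! Suc k = \<sigma> 1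
        then sg (int k) (P (take k p @ drop (Suc k) p)) else 0)"
      unfolding c[symmetric] by presburger
  qed
  finally show ?thesis .
qed

text \<open>The bracket of a symmetric letter with \<open>v\<close>: a word occurs if it begins or ends with \<open>\<sigma> 1\<close>.\<close>

lemma lookup_outer_term:
  assumes v: "supp v \<subseteq> as_words (r + n)"
    and P: "\<And>u. u \<in> as_words (r + n) \<Longrightarrow> coeff v u = P (pattern r u)"
    and w: "w \<in> as_words (Suc (r + n))" and \<sigma>: "\<sigma> \<in> Sh 1 r" and rn: "r + n \<noteq> 0"
  defines "p \<equiv> pattern (Suc r) w"
  shows "coeff (relabel \<sigma> (signed_ins 2 (r + n) sgn_bracket v)) w
    = (if w ! 0 = \<sigma> 1 then sg (int (r + n) - 1) (P (tl p)) else 0)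
      + (if w ! (r + n) = \<sigma> 1 then P (butlast p) else 0)"
proof -
  have perm: "\<sigma> permutes {1..Suc r}" using \<sigma> by (simp add: Sh_def)
  then have perm': "\<sigma> permutes {1..Suc (r + n)}" by (rule permutes_subset) auto
  let ?y = "map (inv \<sigma>) w"
  have y: "?y \<in> as_words (Suc (r + n))" using map_as_words[OF w permutes_inv[OF perm']] .
  have len: "length w = Suc (r + n)" using length_as_words w by blast
  have nth: "?y ! k = j \<longleftrightarrow> w ! k = \<sigma> j" if "k < Suc (r + n)" for k j
    using that len permutes_inv_eq[OF perm] by auto
  have letter: "pattern_letter r (inv \<sigma> x - 1) = pattern_letter (Suc r) x" if "x \<in> set w" for x
  proof (cases "x \<le> Suc r")
    case True
    then have "inv \<sigma> x \<in> {1..Suc r}" using permutes_in_image[OF permutes_inv[OF perm], of x] that w by (auto simp: as_words_iff)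
    then show ?thesis using True by (auto simp: pattern_letter_def)
  next
    case False
    then have "inv \<sigma> x = x" using permutes_inv[OF perm] by (auto simp: permutes_def)
    then show ?thesis using False by (auto simp: pattern_letter_def)
  qed
  have letters: "map (\<lambda>x. pattern_letter r (inv \<sigma> x - 1)) w = pattern (Suc r) w"
    by (rule map_cong[OF refl letter])
  have words: "map (\<lambda>l. l - 1) z \<in> as_words (r + n)"
    if "set z = {1..Suc (r + n)} - {1}" "distinct z" for z
  proof -
    have "(\<lambda>l. l - 1) ` set z = {1..r + n}"
    proof (intro equalityI subsetI)
      fix x assume "x \<in> {1..r + n}"
      then have "Suc x \<in> set z" unfolding that(1) by auto
      then show "x \<in> (\<lambda>l. l - 1) ` set z" by (intro image_eqI[of _ _ "Suc x"]) auto
    qed (auto simp: that(1))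
    moreover have "inj_on (\<lambda>l. l - 1) (set z)" unfolding that(1) by (auto simp: inj_on_def)
    ultimately show ?thesis using that(2) rn by (simp add: as_words_iff distinct_map)
  qed
  have t: "coeff v (map (\<lambda>l. l - 1) (tl ?y)) = P (tl p)" if "?y ! 0 = 1"
  proof -
    have "?y = 1 # tl ?y" using that len by (cases w) auto
    then have "set (tl ?y) = {1..Suc (r + n)} - {1}" "distinct (tl ?y)"
      using y unfolding as_words_iff by (metis distinct.simps(2) insert_Diff_single list.simps(15) Diff_insert_absorb)+
    from P[OF words[OF this]] show ?thesis
      unfolding p_def map_tl[symmetric] map_map o_def using letter
      by (simp add: map_tl letters[symmetric] o_def)
  qed
  have b: "coeff v (map (\<lambda>l. l - 1) (butlast ?y)) = P (butlast p)" if "?y ! (r + n) = 1"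
  proof -
    have "?y = butlast ?y @ [1]" using that len by (metis append_butlast_last_id diff_Suc_1 last_conv_nth length_map list.size(3) nat.distinct(1))
    then have "set (butlast ?y) \<union> {1} = {1..Suc (r + n)} \<and> distinct (butlast ?y @ [1])"
      using y unfolding as_words_iff by (metis list.set(1) list.simps(15) set_append)
    then have "set (butlast ?y) = {1..Suc (r + n)} - {1}" "distinct (butlast ?y)" by auto
    from P[OF words[OF this]] show ?thesis
      unfolding p_def map_butlast[symmetric] map_map o_def using letter
      by (simp add: map_butlast letters[symmetric] o_def)
  qed
  have "coeff (relabel \<sigma> (signed_ins 2 (r + n) sgn_bracket v)) w
     = (if ?y ! 0 = 1 then sg (int (r + n) - 1) (coeff v (map (\<lambda>l. l - 1) (tl ?y))) else 0)
      + (if ?y ! (r + n) = 1 then coeff v (map (\<lambda>l. l - 1) (butlast ?y)) else 0)"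
    unfolding lookup_relabel[OF perm] by (rule lookup_bracket_signed_ins[OF v y])
  also have "\<dots> = (if ?y ! 0 = 1 then sg (int (r + n) - 1) (P (tl p)) else 0)
      + (if ?y ! (r + n) = 1 then P (butlast p) else 0)"
    using t b by presburger
  finally show ?thesis unfolding nth[of 0, OF zero_less_Suc] nth[of "r + n", OF lessI] .
qed

text \<open>The relabelling of inputs in \<open>Tw_ins\<close> when \<open>\<kappa>\<close> is inserted into the input $x_i$: the last letter
  \<open>\<sigma> (Suc r)\<close> of the shuffle is placed in front of $x_i$.\<close>

abbreviation slot_perm :: "nat \<Rightarrow> nat \<Rightarrow> nat \<Rightarrow> (nat \<Rightarrow> nat) \<Rightarrow> nat \<Rightarrow> nat" where
  "slot_perm r n i \<sigma> \<equiv> list_perm (map \<sigma> [1..<Suc r] @ [Suc r + 1..<Suc r + i]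
      @ map \<sigma> [Suc r..<Suc (Suc r)] @ [Suc r + i..<Suc r + n + 1])"

lemma slot_perm_values:
  fixes \<sigma> :: "nat \<Rightarrow> nat" and r n i :: nat
  assumes \<sigma>: "\<sigma> \<in> Sh r 1" and i: "i \<in> {1..n}"
  defines "\<pi> \<equiv> slot_perm r n i \<sigma>"
  shows "\<pi> permutes {1..Suc (r + n)}"
    and "l \<in> {1..r} \<Longrightarrow> \<pi> l = \<sigma> l" and "r < l \<Longrightarrow> l < r + i \<Longrightarrow> \<pi> l = Suc l"
    and "\<pi> (r + i) = \<sigma> (Suc r)" and "r + i < l \<Longrightarrow> l \<le> Suc (r + n) \<Longrightarrow> \<pi> l = l"
    and "l \<in> {1..Suc r} \<Longrightarrow> \<sigma> l \<in> {1..Suc r}"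
proof -
  let ?A = "map \<sigma> [1..<Suc r]" and ?B = "[Suc r + 1..<Suc r + i]" and ?C = "map \<sigma> [Suc r..<Suc (Suc r)]"
    and ?D = "[Suc r + i..<Suc r + n + 1]"
  have perm: "\<sigma> permutes {1..Suc r}" using \<sigma> by (simp add: Sh_def)
  have len: "length ?A = r" "length ?B = i - 1" "length ?C = 1" "length ?D = n + 1 - i" using i by (simp_all del: upt_Suc)
  have "set (?A @ ?B @ ?C @ ?D) = \<sigma> ` {1..Suc r} \<union> {r + 2..Suc (r + n)}"
  proof -
    have "set [1..<Suc r] \<union> set [Suc r..<Suc (Suc r)] = {1..Suc r}" by auto
    then have "set ?A \<union> set ?C = \<sigma> ` {1..Suc r}" by (metis image_Un set_map)
    moreover have "set ?B \<union> set ?D = {r + 2..Suc (r + n)}" using i by auto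
    ultimately show ?thesis unfolding set_append by blast
  qed
  also have "\<dots> = {1..Suc (r + n)}" unfolding permutes_image[OF perm] by auto
  finally have set: "set (?A @ ?B @ ?C @ ?D) = {1..Suc (r + n)}" .
  moreover have "length (?A @ ?B @ ?C @ ?D) = Suc (r + n)" unfolding length_append len using i by auto
  ultimately have "distinct (?A @ ?B @ ?C @ ?D)" by (intro card_distinct) simp
  then show "\<pi> permutes {1..Suc (r + n)}" unfolding \<pi>_def using set by (rule list_perm_permutes)
  have L: "\<pi> l = (?A @ ?B @ ?C @ ?D) ! (l - 1)" if "1 \<le> l" "l \<le> Suc (r + n)" for l
    unfolding \<pi>_def list_perm_def using that i len by simp
  show "\<pi> l = \<sigma> l" if "l \<in> {1..r}"
    using that L[of l] by (auto simp: nth_append simp del: upt_Suc)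
  show "\<pi> l = Suc l" if "r < l" "l < r + i"
    using that L[of l] i by (auto simp: nth_append simp del: upt_Suc)
  show "\<pi> (r + i) = \<sigma> (Suc r)"
    using L[of "r + i"] i by (auto simp: nth_append)
  show "\<pi> l = l" if "r + i < l" "l \<le> Suc (r + n)"
    using that L[of l] i by (auto simp: nth_append simp del: upt_Suc)
  show "\<sigma> l \<in> {1..Suc r}" if "l \<in> {1..Suc r}" using that unfolding permutes_in_image[OF perm] .
qed

definition delete_nth :: "nat \<Rightarrow> 'a list \<Rightarrow> 'a list" where "delete_nth k p = take k p @ drop (Suc k) p"

text \<open>The bracket inserted into the input $x_i$: a word occurs if \<open>\<sigma> (Suc r)\<close> and $x_i$ are adjacent in it.
  The sign is that of the position of the symmetric letter in both cases, which produces the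
  difference.\<close>

lemma lookup_slot_term:
  assumes v: "supp v \<subseteq> as_words (r + n)"
    and P: "\<And>u. u \<in> as_words (r + n) \<Longrightarrow> coeff v u = P (pattern r u)"
    and w: "w \<in> as_words (Suc (r + n))" and \<sigma>: "\<sigma> \<in> Sh r 1" and i: "i \<in> {1..n}"
  defines "p \<equiv> pattern (Suc r) w"
    and "\<pi> \<equiv> slot_perm r n i \<sigma>"
  shows "coeff (relabel \<pi> (signed_ins (r + i) 2 v sgn_bracket)) w
    = (\<Sum>k<r + n. (if w ! k = \<sigma> (Suc r) \<and> w ! Suc k = Suc r + i then sg (int k) (P (delete_nth k p)) else 0)
        - (if w ! k = Suc r + i \<and> w ! Suc k = \<sigma> (Suc r) then sg (int (Suc k)) (P (delete_nth (Suc k) p)) else 0))"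
proof -
  note \<pi> = slot_perm_values[OF \<sigma> i, folded \<pi>_def]
  let ?y = "map (inv \<pi>) w" and ?i = "r + i"
  have y: "?y \<in> as_words (Suc (r + n))" using map_as_words[OF w permutes_inv[OF \<pi>(1)]] .
  have len: "length w = Suc (r + n)" using length_as_words w by blast
  have nth: "?y ! k = j \<longleftrightarrow> w ! k = \<pi> j" if "k < Suc (r + n)" for k j
    using that len permutes_inv_eq[OF \<pi>(1)] by auto
  have \<pi>S: "\<pi> (Suc ?i) = Suc r + i" using \<pi>(5)[of "Suc ?i"] i by simp
  have letter: "pattern_letter r (merge_letter ?i (inv \<pi> x)) = pattern_letter (Suc r) x"
    if "x \<in> set w" "inv \<pi> x \<noteq> ?i" "inv \<pi> x \<noteq> Suc ?i" for x
  proof -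
    define l where "l = inv \<pi> x"
    have x: "x = \<pi> l" unfolding l_def using permutes_inverses(1)[OF \<pi>(1)] by simp
    have "x \<in> {1..Suc (r + n)}" using that(1) w by (simp add: as_words_iff)
    then have l: "l \<in> {1..Suc (r + n)}" unfolding x permutes_in_image[OF \<pi>(1)] .
    have "l \<noteq> ?i" "l \<noteq> Suc ?i" using that(2,3) by (simp_all add: l_def)
    then have "l \<in> {1..r} \<or> (r < l \<and> l < r + i) \<or> Suc (r + i) < l" using l by auto
    then have "pattern_letter r (merge_letter ?i l) = pattern_letter (Suc r) (\<pi> l)"
    proof (elim disjE conjE)
      assume 1: "l \<in> {1..r}"
      then have "\<pi> l \<in> {1..Suc r}" using \<pi>(2)[of l] \<pi>(6)[of l] by simp
      then show ?thesis using 1 by (auto simp: pattern_letter_def merge_letter_def)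
    next
      assume 2: "r < l" "l < r + i"
      then show ?thesis using \<pi>(3)[of l] by (auto simp: pattern_letter_def merge_letter_def)
    next
      assume 3: "Suc (r + i) < l"
      then show ?thesis using \<pi>(5)[of l] l by (auto simp: pattern_letter_def merge_letter_def)
    qed
    then show ?thesis by (simp only: l_def[symmetric] x[symmetric])
  qed
  have \<sigma>r: "\<sigma> (Suc r) \<in> {1..Suc r}" using \<pi>(6)[of "Suc r"] by simp
  have pi: "pattern_letter r ?i = i" using i by (auto simp: pattern_letter_def)
  have inj: "inj (inv \<pi>)" using permutes_inv[OF \<pi>(1)] permutes_inj by blast
  have plen: "length p = Suc (r + n)" by (simp add: p_def len)
  have pk: "p ! k = pattern_letter (Suc r) (w ! k)" if "k < Suc (r + n)" for k using that len by (simp add: p_def)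
  have a: "coeff v (contract ?i ?y) = P (delete_nth k p)"
    if k: "k < r + n" and yk: "?y ! k = ?i" "?y ! Suc k = Suc ?i" for k
  proof -
    have 1: "contract ?i ?y \<in> as_words (r + n)"
      using yk i word_subst_contract(1)[OF y k, of 1 ?i 2] by auto
    have 2: "pattern r (contract ?i ?y) = take k p @ pattern_letter r ?i # drop (Suc (Suc k)) p"
      unfolding p_def
    proof (rule pattern_contract[OF w k _ inj letter])
      show "{inv \<pi> (w ! k), inv \<pi> (w ! Suc k)} = {?i, Suc ?i}" using yk len k by auto
    qed
    have "w ! Suc k = Suc r + i" using yk(2) nth[of "Suc k"] k \<pi>S by simp
    then have "p ! Suc k = pattern_letter r ?i" unfolding pi using pk[of "Suc k"] k i by (auto simp: pattern_letter_def)
    then have 3: "pattern_letter r ?i # drop (Suc (Suc k)) p = drop (Suc k) p"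
      using k plen by (intro drop_nth_eq) auto
    show ?thesis unfolding P[OF 1] 2 3 delete_nth_def ..
  qed
  have b: "coeff v (contract ?i ?y) = P (delete_nth (Suc k) p)"
    if k: "k < r + n" and yk: "?y ! k = Suc ?i" "?y ! Suc k = ?i" for k
  proof -
    have 1: "contract ?i ?y \<in> as_words (r + n)"
      using yk i word_subst_contract(1)[OF y k, of 2 ?i 1] by (auto simp: doubleton_eq_iff)
    have 2: "pattern r (contract ?i ?y) = take k p @ pattern_letter r ?i # drop (Suc (Suc k)) p"
      unfolding p_def
    proof (rule pattern_contract[OF w k _ inj letter])
      show "{inv \<pi> (w ! k), inv \<pi> (w ! Suc k)} = {?i, Suc ?i}" using yk len k by auto
    qed
    have "w ! k = Suc r + i" using yk(1) nth[of k] k \<pi>S by simp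
    then have "p ! k = pattern_letter r ?i" unfolding pi using pk[of k] k i by (auto simp: pattern_letter_def)
    then have 3: "take k p @ pattern_letter r ?i # q = take (Suc k) p @ q" for q
      using k plen by (intro take_nth_eq) auto
    show ?thesis unfolding P[OF 1] 2 3 delete_nth_def ..
  qed
  have "coeff (relabel \<pi> (signed_ins ?i 2 v sgn_bracket)) w
    = (\<Sum>k<r + n. if ?y ! k = ?i \<and> ?y ! Suc k = Suc ?i \<or> ?y ! k = Suc ?i \<and> ?y ! Suc k = ?i
        then sg (int k) (coeff v (contract ?i ?y)) else 0)"
    unfolding lookup_relabel[OF \<pi>(1)] using i by (intro lookup_signed_ins_bracket[OF v y]) auto
  also have "\<dots> = (\<Sum>k<r + n. (if w ! k = \<sigma> (Suc r) \<and> w ! Suc k = Suc r + i then sg (int k) (P (delete_nth k p)) else 0)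
        - (if w ! k = Suc r + i \<and> w ! Suc k = \<sigma> (Suc r) then sg (int (Suc k)) (P (delete_nth (Suc k) p)) else 0))"
  proof (rule sum.cong[OF refl])
    fix k assume "k \<in> {..<r + n}"
    then have k: "k < r + n" by simp
    have c: "w ! k = \<sigma> (Suc r) \<and> w ! Suc k = Suc r + i \<longleftrightarrow> ?y ! k = ?i \<and> ?y ! Suc k = Suc ?i"
      "w ! k = Suc r + i \<and> w ! Suc k = \<sigma> (Suc r) \<longleftrightarrow> ?y ! k = Suc ?i \<and> ?y ! Suc k = ?i"
      using nth[of k ?i] nth[of "Suc k" ?i] nth[of k "Suc ?i"] nth[of "Suc k" "Suc ?i"] k \<pi>(4) \<pi>S by auto
    have "sg (int (Suc k)) x = - sg (int k) x" for x :: 'a by (simp add: sg_def)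
    then show "(if ?y ! k = ?i \<and> ?y ! Suc k = Suc ?i \<or> ?y ! k = Suc ?i \<and> ?y ! Suc k = ?i
        then sg (int k) (coeff v (contract ?i ?y)) else 0)
      = (if w ! k = \<sigma> (Suc r) \<and> w ! Suc k = Suc r + i then sg (int k) (P (delete_nth k p)) else 0)
        - (if w ! k = Suc r + i \<and> w ! Suc k = \<sigma> (Suc r) then sg (int (Suc k)) (P (delete_nth (Suc k) p)) else 0)"
      unfolding c using a[OF k] b[OF k] by auto
  qed
  finally show ?thesis .
qed

text \<open>The alternating sum of the values of \<open>F\<close> at the patterns obtained from \<open>p\<close> by removing one zero of
  a pair of adjacent zeros, with the position of the pair as sign (\<open>zero_pairs_eq_sum\<close>). The recursion
  hands the first letter over to \<open>F\<close>, so that prefixes and blocks of zeros can be split off.\<close>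

fun zero_pairs :: "(nat list \<Rightarrow> 'a::ab_group_add) \<Rightarrow> nat list \<Rightarrow> 'a" where
  "zero_pairs F [] = 0"
| "zero_pairs F (x # p) = (if x = 0 \<and> p \<noteq> [] \<and> hd p = 0 then F p else 0) - zero_pairs (\<lambda>q. F (x # q)) p"

lemma zero_pairs_eq_sum:
  "length p = Suc N \<Longrightarrow>
    zero_pairs F p = (\<Sum>k<N. if p ! k = 0 \<and> p ! Suc k = 0 then sg (int k) (F (delete_nth k p)) else 0)"
proof (induction p arbitrary: F N)
  case (Cons x p)
  show ?case
  proof (cases N)
    case 0
    then show ?thesis using Cons.prems by simp
  next
    case (Suc M)
    then have p: "length p = Suc M" using Cons.prems by simp
    then have hd: "p \<noteq> []" "hd p = p ! 0" by (cases p; simp)+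
    have s: "sg (int (Suc k)) x = - sg (int k) x" for k and x :: 'a by (simp add: sg_def)
    have "(\<Sum>k<Suc M. if (x # p) ! k = 0 \<and> (x # p) ! Suc k = 0 then sg (int k) (F (delete_nth k (x # p))) else 0)
      = (if x = 0 \<and> p ! 0 = 0 then F p else 0)
        + (\<Sum>k<M. if p ! k = 0 \<and> p ! Suc k = 0 then sg (int (Suc k)) (F (x # delete_nth k p)) else 0)"
      by (subst sum.lessThan_Suc_shift) (simp add: delete_nth_def cong: if_cong)
    also have "(\<Sum>k<M. if p ! k = 0 \<and> p ! Suc k = 0 then sg (int (Suc k)) (F (x # delete_nth k p)) else 0)
      = - zero_pairs (\<lambda>q. F (x # q)) p"
      unfolding Cons.IH[OF p] sum_negf[symmetric] by (intro sum.cong refl) (simp add: sg_def)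
    finally show ?thesis using Suc hd by simp
  qed
qed simp

text \<open>Let \<open>Q k\<close> be the signed value at the pattern without its letter number \<open>k\<close>; then \<open>Q (k + 1) = - Q k\<close>
  at a pair of adjacent zeros. The commutator with \<open>z\<close>, which is \<open>B\<close>, sees the zeros at the two ends of the
  pattern, and \<open>C\<close> sees those next to some $x_i$. Up to telescoping terms these make up twice the sum over
  the pairs of adjacent zeros, and \<open>A\<close> removes one copy. This is the calculation $2z^2-z^2=z^2$.\<close>

lemma twisted_sum:
  assumes v: "supp v \<subseteq> as_words (r + n)"
    and P: "\<And>u. u \<in> as_words (r + n) \<Longrightarrow> coeff v u = P (pattern r u)"
    and w: "w \<in> as_words (Suc (r + n))" and rn: "r + n \<noteq> 0"
  defines "A \<equiv> (if r \<ge> 1 then \<Sum>\<sigma>\<in>Sh 2 (r - 1). coeff (relabel \<sigma> (signed_ins 1 2 v sgn_bracket)) w else 0)"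
    and "B \<equiv> (\<Sum>\<sigma>\<in>Sh 1 r. coeff (relabel \<sigma> (signed_ins 2 (r + n) sgn_bracket v)) w)"
    and "C \<equiv> (\<Sum>i=1..n. \<Sum>\<sigma>\<in>Sh r 1. coeff (relabel (slot_perm r n i \<sigma>)
      (signed_ins (r + i) 2 v sgn_bracket)) w)"
  shows "sg (int (r + n)) A + B + sg (int (r + n)) C = - sg (int (r + n)) (zero_pairs P (pattern (Suc r) w))"
proof -
  define p where "p = pattern (Suc r) w"
  define N where "N = r + n"
  define Q where "Q = (\<lambda>k. sg (int k) (P (delete_nth k p)))"
  have len: "length w = Suc N" using length_as_words w N_def by blast
  then have plen: "length p = Suc N" by (simp add: p_def)
  have dist: "distinct w" and set: "set w = {1..Suc N}" using w by (auto simp: as_words_iff N_def)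
  have Z: "w ! k \<in> {1..Suc r} \<longleftrightarrow> p ! k = 0" "w ! k = Suc r + i \<and> i \<in> {1..n} \<longleftrightarrow> p ! k = i \<and> i \<in> {1..n}"
    "p ! k \<le> n" if "k \<le> N" for k i
  proof -
    have "w ! k \<in> {1..Suc N}" using that len set nth_mem[of k w] by auto
    then show "w ! k \<in> {1..Suc r} \<longleftrightarrow> p ! k = 0" "w ! k = Suc r + i \<and> i \<in> {1..n} \<longleftrightarrow> p ! k = i \<and> i \<in> {1..n}" "p ! k \<le> n"
      using that len by (auto simp: p_def pattern_letter_def N_def)
  qed
  have A: "A = (\<Sum>k<N. if p ! k = 0 \<and> p ! Suc k = 0 then Q k else 0)"
  proof (cases "r \<ge> 1")
    case True
    have "A = (\<Sum>\<sigma>\<in>Sh 2 (r - 1). \<Sum>k<N. if w ! k = \<sigma> 1 \<and> w ! Suc k = \<sigma> 2 \<or> w ! k = \<sigma> 2 \<and> w ! Suc k = \<sigma> 1 then Q k else 0)"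
      unfolding A_def if_P[OF True] Q_def N_def p_def delete_nth_def
      by (rule sum.cong[OF refl]) (rule lookup_merge_term[OF v P w _ True])
    also have "\<dots> = (\<Sum>k<N. \<Sum>\<sigma>\<in>Sh 2 (r - 1). if w ! k = \<sigma> 1 \<and> w ! Suc k = \<sigma> 2 \<or> w ! k = \<sigma> 2 \<and> w ! Suc k = \<sigma> 1 then Q k else 0)"
      by (rule sum.swap)
    also have "\<dots> = (\<Sum>k<N. if p ! k = 0 \<and> p ! Suc k = 0 then Q k else 0)"
    proof (rule sum.cong[OF refl])
      fix k assume "k \<in> {..<N}"
      then have k: "k \<le> N" "Suc k \<le> N" by auto
      then have "w ! k \<noteq> w ! Suc k" using dist len by (simp add: nth_eq_iff_index_eq)
      from sum_Sh_2[OF True this, of "Q k"]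
      show "(\<Sum>\<sigma>\<in>Sh 2 (r - 1). if w ! k = \<sigma> 1 \<and> w ! Suc k = \<sigma> 2 \<or> w ! k = \<sigma> 2 \<and> w ! Suc k = \<sigma> 1 then Q k else 0)
        = (if p ! k = 0 \<and> p ! Suc k = 0 then Q k else 0)"
        unfolding Z(1)[OF k(1)] Z(1)[OF k(2)] .
    qed
    finally show ?thesis .
  next
    case False
    have "\<not> (p ! k = 0 \<and> p ! Suc k = 0)" if "k < N" for k
    proof
      assume "p ! k = 0 \<and> p ! Suc k = 0"
      then have "w ! k \<in> {1..Suc r}" "w ! Suc k \<in> {1..Suc r}" using Z(1)[of k] Z(1)[of "Suc k"] that by auto
      then have "w ! k = w ! Suc k" using False by auto
      then show False using dist len that by (simp add: nth_eq_iff_index_eq)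
    qed
    then have "(\<Sum>k<N. if p ! k = 0 \<and> p ! Suc k = 0 then Q k else 0) = 0"
      by (intro sum.neutral ballI if_not_P) auto
    then show ?thesis using False by (simp add: A_def)
  qed
  have sN: "sg (int N - 1) x = - sg (int N) x" for x :: 'a by (simp add: sg_def)
  have B: "B = - sg (int N) (if p ! 0 = 0 then Q 0 else 0) + sg (int N) (if p ! N = 0 then Q N else 0)"
  proof -
    have tl: "P (tl p) = Q 0" by (simp add: Q_def delete_nth_def drop_Suc)
    have bl: "P (butlast p) = sg (int N) (Q N)"
      using plen by (simp add: Q_def delete_nth_def butlast_conv_take sg_sg) (simp add: sg_def)
    have "B = (\<Sum>\<sigma>\<in>Sh 1 r. (if w ! 0 = \<sigma> 1 then sg (int N - 1) (P (tl p)) else 0) + (if w ! N = \<sigma> 1 then P (butlast p) else 0))"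
      unfolding B_def N_def p_def by (rule sum.cong[OF refl]) (rule lookup_outer_term[OF v P w _ rn])
    also have "\<dots> = (if w ! 0 \<in> {1..Suc r} then sg (int N - 1) (P (tl p)) else 0)
        + (if w ! N \<in> {1..Suc r} then P (butlast p) else 0)"
      unfolding sum.distrib eq_commute[of "w ! _"] sum_Sh_1 ..
    finally show ?thesis using Z(1)[of 0] Z(1)[of N] by (simp add: tl bl sN)
  qed
  have C: "C = (\<Sum>k<N. (if p ! k = 0 \<and> p ! Suc k \<noteq> 0 then Q k else 0)
      - (if p ! k \<noteq> 0 \<and> p ! Suc k = 0 then Q (Suc k) else 0))"
  proof -
    have "C = (\<Sum>i=1..n. \<Sum>\<sigma>\<in>Sh r 1. \<Sum>k<N. (if w ! k = \<sigma> (Suc r) \<and> w ! Suc k = Suc r + i then Q k else 0)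
        - (if w ! k = Suc r + i \<and> w ! Suc k = \<sigma> (Suc r) then Q (Suc k) else 0))"
      unfolding C_def Q_def N_def p_def
      by (rule sum.cong[OF refl], rule sum.cong[OF refl]) (rule lookup_slot_term[OF v P w])
    also have "\<dots> = (\<Sum>k<N. \<Sum>i=1..n. \<Sum>\<sigma>\<in>Sh r 1. (if w ! k = \<sigma> (Suc r) \<and> w ! Suc k = Suc r + i then Q k else 0)
        - (if w ! k = Suc r + i \<and> w ! Suc k = \<sigma> (Suc r) then Q (Suc k) else 0))"
      unfolding sum.swap[of _ "{..<N}" "Sh r 1"] by (rule sum.swap)
    also have "\<dots> = (\<Sum>k<N. (if p ! k = 0 \<and> p ! Suc k \<noteq> 0 then Q k else 0)
      - (if p ! k \<noteq> 0 \<and> p ! Suc k = 0 then Q (Suc k) else 0))"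
    proof (rule sum.cong[OF refl])
      fix k assume "k \<in> {..<N}"
      then have k: "k \<le> N" "Suc k \<le> N" by auto
      have 1: "(\<Sum>\<sigma>\<in>Sh r 1. if w ! k = \<sigma> (Suc r) \<and> w ! Suc k = Suc r + i then Q k else 0)
        = (if i = p ! Suc k then if p ! k = 0 then Q k else 0 else 0)" if "i \<in> {1..n}" for i
        using sum_Sh_last[of r "w ! k" "Q k"] Z(1)[OF k(1)] Z(2)[OF k(2), of i] that
        by (cases "w ! Suc k = Suc r + i") (auto simp: eq_commute[of "w ! k"])
      have 2: "(\<Sum>\<sigma>\<in>Sh r 1. if w ! k = Suc r + i \<and> w ! Suc k = \<sigma> (Suc r) then Q (Suc k) else 0)
        = (if i = p ! k then if p ! Suc k = 0 then Q (Suc k) else 0 else 0)" if "i \<in> {1..n}" for i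
        using sum_Sh_last[of r "w ! Suc k" "Q (Suc k)"] Z(1)[OF k(2)] Z(2)[OF k(1), of i] that
        by (cases "w ! k = Suc r + i") (auto simp: eq_commute[of "w ! Suc k"])
      have "(\<Sum>i=1..n. \<Sum>\<sigma>\<in>Sh r 1. (if w ! k = \<sigma> (Suc r) \<and> w ! Suc k = Suc r + i then Q k else 0)
          - (if w ! k = Suc r + i \<and> w ! Suc k = \<sigma> (Suc r) then Q (Suc k) else 0))
        = (\<Sum>i=1..n. (if i = p ! Suc k then if p ! k = 0 then Q k else 0 else 0)
          - (if i = p ! k then if p ! Suc k = 0 then Q (Suc k) else 0 else 0))"
        unfolding sum_subtractf[of _ _ "Sh r 1"] by (rule sum.cong[OF refl]) (simp only: 1 2)
      also have "\<dots> = (if p ! Suc k \<in> {1..n} then if p ! k = 0 then Q k else 0 else 0)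
          - (if p ! k \<in> {1..n} then if p ! Suc k = 0 then Q (Suc k) else 0 else 0)"
        unfolding sum_subtractf by simp
      also have "\<dots> = (if p ! k = 0 \<and> p ! Suc k \<noteq> 0 then Q k else 0)
        - (if p ! k \<noteq> 0 \<and> p ! Suc k = 0 then Q (Suc k) else 0)"
        using Z(3)[OF k(1)] Z(3)[OF k(2)] by auto
      finally show "(\<Sum>i=1..n. \<Sum>\<sigma>\<in>Sh r 1. (if w ! k = \<sigma> (Suc r) \<and> w ! Suc k = Suc r + i then Q k else 0)
          - (if w ! k = Suc r + i \<and> w ! Suc k = \<sigma> (Suc r) then Q (Suc k) else 0))
        = (if p ! k = 0 \<and> p ! Suc k \<noteq> 0 then Q k else 0)
        - (if p ! k \<noteq> 0 \<and> p ! Suc k = 0 then Q (Suc k) else 0)" .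
    qed
    finally show ?thesis .
  qed
  define z where "z = (\<lambda>k. if p ! k = 0 then Q k else 0)"
  \<comment> \<open>Removing either one of two adjacent zeros gives the same pattern; only the sign differs.\<close>
  have adj: "Q (Suc k) = - Q k" if "k < N" "p ! k = 0" "p ! Suc k = 0" for k
  proof -
    have "take (Suc k) p @ drop (Suc (Suc k)) p = take k p @ p ! k # drop (Suc (Suc k)) p"
      using that plen by (simp add: take_Suc_conv_app_nth)
    also have "p ! k # drop (Suc (Suc k)) p = drop (Suc k) p" using that plen by (intro drop_nth_eq) auto
    finally show ?thesis by (simp add: Q_def delete_nth_def sg_def)
  qed
  \<comment> \<open>A pair of adjacent zeros contributes \<open>z k - z (k + 1) = 2 Q k\<close> to the telescoping sum but nothing to
    \<open>C\<close>; the two subtracted terms make up for this.\<close>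
  have "C = (\<Sum>k<N. (z k - z (Suc k)) - (if p ! k = 0 \<and> p ! Suc k = 0 then Q k else 0)
      - (if p ! k = 0 \<and> p ! Suc k = 0 then Q k else 0))"
    unfolding C by (rule sum.cong[OF refl]) (use adj in \<open>auto simp: z_def\<close>)
  also have "\<dots> = z 0 - z N - A - A"
    unfolding sum_subtractf A using sum_lessThan_telescope'[of z N] by (simp add: sum_subtractf)
  finally have C': "C = z 0 - z N - A - A" .
  have "zero_pairs P p = A" unfolding A Q_def by (rule zero_pairs_eq_sum[OF plen])
  then show ?thesis
    unfolding p_def[symmetric] N_def[symmetric] B C' z_def[symmetric]
    by (simp add: sg_diff) (simp add: sg_def z_def)
qed

section \<open>The twisted differential\<close>

abbreviation TwLAs :: "('k::field, nat \<Rightarrow> 'k ncpoly) dgop" where "TwLAs \<equiv> Tw LAs LLinf_to_LAs"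

abbreviation Tw_d :: "nat \<Rightarrow> int \<Rightarrow> (nat \<Rightarrow> 'k::field ncpoly) \<Rightarrow> nat \<Rightarrow> 'k ncpoly" where
  "Tw_d \<equiv> Tw_dif LAs LLinf_to_LAs"

lemma mc_eq: "mc LLinf_to_LAs k = (as_gen k :: 'k::field ncpoly)"
  using mc_LLinf_to_LAs[of k] mc_LLinf_to_LAs_small[of k] by (cases "2 \<le> k") (auto simp: as_gen_def)

lemma sum_single:
  assumes "finite A" "\<And>x. x \<in> A \<Longrightarrow> x \<noteq> a \<Longrightarrow> g x = 0"
  shows "sum g A = (if a \<in> A then g a else 0)"
proof -
  have "sum g A = (\<Sum>x\<in>A. if x = a then g a else 0)" using assms(2) by (intro sum.cong) auto
  then show ?thesis using assms(1) by simp
qed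

lemma Tw_dif_0: "Tw_d n d f 0 = (0 :: 'k::field ncpoly)"
  by (simp add: Tw_dif_def Let_def LAs_simps(5) Tw_ins_def mc_eq as_gen_def)

text \<open>The three parts of the twisted differential of a component \<open>v\<close>, according to the place of the
  bracket: in a symmetric input of \<open>v\<close>, outside of \<open>v\<close>, or in the input $x_i$ of \<open>v\<close>.\<close>

definition merge_sum :: "nat \<Rightarrow> int \<Rightarrow> nat \<Rightarrow> 'k::field ncpoly \<Rightarrow> 'k ncpoly" where
  "merge_sum n d r v = (if r \<ge> 1 then \<Sum>\<sigma>\<in>Sh 2 (r - 1). act LAs (Suc r + n) (d + 1 - 2 * int (Suc r)) \<sigma>
        (ins LAs (r + n) (d - 2 * int r) 2 (- 1) 1 v as_bracket) else 0)"

definition outer_sum :: "nat \<Rightarrow> int \<Rightarrow> nat \<Rightarrow> 'k::field ncpoly \<Rightarrow> 'k ncpoly" where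
  "outer_sum n d r v = (\<Sum>\<sigma>\<in>Sh 1 r. act LAs (Suc r + n) (d + 1 - 2 * int (Suc r)) (list_perm (map \<sigma> [1..<Suc (Suc r)] @ [Suc r + 1..<Suc r + 1 + n]))
        (ins LAs 2 (- 1) (r + n) (d - 2 * int r) 2 as_bracket v))"

definition slot_sum :: "nat \<Rightarrow> int \<Rightarrow> nat \<Rightarrow> nat \<Rightarrow> 'k::field ncpoly \<Rightarrow> 'k ncpoly" where
  "slot_sum n d r i v = (\<Sum>\<sigma>\<in>Sh r 1. act LAs (Suc r + n) (d + 1 - 2 * int (Suc r))
        (slot_perm r n i \<sigma>)
        (ins LAs (r + n) (d - 2 * int r) 2 (- 1) (r + i) v as_bracket))"

text \<open>The values of $\varphi$ are zero except in arity 2, so that in each of the sums over \<open>p\<close> in the definition of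
  the differential at most one summand is left: \<open>p = 2\<close> in the first sum, \<open>p = 1\<close> in the second and
  \<open>p = r\<close> in the third.\<close>

lemma Tw_dif_Suc:
  fixes f :: "nat \<Rightarrow> 'k::field ncpoly"
  shows "Tw_d n d f (Suc r) =
    - sg d (merge_sum n d r (f r))
    + outer_sum n d r (f r)
    - sg d (\<Sum>i=1..n. slot_sum n d r i (f r))"
proof -
  let ?R = "Suc r"
  have g2: "as_gen 2 = (as_bracket :: 'k ncpoly)" by (simp add: as_gen_def)
  let ?g = "\<lambda>p. \<Sum>\<sigma>\<in>Sh p (?R - p). act LAs (?R + n) (d + 1 - 2 * int ?R) \<sigma>
         (ins LAs (?R - p + 1 + n) (d - 2 * int (?R - p + 1)) p (3 - 2 * int p) 1
           (f (?R - p + 1)) (as_gen p))"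
  have T1: "sum ?g {1..?R} = merge_sum n d r (f r)"
  proof -
    have "sum ?g {1..?R} = (if 2 \<in> {1..?R} then ?g 2 else 0)"
      by (rule sum_single) (auto simp: as_gen_def)
    moreover have "?g 2 = (\<Sum>\<sigma>\<in>Sh 2 (r - 1). act LAs (Suc r + n) (d + 1 - 2 * int (Suc r)) \<sigma>
        (ins LAs (r + n) (d - 2 * int r) 2 (- 1) 1 (f r) as_bracket))" if "r \<ge> 1"
    proof -
      have e: "?R - 2 + 1 = r" "?R - 2 = r - 1" "3 - 2 * int 2 = - 1" using that by auto
      show ?thesis unfolding e(1) unfolding e(2,3) g2 ..
    qed
    ultimately show ?thesis by (simp add: merge_sum_def del: One_nat_def)
  qed
  let ?h = "\<lambda>p. \<Sum>\<sigma>\<in>Sh p (?R - p).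
     act LAs (?R + 1 + n - 1) (1 + d - 2 * int ?R)
       (list_perm (map \<sigma> [1..<Suc p] @ [?R + 1..<?R + 1] @ map \<sigma> [Suc p..<Suc ?R] @ [?R + 1..<?R + 1 + n]))
       (ins LAs (p + 1) (1 - 2 * int p) (?R - p + n) (d - 2 * int (?R - p)) (p + 1) (as_gen (p + 1)) (f (?R - p)))"
  have T2: "sum ?h {..?R} = outer_sum n d r (f r)"
  proof -
    have "sum ?h {..?R} = (if 1 \<in> {..?R} then ?h 1 else 0)"
      by (rule sum_single) (auto simp: as_gen_def)
    also have "\<dots> = ?h 1" by simp
    also have "\<dots> = outer_sum n d r (f r)"
      unfolding outer_sum_def
    proof (rule sum.cong)
      fix \<sigma>
      have e: "?R - 1 = r" "1 + 1 = (2::nat)" "1 - 2 * int 1 = - 1" "?R + 1 + n - 1 = ?R + n" "1 + d = d + 1" by auto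
      have "[1..<Suc (Suc r)] = [1..<Suc 1] @ [Suc 1..<Suc (Suc r)]" by (rule upt_split) auto
      then have l: "map \<sigma> [1..<Suc 1] @ [?R + 1..<?R + 1] @ map \<sigma> [Suc 1..<Suc ?R] @ [?R + 1..<?R + 1 + n]
        = map \<sigma> [1..<Suc (Suc r)] @ [Suc r + 1..<Suc r + 1 + n]"
        by (simp only: map_append append_assoc) simp
      show "act LAs (?R + 1 + n - 1) (1 + d - 2 * int ?R)
       (list_perm (map \<sigma> [1..<Suc 1] @ [?R + 1..<?R + 1] @ map \<sigma> [Suc 1..<Suc ?R] @ [?R + 1..<?R + 1 + n]))
       (ins LAs (1 + 1) (1 - 2 * int 1) (?R - 1 + n) (d - 2 * int (?R - 1)) (1 + 1) (as_gen (1 + 1)) (f (?R - 1)))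
       = act LAs (Suc r + n) (d + 1 - 2 * int (Suc r)) (list_perm (map \<sigma> [1..<Suc (Suc r)] @ [Suc r + 1..<Suc r + 1 + n]))
        (ins LAs 2 (- 1) (r + n) (d - 2 * int r) 2 as_bracket (f r))"
        unfolding l e g2 ..
    qed simp
    finally show ?thesis .
  qed
  let ?k = "\<lambda>i p. \<Sum>\<sigma>\<in>Sh p (?R - p).
     act LAs (?R + n + 1 - 1) (d + 1 - 2 * int ?R)
       (list_perm (map \<sigma> [1..<Suc p] @ [?R + 1..<?R + i] @ map \<sigma> [Suc p..<Suc ?R] @ [?R + i..<?R + n + 1]))
       (ins LAs (p + n) (d - 2 * int p) (?R - p + 1) (1 - 2 * int (?R - p)) (p + i) (f p) (as_gen (?R - p + 1)))"
  have T3: "sum (?k i) {..?R} = slot_sum n d r i (f r)" for i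
  proof -
    have "sum (?k i) {..?R} = (if r \<in> {..?R} then ?k i r else 0)"
      by (rule sum_single) (auto simp: as_gen_def)
    also have "\<dots> = ?k i r" by simp
    also have "\<dots> = slot_sum n d r i (f r)"
    proof -
      have e: "?R - r = 1" "1 + 1 = (2::nat)" "1 - 2 * int 1 = - 1" "?R + n + 1 - 1 = ?R + n" by auto
      show ?thesis unfolding slot_sum_def e g2 ..
    qed
    finally show ?thesis .
  qed
  show ?thesis
    unfolding Tw_dif_def Let_def Tw_ins_def mc_eq LAs_simps(5) T1 T2 T3 by simp
qed

lemma keys_sum_subset:
  "(\<And>a. a \<in> A \<Longrightarrow> supp (f a) \<subseteq> S) \<Longrightarrow> supp (\<Sum>a\<in>A. f a) \<subseteq> S"
  by (auto elim!: keys_sum_mem)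

lemma keys_add_subset:
  "supp x \<subseteq> S \<Longrightarrow> supp y \<subseteq> S \<Longrightarrow> supp (x + y) \<subseteq> S"
  using Poly_Mapping.keys_add[of x y] by auto

lemma list_perm_map_upt:
  assumes "\<sigma> permutes {1..N}" shows "list_perm (map \<sigma> [1..<Suc N]) = \<sigma>"
proof
  fix j show "list_perm (map \<sigma> [1..<Suc N]) j = \<sigma> j"
  proof (cases "j \<in> {1..N}")
    case True
    then show ?thesis by (auto simp: list_perm_def simp del: upt_Suc)
  next
    case False
    then have "\<sigma> j = j" using assms by (auto simp: permutes_def)
    then show ?thesis using False by (auto simp: list_perm_def)
  qed
qed

text \<open>The component \<open>r + 1\<close> of the twisted differential in the basis of signed words. In the degree where
  the component \<open>r\<close> can be nonzero, the sign \<open>- sg d\<close> of the differential is \<open>sg (r + n)\<close>.\<close>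

definition twisted :: "nat \<Rightarrow> nat \<Rightarrow> 'k::field ncpoly \<Rightarrow> 'k ncpoly" where
  "twisted n r v =
     sg (int (r + n)) (if r \<ge> 1 then \<Sum>\<sigma>\<in>Sh 2 (r - 1). relabel \<sigma> (signed_ins 1 2 v sgn_bracket) else 0)
     + (\<Sum>\<sigma>\<in>Sh 1 r. relabel \<sigma> (signed_ins 2 (r + n) sgn_bracket v))
     + sg (int (r + n)) (\<Sum>i=1..n. \<Sum>\<sigma>\<in>Sh r 1. relabel (slot_perm r n i \<sigma>)
      (signed_ins (r + i) 2 v sgn_bracket))"

lemma Sh_permutes_ext:
  assumes "\<sigma> \<in> Sh p q" "p + q = Suc r" shows "\<sigma> permutes {1..Suc (r + n)}"
  using assms permutes_subset[of \<sigma> "{1..Suc r}" "{1..Suc (r + n)}"] by (auto simp: Sh_def)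

lemma Tw_dif_theta:
  fixes f :: "nat \<Rightarrow> 'k::field ncpoly"
  assumes f: "f r = theta v" and v: "supp v \<subseteq> as_words (r + n)" and d: "d = 1 - int n + int r"
  shows "Tw_d n d f (Suc r) = theta (twisted n r v)"
    and "supp (twisted n r v) \<subseteq> as_words (Suc (r + n))"
proof -
  let ?b = "sgn_bracket :: 'k ncpoly"
  have d': "d - 2 * int r = 1 - int (r + n)" "- 1 = 1 - int 2" using d by auto
  have s: "- sg d x = sg (int (r + n)) x" for x :: "'k ncpoly" unfolding d by (simp add: sg_def)
  have k1: "supp (signed_ins 1 2 v ?b) \<subseteq> as_words (Suc (r + n))" if "r \<ge> 1"
    using keys_signed_ins[OF v keys_sgn_bracket, of 1] that by simp
  have k2: "supp (signed_ins 2 (r + n) ?b v) \<subseteq> as_words (Suc (r + n))"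
    using keys_signed_ins[OF keys_sgn_bracket v, of 2] by simp
  have k3: "supp (signed_ins (r + i) 2 v ?b) \<subseteq> as_words (Suc (r + n))" if "i \<in> {1..n}" for i
    using keys_signed_ins[OF v keys_sgn_bracket, of "r + i"] that by simp
  have S1: "\<sigma> permutes {1..Suc (r + n)}" if "r \<ge> 1" "\<sigma> \<in> Sh 2 (r - 1)" for \<sigma>
    using Sh_permutes_ext[OF that(2)] that(1) by simp
  have S2: "\<sigma> permutes {1..Suc (r + n)}" if "\<sigma> \<in> Sh 1 r" for \<sigma> using Sh_permutes_ext[OF that] by simp
  have e: "Suc r + n = Suc (r + n)" by simp
  have T1: "merge_sum n d r (f r)
    = theta (if r \<ge> 1 then \<Sum>\<sigma>\<in>Sh 2 (r - 1). relabel \<sigma> (signed_ins 1 2 v ?b) else 0)"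
  proof (cases "r \<ge> 1")
    case True
    have "ins LAs (r + n) (d - 2 * int r) 2 (- 1) 1 (f r) as_bracket = theta (signed_ins 1 2 v ?b)"
      unfolding d'(1) f theta_sgn_bracket[symmetric] using True by (intro LAs_ins_theta[OF v keys_sgn_bracket]) simp
    then show ?thesis unfolding merge_sum_def if_P[OF True] theta_linear(6) e
      by (intro sum.cong refl) (simp only: LAs_act_theta[OF k1[OF True] S1[OF True]])
  qed (simp add: merge_sum_def theta_linear)
  have T2: "outer_sum n d r (f r)
    = theta (\<Sum>\<sigma>\<in>Sh 1 r. relabel \<sigma> (signed_ins 2 (r + n) ?b v))"
    unfolding outer_sum_def theta_linear(6)
  proof (rule sum.cong[OF refl])
    fix \<sigma> assume \<sigma>: "\<sigma> \<in> Sh 1 r"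
    have "map \<sigma> [Suc r + 1..<Suc r + 1 + n] = [Suc r + 1..<Suc r + 1 + n]"
      using \<sigma> by (intro map_idI) (auto simp: Sh_def permutes_def)
    moreover have "[1..<Suc (Suc (r + n))] = [1..<Suc (Suc r)] @ [Suc r + 1..<Suc r + 1 + n]"
      using upt_split[of 1 "Suc (Suc r)" "Suc (Suc (r + n))"] by (simp del: upt_Suc)
    ultimately have "map \<sigma> [1..<Suc (Suc r)] @ [Suc r + 1..<Suc r + 1 + n] = map \<sigma> [1..<Suc (Suc (r + n))]"
      by (simp only: map_append)
    then have l: "list_perm (map \<sigma> [1..<Suc (Suc r)] @ [Suc r + 1..<Suc r + 1 + n]) = \<sigma>"
      using list_perm_map_upt[OF S2[OF \<sigma>]] by (simp only:)
    have i: "ins LAs 2 (- 1) (r + n) (d - 2 * int r) 2 as_bracket (f r) = theta (signed_ins 2 (r + n) ?b v)"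
      unfolding d'(2) f theta_sgn_bracket[symmetric] by (rule LAs_ins_theta[OF keys_sgn_bracket v]) simp
    show "act LAs (Suc r + n) (d + 1 - 2 * int (Suc r)) (list_perm (map \<sigma> [1..<Suc (Suc r)] @ [Suc r + 1..<Suc r + 1 + n]))
        (ins LAs 2 (- 1) (r + n) (d - 2 * int r) 2 as_bracket (f r)) = theta (relabel \<sigma> (signed_ins 2 (r + n) ?b v))"
      unfolding l i e by (rule LAs_act_theta[OF k2 S2[OF \<sigma>]])
  qed
  have T3: "(\<Sum>i=1..n. slot_sum n d r i (f r))
    = theta (\<Sum>i=1..n. \<Sum>\<sigma>\<in>Sh r 1. relabel (slot_perm r n i \<sigma>) (signed_ins (r + i) 2 v ?b))"
    unfolding slot_sum_def theta_linear(6)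
  proof (rule sum.cong[OF refl], rule sum.cong[OF refl])
    fix i \<sigma> assume i: "i \<in> {1..n}" and \<sigma>: "\<sigma> \<in> Sh r 1"
    have ii: "ins LAs (r + n) (d - 2 * int r) 2 (- 1) (r + i) (f r) as_bracket = theta (signed_ins (r + i) 2 v ?b)"
      unfolding d'(1) f theta_sgn_bracket[symmetric] using i by (intro LAs_ins_theta[OF v keys_sgn_bracket]) simp
    show "act LAs (Suc r + n) (d + 1 - 2 * int (Suc r))
        (slot_perm r n i \<sigma>)
        (ins LAs (r + n) (d - 2 * int r) 2 (- 1) (r + i) (f r) as_bracket)
      = theta (relabel (slot_perm r n i \<sigma>) (signed_ins (r + i) 2 v ?b))"
      unfolding ii
      by (rule LAs_act_theta) (use k3[OF i] slot_perm_values(1)[OF \<sigma> i] in \<open>simp_all only: add_Suc\<close>)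
  qed
  show "Tw_d n d f (Suc r) = theta (twisted n r v)"
    unfolding Tw_dif_Suc T1 T2 T3 twisted_def theta_linear(2,4) using s by (metis (no_types, lifting) diff_conv_add_uminus)
  have R: "supp (relabel \<sigma> x) \<subseteq> as_words (Suc (r + n))"
    if "supp x \<subseteq> as_words (Suc (r + n))" "\<sigma> permutes {1..Suc (r + n)}" for \<sigma> and x :: "'k ncpoly"
    using that(1) by (rule keys_relabel) (use map_as_words[OF _ that(2)] in blast)
  show "supp (twisted n r v) \<subseteq> as_words (Suc (r + n))"
    unfolding twisted_def
  proof (intro keys_add_subset)
    show "supp (sg (int (r + n)) (if r \<ge> 1 then \<Sum>\<sigma>\<in>Sh 2 (r - 1). relabel \<sigma> (signed_ins 1 2 v ?b) else 0)) \<subseteq> as_words (Suc (r + n))"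
    proof (cases "r \<ge> 1")
      case True
      then show ?thesis unfolding keys_sg if_P[OF True] using R[OF k1 S1] by (intro keys_sum_subset)
    qed simp
    show "supp (\<Sum>\<sigma>\<in>Sh 1 r. relabel \<sigma> (signed_ins 2 (r + n) ?b v)) \<subseteq> as_words (Suc (r + n))"
      using R[OF k2 S2] by (intro keys_sum_subset)
    show "supp (sg (int (r + n)) (\<Sum>i=1..n. \<Sum>\<sigma>\<in>Sh r 1. relabel (slot_perm r n i \<sigma>)
      (signed_ins (r + i) 2 v ?b))) \<subseteq> as_words (Suc (r + n))"
      unfolding keys_sg by (intro keys_sum_subset R[OF k3 slot_perm_values(1)])
  qed
qed

lemma lookup_if_sum:
  "coeff (if c then \<Sum>a\<in>A. f a else 0) w = (if c then \<Sum>a\<in>A. coeff (f a) w else 0)"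
  by (simp add: lookup_sum)

lemma lookup_twisted_nonempty:
  assumes "supp v \<subseteq> as_words (r + n)"
    and "\<And>u. u \<in> as_words (r + n) \<Longrightarrow> coeff v u = P (pattern r u)"
    and "w \<in> as_words (Suc (r + n))" "r + n \<noteq> 0"
  shows "coeff (twisted n r v) w = - sg (int (r + n)) (zero_pairs P (pattern (Suc r) w))"
  unfolding twisted_def lookup_add lookup_sg lookup_if_sum lookup_sum by (rule twisted_sum[OF assms])

lemma Tw_dif_Suc_zero: "f r = 0 \<Longrightarrow> Tw_d n d f (Suc r) = (0 :: 'k::field ncpoly)"
  unfolding Tw_dif_Suc merge_sum_def outer_sum_def slot_sum_def by simp

lemma LAs_act_add: "act LAs n d \<sigma> (x + y) = act LAs n d \<sigma> x + act LAs n d \<sigma> y"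
  by (simp add: LAs_simps free_vs.lin_add sg_add)

lemma Tw_dif_add:
  fixes f g :: "nat \<Rightarrow> 'k::field ncpoly"
  shows "Tw_d n d (f + g) = Tw_d n d f + Tw_d n d g"
proof
  fix r show "Tw_d n d (f + g) r = (Tw_d n d f + Tw_d n d g) r"
  proof (cases r)
    case 0
    then show ?thesis by (simp add: Tw_dif_0)
  next
    case (Suc k)
    show ?thesis
      unfolding Suc plus_fun_apply Tw_dif_Suc merge_sum_def outer_sum_def slot_sum_def LAs_ins_linear LAs_act_add sum.distrib
      by (simp add: sg_add del: upt_Suc)
  qed
qed

section \<open>Patterns and the contracting homotopy\<close>

lemma same_pattern_permutation:
  assumes "u \<in> as_words (r + n)" "u' \<in> as_words (r + n)" "pattern r u = pattern r u'"
  obtains \<sigma> where "\<sigma> permutes {1..r}" "map \<sigma> u = u'"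
proof -
  have len: "length u = r + n" "length u' = r + n" using assms length_as_words by blast+
  have u: "distinct u" "set u = {1..r + n}" and u': "distinct u'" "set u' = {1..r + n}"
    using assms by (auto simp: as_words_iff)
  define \<sigma> where "\<sigma> x = (if x \<in> set u then u' ! (THE k. k < r + n \<and> u ! k = x) else x)" for x
  have nth: "\<sigma> (u ! k) = u' ! k" if "k < r + n" for k
  proof -
    have "(THE j. j < r + n \<and> u ! j = u ! k) = k"
      using that u(1) len by (intro the_equality) (auto simp: nth_eq_iff_index_eq)
    then show ?thesis using that len by (simp add: \<sigma>_def)
  qed
  have pattern_letter: "pattern_letter r (u ! k) = pattern_letter r (u' ! k)" if "k < r + n" for k
    using arg_cong[OF assms(3), of "\<lambda>p. p ! k"] that len by simp
  have map: "map \<sigma> u = u'" by (rule nth_equalityI) (use len nth in auto)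
  have idx: "\<exists>k<r + n. x = u ! k" if "x \<in> set u" for x using that len by (metis in_set_conv_nth)
  have fix': "\<sigma> x = x" if "x \<notin> {1..r}" for x
  proof (cases "x \<in> set u")
    case True
    then obtain k where k: "k < r + n" "x = u ! k" using idx by blast
    have "x > r" using that True u(2) by auto
    then have "u' ! k = x" using pattern_letter[OF k(1)] k(2) by (auto simp: pattern_letter_def split: if_splits)
    then show ?thesis using nth[OF k(1)] k(2) by simp
  qed (simp add: \<sigma>_def)
  have "\<sigma> permutes {1..r}"
  proof (rule inj_imp_permutes[OF _ _ _ fix'])
    have "inj_on \<sigma> (set u)" using map u'(1) u(1) by (metis distinct_map)
    then show "inj_on \<sigma> {1..r}" by (rule inj_on_subset) (use u(2) in auto)
    fix x assume x: "x \<in> {1..r}"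
    then have "x \<in> set u" using u(2) by auto
    then obtain k where k: "k < r + n" "x = u ! k" using idx by blast
    have "u' ! k \<in> set u'" using k len by simp
    then show "\<sigma> x \<in> {1..r}" using pattern_letter[OF k(1)] k x nth[OF k(1)] u'(2) by (auto simp: pattern_letter_def split: if_splits)
  qed auto
  with map show thesis using that by blast
qed

text \<open>Words with the same pattern differ by a permutation of the symmetric letters, and the coefficients
  of an invariant element do not change under it.\<close>

lemma pattern_function:
  assumes "\<And>\<sigma>. \<sigma> permutes {1..r} \<Longrightarrow> relabel \<sigma> v = v"
  obtains P where "\<And>u. u \<in> as_words (r + n) \<Longrightarrow> coeff v u = P (pattern r u)"
proof
  fix u assume u: "u \<in> as_words (r + n)"
  define u' where "u' = (SOME u'. u' \<in> as_words (r + n) \<and> pattern r u' = pattern r u)"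
  have u': "u' \<in> as_words (r + n)" "pattern r u' = pattern r u"
    using someI[of "\<lambda>u'. u' \<in> as_words (r + n) \<and> pattern r u' = pattern r u", OF conjI[OF u refl]] by (auto simp: u'_def)
  obtain \<sigma> where \<sigma>: "\<sigma> permutes {1..r}" "map \<sigma> u' = u"
    using same_pattern_permutation[OF u'(1) u u'(2)] .
  have "coeff v u = coeff (relabel \<sigma> v) u" by (simp add: assms[OF \<sigma>(1)])
  also have "\<dots> = coeff v u'"
    unfolding lookup_relabel[OF \<sigma>(1)] \<sigma>(2)[symmetric] using permutes_inverses(2)[OF \<sigma>(1)] by (simp add: o_def)
  finally show "coeff v u = (\<lambda>p. coeff v (SOME u'. u' \<in> as_words (r + n) \<and> pattern r u' = p)) (pattern r u)"
    by (simp add: u'_def)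
qed

text \<open>The contracting homotopy on coefficient functions: the map $z^{2k}\mapsto z^{2k-1}$ on the first nonempty
  block of zeros, with the sign of passing the letters in front of the block. The coefficient of the
  image at a pattern is read off at the pattern with one more zero, whence the name.\<close>

definition insert_zero :: "(nat list \<Rightarrow> 'a::ab_group_add) \<Rightarrow> nat list \<Rightarrow> 'a" where
  "insert_zero F p = (let us = takeWhile (\<lambda>l. l \<noteq> 0) p; zs = dropWhile (\<lambda>l. l \<noteq> 0) p in
     if odd (length (takeWhile (\<lambda>l. l = 0) zs)) then sg (int (length us)) (F (us @ 0 # zs)) else 0)"

lemma insert_zero_split:
  assumes "0 \<notin> set us" "vs = [] \<or> hd vs \<noteq> 0" "L > 0"
  shows "insert_zero F (us @ replicate L 0 @ vs)
    = (if odd L then sg (int (length us)) (F (us @ replicate (Suc L) 0 @ vs)) else 0)"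
proof -
  obtain M where M: "L = Suc M" using assms(3) by (cases L) auto
  have 1: "takeWhile (\<lambda>l. l \<noteq> 0) (us @ replicate L 0 @ vs) = us"
    "dropWhile (\<lambda>l. l \<noteq> 0) (us @ replicate L 0 @ vs) = replicate L 0 @ vs"
    using assms(1) unfolding M by (auto simp: takeWhile_append dropWhile_append)
  have 2: "takeWhile (\<lambda>l. l = 0) (replicate L 0 @ vs) = replicate L 0"
    using assms(2) by (cases vs) (auto simp: takeWhile_append)
  show ?thesis unfolding insert_zero_def Let_def 1 2 by simp
qed

lemma zero_pairs_prefix: "0 \<notin> set us \<Longrightarrow> zero_pairs F (us @ p) = sg (int (length us)) (zero_pairs (\<lambda>q. F (us @ q)) p)"
  by (induction us arbitrary: F) (auto simp: sg_def)

lemma zero_pairs_block: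
  "vs = [] \<or> hd vs \<noteq> 0 \<Longrightarrow> zero_pairs F (replicate L 0 @ vs)
    = (if even L \<and> L > 0 then F (replicate (L - 1) 0 @ vs) else 0)
      + sg (int L) (zero_pairs (\<lambda>q. F (replicate L 0 @ q)) vs)"
proof (induction L arbitrary: F)
  case (Suc L)
  show ?case
  proof (cases "L = 0")
    case True
    then show ?thesis using Suc.prems by (auto simp: sg_def)
  next
    case False
    then obtain M where M: "L = Suc M" by (cases L) auto
    have "zero_pairs F (replicate (Suc L) 0 @ vs) = F (replicate L 0 @ vs) - zero_pairs (\<lambda>q. F (0 # q)) (replicate L 0 @ vs)"
      by (simp add: M)
    then show ?thesis unfolding Suc.IH[OF Suc.prems] using M by (auto simp: sg_def)
  qed
qed simp

lemma zero_pairs_zero [simp]: "zero_pairs (\<lambda>q. 0) p = 0"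
  by (induction p) auto

lemma zero_pairs_sg: "zero_pairs (\<lambda>q. sg e (F q)) p = sg e (zero_pairs F p)"
  by (induction p arbitrary: F) (auto simp: sg_diff)

lemma zero_pairs_insert_zero_tail:
  assumes "0 \<notin> set us" "vs = [] \<or> hd vs \<noteq> 0" "L > 0"
  shows "zero_pairs (\<lambda>q. insert_zero F (us @ replicate L 0 @ q)) vs
    = (if odd L then sg (int (length us)) (zero_pairs (\<lambda>q. F (us @ replicate (Suc L) 0 @ q)) vs) else 0)"
proof (cases vs)
  case (Cons x vs')
  then have x: "x \<noteq> 0" using assms(2) by simp
  have "insert_zero F (us @ replicate L 0 @ x # q)
    = (if odd L then sg (int (length us)) (F (us @ replicate (Suc L) 0 @ x # q)) else 0)" for q
    by (rule insert_zero_split[OF assms(1) _ assms(3)]) (simp add: x)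
  then show ?thesis unfolding Cons using x by (cases "odd L") (simp_all add: zero_pairs_sg sg_minus)
qed simp

text \<open>If the length \<open>L\<close> of the first block is even, a pair of adjacent zeros outside the block leaves an even
  first block and contributes zero; the \<open>L - 1\<close> pairs inside contribute one term with alternating signs,
  which is \<open>F\<close> at the pattern. If \<open>L\<close> is odd, the pairs inside contribute zero. The others are those of
  the cocycle condition at the pattern with one more zero in the first block, in which the first block
  contributes \<open>F\<close> at the original pattern.\<close>

lemma insert_zero_homotopy:
  assumes us: "0 \<notin> set us" and vs: "vs = [] \<or> hd vs \<noteq> 0" and L: "L > 0"
    and cocycle: "zero_pairs F (us @ replicate (Suc L) 0 @ vs) = 0"
  shows "zero_pairs (insert_zero F) (us @ replicate L 0 @ vs) = F (us @ replicate L 0 @ vs)"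
proof (cases "even L")
  case True
  then have "L - 1 > 0" "odd (L - 1)" "Suc (L - 1) = L" using L by (auto elim!: evenE)
  then show ?thesis
    unfolding zero_pairs_prefix[OF us] zero_pairs_block[OF vs] zero_pairs_insert_zero_tail[OF us vs L]
    using insert_zero_split[OF us vs, of "L - 1" F] True L by (simp add: sg_sg) (simp add: sg_def)
next
  case False
  have "F (us @ replicate L 0 @ vs) + zero_pairs (\<lambda>q. F (us @ replicate (Suc L) 0 @ q)) vs = 0"
    using cocycle False unfolding zero_pairs_prefix[OF us] zero_pairs_block[OF vs] by (simp add: sg_def neg_eq_iff_add_eq_0 split: if_splits)
  then have "F (us @ replicate L 0 @ vs) = - zero_pairs (\<lambda>q. F (us @ replicate (Suc L) 0 @ q)) vs"
    by (simp only: eq_neg_iff_add_eq_0)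
  then show ?thesis
    unfolding zero_pairs_prefix[OF us] zero_pairs_block[OF vs] zero_pairs_insert_zero_tail[OF us vs L]
    using False by (simp add: sg_def)
qed

lemma first_zero_block:
  assumes "0 \<in> set p"
  obtains us L vs where "p = us @ replicate L 0 @ vs" "0 \<notin> set us" "vs = [] \<or> hd vs \<noteq> (0::nat)" "L > 0"
proof -
  let ?us = "takeWhile (\<lambda>l. l \<noteq> 0) p" and ?zs = "dropWhile (\<lambda>l. l \<noteq> 0) p"
  let ?bs = "takeWhile (\<lambda>l. l = 0) ?zs" and ?vs = "dropWhile (\<lambda>l. l = 0) ?zs"
  have "?bs = replicate (length ?bs) 0"
    by (rule replicate_length_same[symmetric]) (auto dest: set_takeWhileD)
  moreover have "?zs \<noteq> []" using assms by (auto simp: dropWhile_eq_Nil_conv)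
  then have "hd ?zs = 0" using hd_dropWhile[of "\<lambda>l. l \<noteq> 0" p] by blast
  then have "length ?bs > 0" using \<open>?zs \<noteq> []\<close> by (cases ?zs) auto
  moreover have "?vs = [] \<or> hd ?vs \<noteq> 0" using hd_dropWhile[of "\<lambda>l. l = 0" ?zs] by blast
  moreover have "0 \<notin> set ?us" by (auto dest: set_takeWhileD)
  moreover have "p = ?us @ ?bs @ ?vs" by simp
  ultimately show thesis using that[of ?us "length ?bs" ?vs] by metis
qed

lemma insert_letter_as_words:
  assumes "a @ b \<in> as_words N"
  shows "map Suc a @ 1 # map Suc b \<in> as_words (Suc N)"
proof -
  have ab: "distinct (a @ b)" "set a \<union> set b = {1..N}" using assms by (auto simp: as_words_iff)
  have "set (map Suc a @ 1 # map Suc b) = insert 1 (Suc ` (set a \<union> set b))" by auto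
  also have "\<dots> = {1..Suc N}" unfolding ab(2) image_Suc_atLeastAtMost by auto
  finally have "set (map Suc a @ 1 # map Suc b) = {1..Suc N}" .
  moreover have "0 \<notin> set a" "0 \<notin> set b" using ab(2) by (metis UnCI atLeastAtMost_iff not_one_le_zero)+
  then have "distinct (map Suc a @ 1 # map Suc b)" using ab(1) by (auto simp: distinct_map)
  ultimately show ?thesis unfolding as_words_iff by blast
qed

lemma pattern_insert: "pattern (Suc r) (map Suc a @ 1 # map Suc b) = pattern r a @ 0 # pattern r b"
  by (auto simp: pattern_letter_def)

lemma keys_twisted:
  assumes "supp v \<subseteq> as_words (r + n)"
  shows "supp (twisted n r v) \<subseteq> as_words (Suc (r + n))"
  using Tw_dif_theta(2)[where f = "\<lambda>_. theta v", OF refl assms refl] .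

text \<open>For \<open>r + n = 0\<close> there are no words at all, and the pattern on the right has a single letter.\<close>

lemma lookup_twisted:
  assumes "supp v \<subseteq> as_words (r + n)"
    and "\<And>u. u \<in> as_words (r + n) \<Longrightarrow> coeff v u = P (pattern r u)"
    and "w \<in> as_words (Suc (r + n))"
  shows "coeff (twisted n r v) w = - sg (int (r + n)) (zero_pairs P (pattern (Suc r) w))"
proof (cases "r + n = 0")
  case True
  have "as_words 0 = {}" by (auto simp: as_words_def)
  then have "v = 0" using True assms(1) by simp
  then have "twisted n r v = 0" by (simp add: twisted_def signed_ins_linear cong: if_cong)
  moreover have "length (pattern (Suc r) w) = Suc 0" using length_as_words[OF assms(3)] True by simp
  from zero_pairs_eq_sum[OF this] have "zero_pairs P (pattern (Suc r) w) = 0" by simp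
  ultimately show ?thesis by simp
qed (rule lookup_twisted_nonempty[OF assms])

section \<open>Acyclicity and the homotopy fixed point\<close>

lemma Tw_zero: "(0 :: nat \<Rightarrow> 'k::field ncpoly) \<in> carr (Tw LAs \<phi>) n d"
  "Tw_d n d 0 = (0 :: nat \<Rightarrow> 'k ncpoly)"
proof -
  show "(0 :: nat \<Rightarrow> 'k ncpoly) \<in> carr (Tw LAs \<phi>) n d" by (simp add: Tw_simps)
  show "Tw_d n d 0 = (0 :: nat \<Rightarrow> 'k ncpoly)"
  proof
    fix r show "Tw_d n d 0 r = (0 :: nat \<Rightarrow> 'k ncpoly) r"
      by (cases r) (simp_all add: Tw_dif_0 Tw_dif_Suc_zero)
  qed
qed

lemma symmetric_theta:
  assumes "supp v \<subseteq> as_words (r + n)" "\<sigma> permutes {1..r}"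
  shows "act LAs (r + n) d \<sigma> (theta v) = theta v \<longleftrightarrow> relabel \<sigma> v = v"
proof -
  have "\<sigma> permutes {1..r + n}" using assms(2) by (rule permutes_subset) auto
  from LAs_act_theta[OF assms(1) this] show ?thesis by (metis theta_theta)
qed

lemma pattern_permute:
  assumes "\<sigma> permutes {1..r}" shows "pattern r (map \<sigma> w) = pattern r w"
proof -
  have "pattern_letter r (\<sigma> x) = pattern_letter r x" for x
  proof (cases "x \<in> {1..r}")
    case True
    then have "\<sigma> x \<in> {1..r}" unfolding permutes_in_image[OF assms] .
    then show ?thesis using True by (simp add: pattern_letter_def)
  next
    case False
    then show ?thesis using assms by (simp add: permutes_def)
  qed
  then show ?thesis by simp
qed

text \<open>By its degree, \<open>f\<close> has a single nonzero component, whose number \<open>q + 1\<close> is positive. The homotopy on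
  coefficient functions produces a component \<open>q\<close>, and \<open>insert_zero_homotopy\<close> says that it is a preimage.\<close>

lemma Tw_acyclic:
  fixes f :: "nat \<Rightarrow> 'k::field ncpoly"
  assumes f: "f \<in> carr (Tw LAs \<phi>) n d" and cocycle: "Tw_d n d f = 0" and "f 0 = 0"
  shows "\<exists>h\<in>carr (Tw LAs \<phi>) n (d - 1). Tw_d n (d - 1) h = f"
proof (cases "f = 0")
  case True
  then show ?thesis using Tw_zero by blast
next
  case False
  then obtain r where "f r \<noteq> 0" by (metis ext zero_fun_apply)
  with assms(3) obtain q where q: "f (Suc q) \<noteq> 0" by (cases r) auto
  have carr: "f r \<in> carr LAs (r + n) (d - 2 * int r)"
    and sym: "\<sigma> permutes {1..r} \<Longrightarrow> act LAs (r + n) (d - 2 * int r) \<sigma> (f r) = f r" for r \<sigma>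
    using f by (auto simp: Tw_simps)
  have d: "d = 1 - int n + int (Suc q)"
    using carr[of "Suc q"] q by (auto simp: LAs_simps split: if_splits)
  have other: "f r = 0" if "r \<noteq> Suc q" for r
    using carr[of r] that by (auto simp: LAs_simps d split: if_splits)
  define v where "v = theta (f (Suc q))"
  have fv: "f (Suc q) = theta v" by (simp add: v_def)
  have v: "supp v \<subseteq> as_words (Suc q + n)"
    using carr[of "Suc q"] by (auto simp: LAs_simps v_def split: if_splits)
  have "relabel \<sigma> v = v" if "\<sigma> permutes {1..Suc q}" for \<sigma>
    using sym[OF that] symmetric_theta[OF v that] unfolding fv by blast
  then obtain P where P: "\<And>u. u \<in> as_words (Suc q + n) \<Longrightarrow> coeff v u = P (pattern (Suc q) u)"
    using pattern_function by blast
  \<comment> \<open>The sign cancels the factor \<open>- sg (q + n)\<close> of \<open>lookup_twisted\<close>.\<close>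
  define F where "F p = sg (int (q + n) + 1) (insert_zero P p)" for p
  define hv where "hv = (\<Sum>u\<in>as_words (q + n). single u (F (pattern q u)))"
  have hv: "coeff hv u = (if u \<in> as_words (q + n) then F (pattern q u) else 0)" for u
    unfolding hv_def lookup_sum lookup_single when_def using finite_as_words[of "q + n"] by simp
  have khv: "supp hv \<subseteq> as_words (q + n)" by (auto simp: in_keys_iff hv split: if_splits)
  define h where "h = (\<lambda>r. if r = q then theta hv else 0)"
  have "relabel \<sigma> hv = hv" if \<sigma>: "\<sigma> permutes {1..q}" for \<sigma>
  proof (rule poly_mapping_eqI)
    fix w
    have \<sigma>': "\<sigma> permutes {1..q + n}" using \<sigma> by (rule permutes_subset) auto
    have "map \<sigma> (map (inv \<sigma>) w) = w" using permutes_inverses(1)[OF \<sigma>] by (simp add: o_def)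
    then have "map (inv \<sigma>) w \<in> as_words (q + n) \<longleftrightarrow> w \<in> as_words (q + n)"
      using map_as_words[OF _ \<sigma>'] map_as_words[OF _ permutes_inv[OF \<sigma>']] by metis
    then show "coeff (relabel \<sigma> hv) w = coeff hv w"
      unfolding lookup_relabel[OF \<sigma>] hv pattern_permute[OF permutes_inv[OF \<sigma>]] by presburger
  qed
  then have "act LAs (q + n) e \<sigma> (theta hv) = theta hv" if "\<sigma> permutes {1..q}" for \<sigma> e
    using symmetric_theta[OF khv that] that by blast
  then have h: "h \<in> carr (Tw LAs \<phi>) n (d - 1)"
    using khv by (auto simp: Tw_simps h_def) (simp add: LAs_simps d)
  have "twisted n q hv = v"
  proof (rule poly_mapping_eqI)
    fix w
    show "coeff (twisted n q hv) w = coeff v w"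
    proof (cases "w \<in> as_words (Suc (q + n))")
      case False
      then have "w \<notin> supp (twisted n q hv)" "w \<notin> supp v"
        using keys_twisted[OF khv] v by auto
      then show ?thesis by (simp add: in_keys_iff)
    next
      case w: True
      then have "1 \<in> set w" by (simp add: as_words_iff)
      then have "0 \<in> set (pattern (Suc q) w)" by (auto simp: pattern_letter_def intro!: image_eqI[of _ _ 1])
      then obtain us L vs where p: "pattern (Suc q) w = us @ replicate L 0 @ vs"
        and us: "0 \<notin> set us" and vs: "vs = [] \<or> hd vs \<noteq> 0" and L: "L > 0"
        by (rule first_zero_block)
      define a b where "a = take (length us) w" and "b = drop (length us) w"
      have ab: "w = a @ b" by (simp add: a_def b_def)
      have pab: "pattern (Suc q) a = us" "pattern (Suc q) b = replicate L 0 @ vs"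
        unfolding a_def b_def take_map[symmetric] drop_map[symmetric] p by simp_all
      \<comment> \<open>A new symmetric letter in front of the first block of zeros: the cocycle condition at this word is
        the one required by \<open>insert_zero_homotopy\<close>.\<close>
      let ?w = "map Suc a @ 1 # map Suc b"
      have w': "?w \<in> as_words (Suc (Suc q + n))"
        using insert_letter_as_words[of a b] w unfolding ab by simp
      have "theta (twisted n (Suc q) v) = 0"
        unfolding Tw_dif_theta(1)[where f = f and r = "Suc q", OF fv v d, symmetric] cocycle by simp
      then have "twisted n (Suc q) v = 0" by (metis theta_linear(1) theta_theta)
      then have "zero_pairs P (pattern (Suc (Suc q)) ?w) = 0"
        using lookup_twisted[OF v P w'] by simp
      then have "zero_pairs P (us @ replicate (Suc L) 0 @ vs) = 0" unfolding pattern_insert pab by simp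
      from insert_zero_homotopy[OF us vs L this] have "zero_pairs (insert_zero P) (pattern (Suc q) w) = P (pattern (Suc q) w)" unfolding p .
      moreover have "coeff v w = P (pattern (Suc q) w)" using P w by simp
      moreover have "coeff (twisted n q hv) w = - sg (int (q + n)) (zero_pairs F (pattern (Suc q) w))"
        by (rule lookup_twisted[OF khv _ w]) (simp add: hv)
      moreover have "- sg (int (q + n)) (zero_pairs F (pattern (Suc q) w)) = zero_pairs (insert_zero P) (pattern (Suc q) w)"
        unfolding F_def zero_pairs_sg sg_sg by (simp add: sg_def)
      ultimately show ?thesis by simp
    qed
  qed
  moreover have "Tw_d n (d - 1) h (Suc q) = theta (twisted n q hv)"
    by (rule Tw_dif_theta(1)[where f = h and r = q]) (use khv in \<open>simp_all add: h_def d\<close>)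
  ultimately have hq: "Tw_d n (d - 1) h (Suc q) = f (Suc q)" by (simp add: fv)
  have "Tw_d n (d - 1) h r = f r" for r
  proof (cases r)
    case 0
    then show ?thesis using assms(3) by (simp add: Tw_dif_0)
  next
    case (Suc k)
    show ?thesis
    proof (cases "k = q")
      case True
      then show ?thesis using hq Suc by simp
    next
      case False
      then show ?thesis unfolding Suc by (simp add: Tw_dif_Suc_zero h_def other)
    qed
  qed
  then have "Tw_d n (d - 1) h = f" by blast
  with h show ?thesis by blast
qed

lemma embed_carr: "v \<in> carr LAs n d \<Longrightarrow> embed v \<in> carr (Tw LAs \<phi>) n d"
  by (auto simp: Tw_simps LAs_act_id[unfolded id_def] permutes_empty id_def)

text \<open>The pattern of a word with one symmetric letter has no pair of adjacent zeros. This is the derivation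
  property of the commutator with that letter.\<close>

lemma Tw_dif_embed:
  assumes "v \<in> carr LAs n d"
  shows "Tw_d n d (embed v) = (0 :: nat \<Rightarrow> 'k::field ncpoly)"
proof
  fix r
  show "Tw_d n d (embed v) r = (0 :: nat \<Rightarrow> 'k ncpoly) r"
  proof (cases r)
    case 0
    then show ?thesis by (simp add: Tw_dif_0)
  next
    case r: (Suc k)
    show ?thesis
    proof (cases "k = 0 \<and> v \<noteq> 0")
      case False
      then show ?thesis unfolding r by (auto intro!: Tw_dif_Suc_zero)
    next
      case True
      then have d: "d = 1 - int n + int 0" and kv: "supp (theta v) \<subseteq> as_words (0 + n)"
        using assms by (auto simp: LAs_simps split: if_splits)
      have v: "embed v 0 = theta (theta v)" by simp
      have "relabel \<sigma> (theta v) = theta v" if "\<sigma> permutes {1..0}" for \<sigma>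
        using that by (simp add: id_def)
      then obtain P where P: "\<And>u. u \<in> as_words (0 + n) \<Longrightarrow> coeff (theta v) u = P (pattern 0 u)"
        using pattern_function by blast
      have "twisted n 0 (theta v) = 0"
      proof (rule poly_mapping_eqI)
        fix w
        show "coeff (twisted n 0 (theta v)) w = coeff 0 w"
        proof (cases "w \<in> as_words (Suc (0 + n))")
          case False
          then have "w \<notin> supp (twisted n 0 (theta v))" using keys_twisted[OF kv] by auto
          then show ?thesis by (simp add: in_keys_iff)
        next
          case w: True
          have len: "length w = Suc n" using length_as_words[OF w] by simp
          have nz: "\<not> (pattern (Suc 0) w ! k = 0 \<and> pattern (Suc 0) w ! Suc k = 0)" if k: "k < n" for k
          proof
            assume "pattern (Suc 0) w ! k = 0 \<and> pattern (Suc 0) w ! Suc k = 0"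
            moreover have "w ! k \<in> {1..Suc n}" "w ! Suc k \<in> {1..Suc n}"
              using w k len nth_mem[of k w] nth_mem[of "Suc k" w] by (auto simp: as_words_iff)
            ultimately have "w ! k = w ! Suc k" using k len by (auto simp: pattern_letter_def split: if_splits)
            then show False using w k len by (auto simp: as_words_iff nth_eq_iff_index_eq)
          qed
          have "zero_pairs P (pattern (Suc 0) w) = (\<Sum>k<n. if pattern (Suc 0) w ! k = 0 \<and> pattern (Suc 0) w ! Suc k = 0
              then sg (int k) (P (delete_nth k (pattern (Suc 0) w))) else 0)"
            by (rule zero_pairs_eq_sum) (simp add: len)
          also have "\<dots> = 0"
          proof (intro sum.neutral ballI if_not_P)
            fix k assume "k \<in> {..<n}"
            then show "\<not> (pattern (Suc 0) w ! k = 0 \<and> pattern (Suc 0) w ! Suc k = 0)"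
              unfolding lessThan_iff by (rule nz)
          qed
          finally have "zero_pairs P (pattern (Suc 0) w) = 0" .
          then show ?thesis using lookup_twisted[OF kv P w] by simp
        qed
      qed
      then have "Tw_d n d (embed v) (Suc 0) = 0"
        using Tw_dif_theta(1)[where f = "embed v" and r = 0, OF v kv d] by (simp add: theta_linear)
      then show ?thesis using True r by simp
    qed
  qed
qed

lemma embed_map:
  "dg_operad_map LAs TwLAs (Tw_embed :: ('k::field ncpoly, _) gmap)"
  unfolding dg_operad_map_def Tw_embed_def Tw_simps(2,3,5,6) LAs_simps(2)
proof (intro conjI allI ballI impI)
  fix n d m e i \<sigma> and v w :: "'k ncpoly"
  show "embed ` carr LAs n d \<subseteq> carr TwLAs n d" using embed_carr by blast
  show "linear_from (carr LAs n d) pscale (\<lambda>c f r. pscale c (f r)) (embed :: 'k ncpoly \<Rightarrow> _)"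
    by (auto simp: linear_from_def fun_eq_iff)
  assume v: "v \<in> carr LAs n d"
  show "embed (ins LAs n d m e i v w) = Tw_ins LAs n d m e i (embed v) (embed w)" if "i \<in> {1..n}"
    by (rule Tw_ins_embed[OF that, symmetric])
  show "embed (act LAs n d \<sigma> v) = act TwLAs n d \<sigma> (embed v)" if "\<sigma> permutes {1..n}"
    by (rule Tw_act_embed[OF that, symmetric])
  show "embed (dif LAs n d v) = Tw_d n d (embed v)"
    unfolding Tw_dif_embed[OF v] by (auto simp: LAs_simps(5))
qed simp

lemma eta_map:
  "dg_operad_map TwLAs LAs (Tw_eta :: (_, 'k::field ncpoly) gmap)"
  unfolding dg_operad_map_def Tw_eta_def Tw_simps(2,3,5,6) LAs_simps(2)
proof (intro conjI allI ballI impI)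
  fix n d m e i \<sigma> and f g :: "nat \<Rightarrow> 'k ncpoly"
  have "f 0 \<in> carr LAs n d" if "f \<in> carr TwLAs n d" for f :: "nat \<Rightarrow> 'k ncpoly"
  proof -
    have "f 0 \<in> carr LAs (0 + n) (d - 2 * int 0)" using that unfolding Tw_simps by blast
    then show ?thesis by simp
  qed
  then show "(\<lambda>f. f 0) ` carr TwLAs n d \<subseteq> (carr LAs n d :: 'k ncpoly set)" by blast
  show "linear_from (carr TwLAs n d) (\<lambda>c f r. pscale c (f r)) pscale (\<lambda>f. f 0 :: 'k ncpoly)"
    by (auto simp: linear_from_def)
  show "Tw_ins LAs n d m e i f g 0 = ins LAs n d m e i (f 0) (g 0)" if "i \<in> {1..n}"
    by (rule Tw_ins_0[OF that])
  show "act TwLAs n d \<sigma> f 0 = act LAs n d \<sigma> (f 0)" if "\<sigma> permutes {1..n}"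
  proof -
    have "\<sigma> 0 = 0" using that by (auto simp: permutes_def)
    then have "(\<lambda>j. if j \<le> 0 then j else 0 + \<sigma> (j - 0)) = \<sigma>" by auto
    then show ?thesis by (simp add: Tw_simps)
  qed
  show "Tw_d n d f 0 = dif LAs n d (f 0)" by (simp add: Tw_dif_0 LAs_simps(5))
qed simp

lemma Tw_carr_group:
  fixes f g :: "nat \<Rightarrow> 'k::field ncpoly"
  assumes "f \<in> carr (Tw LAs \<phi>) n d" "g \<in> carr (Tw LAs \<phi>) n d"
  shows "f + g \<in> carr (Tw LAs \<phi>) n d" "- f \<in> carr (Tw LAs \<phi>) n d" "f - g \<in> carr (Tw LAs \<phi>) n d"
proof -
  have sub: "x + y \<in> carr LAs k e" if "x \<in> carr LAs k e" "y \<in> carr LAs k e" for x y :: "'k ncpoly" and k e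
    using that by (rule free_vs.subspace_add[OF subspace_LAs])
  have subneg: "- x \<in> carr LAs k e" if "x \<in> carr LAs k e" for x :: "'k ncpoly" and k e
    using that by (rule free_vs.subspace_neg[OF subspace_LAs])
  have neg: "act LAs k e \<sigma> (- x) = - act LAs k e \<sigma> x" for k e \<sigma> and x :: "'k ncpoly"
    by (simp add: LAs_simps free_vs.lin_uminus sg_minus)
  have minus: "- h \<in> carr (Tw LAs \<phi>) n d" if "h \<in> carr (Tw LAs \<phi>) n d" for h :: "nat \<Rightarrow> 'k ncpoly"
    using that subneg by (auto simp: Tw_simps neg)
  have plus: "h + k \<in> carr (Tw LAs \<phi>) n d" if "h \<in> carr (Tw LAs \<phi>) n d" "k \<in> carr (Tw LAs \<phi>) n d" for h k :: "nat \<Rightarrow> 'k ncpoly"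
    using that sub by (auto simp: Tw_simps LAs_act_add)
  show "f + g \<in> carr (Tw LAs \<phi>) n d" "- f \<in> carr (Tw LAs \<phi>) n d" using plus minus assms by blast+
  show "f - g \<in> carr (Tw LAs \<phi>) n d" using plus[OF assms(1) minus[OF assms(2)]] by simp
qed

lemma Tw_dif_diff:
  fixes f g :: "nat \<Rightarrow> 'k::field ncpoly"
  shows "Tw_d n d (f - g) = Tw_d n d f - Tw_d n d g"
  using Tw_dif_add[of n d "f - g" g] by simp

text \<open>The differential of \<open>Lam As\<close> is zero, so that its cohomology classes are single elements. The class
  of a cocycle is determined by its component 0, because the difference of two cocycles with the same
  component 0 is exact; every value is attained at an embedded element.\<close>

lemma eta_quasi_isomorphism:
  "quasi_isomorphism TwLAs LAs (Tw_eta :: (_, 'k::field ncpoly) gmap)"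
  unfolding quasi_isomorphism_def
proof (intro conjI allI eta_map)
  fix n d
  let ?T = "TwLAs :: ('k, nat \<Rightarrow> 'k ncpoly) dgop" and ?L = "LAs :: ('k, 'k ncpoly) dgop"
  let ?D = "Tw_d"
  have Q1: "cocycles ?L n d = carr ?L n d" by (auto simp: cocycles_def LAs_simps(5))
  have Q2: "coboundaries ?L n d = {0}" by (auto simp: coboundaries_def LAs_simps(5) image_constant_conv)
    (use zero_in_LAs in blast)+
  have Q3: "cohom_class ?L n d x = {x}" if "x \<in> carr ?L n d" for x
    using that by (auto simp: cohom_class_def Q1 Q2)
  have Q4: "cohomology ?L n d = (\<lambda>x. {x}) ` carr ?L n d"
    unfolding cohomology_def Q1 using Q3 by (intro image_cong) auto
  have Z: "cocycles ?T n d = {f \<in> carr ?T n d. ?D n d f = 0}" by (simp add: cocycles_def Tw_simps(5))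
  have B: "coboundaries ?T n d = ?D n (d - 1) ` carr ?T n (d - 1)" by (simp add: coboundaries_def Tw_simps(5))
  have B0: "0 \<in> coboundaries ?T n d" unfolding B using Tw_zero by (metis image_eqI)
  have Badd: "x + y \<in> coboundaries ?T n d" if "x \<in> coboundaries ?T n d" "y \<in> coboundaries ?T n d" for x y
    using that unfolding B by (auto simp flip: Tw_dif_add intro!: imageI Tw_carr_group)
  have Bev: "b 0 = 0" if "b \<in> coboundaries ?T n d" for b using that unfolding B by (auto simp: Tw_dif_0)
  have ev: "f 0 \<in> carr ?L n d" if "f \<in> carr ?T n d" for f
    using eta_map that unfolding dg_operad_map_def Tw_eta_def by blast
  have exact: "f - g \<in> coboundaries ?T n d" if "f \<in> cocycles ?T n d" "g \<in> cocycles ?T n d" "f 0 = g 0" for f g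
  proof -
    have "f - g \<in> carr ?T n d" "?D n d (f - g) = 0" "(f - g) 0 = 0"
      using that Tw_carr_group(3) by (auto simp: Z Tw_dif_diff)
    from Tw_acyclic[OF this] show ?thesis unfolding B by (metis imageI)
  qed
  have map: "cohom_map ?L Tw_eta n d (cohom_class ?T n d f) = {f 0}" if f: "f \<in> cocycles ?T n d" for f
  proof -
    have "f \<in> cohom_class ?T n d f" using f B0 by (simp add: cohom_class_def)
    moreover have "g 0 = f 0 \<and> g \<in> carr ?T n d" if "g \<in> cohom_class ?T n d f" for g
      using that Bev[of "g - f"] by (auto simp: cohom_class_def Z)
    then have "(\<Union>g\<in>cohom_class ?T n d f. cohom_class ?L n d (g 0)) = (\<Union>g\<in>cohom_class ?T n d f. {f 0})"
      using Q3 ev by (intro SUP_cong refl) metis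
    ultimately have "(\<Union>g\<in>cohom_class ?T n d f. cohom_class ?L n d (g 0)) = {f 0}" by blast
    then show ?thesis by (simp add: cohom_map_def Tw_eta_def)
  qed
  have classes: "cohom_class ?T n d f = cohom_class ?T n d g"
    if fg: "f \<in> cocycles ?T n d" "g \<in> cocycles ?T n d" "f 0 = g 0" for f g
  proof -
    have sub: "cohom_class ?T n d f \<subseteq> cohom_class ?T n d g"
      if "f \<in> cocycles ?T n d" "g \<in> cocycles ?T n d" "f 0 = g 0" for f g
    proof
      fix x assume x: "x \<in> cohom_class ?T n d f"
      then have "(x - f) + (f - g) \<in> coboundaries ?T n d"
        using exact[OF that] by (intro Badd) (auto simp: cohom_class_def)
      then show "x \<in> cohom_class ?T n d g" using x by (auto simp: cohom_class_def)
    qed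
    show ?thesis using sub[OF fg] sub[OF fg(2,1) fg(3)[symmetric]] by blast
  qed
  show "bij_betw (cohom_map ?L Tw_eta n d) (cohomology ?T n d) (cohomology ?L n d)"
  proof (rule bij_betw_imageI)
    show "inj_on (cohom_map ?L Tw_eta n d) (cohomology ?T n d)"
    proof (rule inj_onI)
      fix X Y assume "X \<in> cohomology ?T n d" "Y \<in> cohomology ?T n d"
        and eq: "cohom_map ?L Tw_eta n d X = cohom_map ?L Tw_eta n d Y"
      then obtain f g where f: "f \<in> cocycles ?T n d" "X = cohom_class ?T n d f"
        and g: "g \<in> cocycles ?T n d" "Y = cohom_class ?T n d g" unfolding cohomology_def by blast
      have "f 0 = g 0" using eq unfolding f(2) g(2) map[OF f(1)] map[OF g(1)] by simp
      then show "X = Y" unfolding f(2) g(2) by (rule classes[OF f(1) g(1)])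
    qed
    have section_embed: "embed x \<in> cocycles ?T n d" if "x \<in> carr ?L n d" for x
      using that by (simp add: Z embed_carr Tw_dif_embed)
    have "carr ?L n d \<subseteq> (\<lambda>f. f 0) ` cocycles ?T n d"
    proof
      fix x assume "x \<in> carr ?L n d"
      from section_embed[OF this] show "x \<in> (\<lambda>f. f 0) ` cocycles ?T n d"
        by (intro image_eqI[of _ _ "embed x"]) simp_all
    qed
    moreover have "(\<lambda>f. f 0) ` cocycles ?T n d \<subseteq> carr ?L n d" using ev by (auto simp: Z)
    ultimately have "(\<lambda>f. f 0) ` cocycles ?T n d = carr ?L n d" by blast
    then have "(\<lambda>f. {f 0}) ` cocycles ?T n d = cohomology ?L n d"
      unfolding Q4 image_image[of "\<lambda>x. {x}" "\<lambda>f. f 0", symmetric] by simp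
    moreover have "cohom_map ?L Tw_eta n d ` cohomology ?T n d = (\<lambda>f. {f 0}) ` cocycles ?T n d"
      unfolding cohomology_def[of ?T] image_image by (rule image_cong[OF refl map])
    ultimately show "cohom_map ?L Tw_eta n d ` cohomology ?T n d = cohomology ?L n d" by simp
  qed
qed

theorem proposition5p15:
  shows "Tw_coalgebra (Lam As :: ('k::field_char_0, nat list \<Rightarrow>\<^sub>0 'k) dgop) LLinf_to_LAs Tw_embed
    \<and> homotopy_fixed_point (Lam As :: ('k, nat list \<Rightarrow>\<^sub>0 'k) dgop) LLinf_to_LAs"
proof
  show "Tw_coalgebra (Lam As :: ('k, nat list \<Rightarrow>\<^sub>0 'k) dgop) LLinf_to_LAs Tw_embed"
    unfolding Tw_coalgebra_def
  proof (intro conjI allI ballI)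
    show "dg_operad (LAs :: ('k, nat list \<Rightarrow>\<^sub>0 'k) dgop)" by (rule dg_operad_LAs)
    show "dg_operad_map LLinf (LAs :: ('k, nat list \<Rightarrow>\<^sub>0 'k) dgop) LLinf_to_LAs" by (rule LLinf_to_LAs_map)
    show "dg_operad_map (LAs :: ('k, nat list \<Rightarrow>\<^sub>0 'k) dgop) TwLAs Tw_embed" by (rule embed_map)
    show "gcomp Tw_embed LLinf_to_LAs n d x = (Tw_beta LAs LLinf_to_LAs n d x :: nat \<Rightarrow> nat list \<Rightarrow>\<^sub>0 'k)"
      if "x \<in> carr LLinf n d" for n d x
      using Tw_beta_embed[OF that] by (simp add: gcomp_def Tw_embed_def)
    show "gcomp Tw_eta Tw_embed n d v = v" for n d and v :: "nat list \<Rightarrow>\<^sub>0 'k"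
      by (simp add: gcomp_def Tw_eta_def Tw_embed_def)
    show "gcomp (Tw_map Tw_embed) Tw_embed n d v = gcomp Tw_D Tw_embed n d v" for n d and v :: "nat list \<Rightarrow>\<^sub>0 'k"
      by (auto simp: gcomp_def Tw_map_def Tw_D_def Tw_embed_def fun_eq_iff)
  qed
  show "homotopy_fixed_point (Lam As :: ('k, nat list \<Rightarrow>\<^sub>0 'k) dgop) LLinf_to_LAs"
    unfolding homotopy_fixed_point_def by (rule eta_quasi_isomorphism)
qed

end
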